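(* Let $a$ be a real number with $1/2\le a<1$, and suppose that for every integer $l\ge 1$ and every Dirichlet character $\chi \pmod{l}$, the Dirichlet $L$-function $L(s,\chi)$ has no zeros in the half-plane $\operatorname{Re}(s)>a$. Suppose moreover that for every $\varepsilon>0$, uniformly for all integers $l\ge1$, all $T\ge 10$ and all $1/2\le\sigma\le 1$, \[ \sum_{\chi \pmod{l}} N(\sigma,T,\chi)\ll_{\varepsilon} (lT)^{2-2\sigma+\varepsilon}. \] Then for every $\varepsilon>0$ and all $x\ge 2$, \[ \max_{\alpha\in[0,1]}|S(x,\alpha)|\ll_{\varepsilon} x^{\frac{1+a}{2}+\varepsilon}. \]
   Context: $\mu$ denotes the Möbius function and $e(\alpha)=e^{2\pi i\alpha}$. For real $x\ge 1$ and real $\alpha$, $S(x,\alpha)=\sum_{1\le n\le x}\mu(n)e(\alpha n)$. For a Dirichlet character $\chi$, $1/2\le\sigma\le1$ and $T\ge 10$, $N(\sigma,T,\chi)$ denotes the number of zeros $\rho=\beta+i\gamma$ of $L(s,\chi)$ (counted with multiplicity) with $\sigma\le\beta\le 1$ and $10\le|\gamma|\le T$; the sum $\sum_{\chi \pmod l}$ runs over all Dirichlet characters modulo $l$. The notation $f\ll_\varepsilon g$ means $|f|\le C g$ for a constant $C$ depending only on $\varepsilon$ (and the fixed parameter $a$). *)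

theory Defs
  imports "HOL-Complex_Analysis.Complex_Analysis" "HOL-Computational_Algebra.Computational_Algebra"
begin

definition mu :: "nat \<Rightarrow> int" where
  "mu n = (if n \<ge> 1 \<and> squarefree n then (-1) ^ card (prime_factors n) else 0)"

definition S_mu :: "real \<Rightarrow> real \<Rightarrow> complex" where
  "S_mu x \<alpha> = (\<Sum>n\<in>{1..nat \<lfloor>x\<rfloor>}. of_int (mu n) * exp (2 * pi * \<i> * of_real (\<alpha> * real n)))"

definition dirichlet_char :: "nat \<Rightarrow> (nat \<Rightarrow> complex) \<Rightarrow> bool" where
  "dirichlet_char l \<psi> \<longleftrightarrow>
     (\<forall>m n. \<psi> (m * n) = \<psi> m * \<psi> n) \<and> \<psi> 1 = 1 \<and>
     (\<forall>n. \<psi> (n + l) = \<psi> n) \<and>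
     (\<forall>n. \<psi> n = 0 \<longleftrightarrow> \<not> coprime n l)"

definition dchars :: "nat \<Rightarrow> (nat \<Rightarrow> complex) set" where
  "dchars l = {\<psi>. dirichlet_char l \<psi>}"

definition principal_char :: "nat \<Rightarrow> (nat \<Rightarrow> complex) \<Rightarrow> bool" where
  "principal_char l \<psi> \<longleftrightarrow> (\<forall>n. \<psi> n = (if coprime n l then 1 else 0))"

text \<open>Natural domain of L(s,chi) within Re s > 0: the pole s = 1 is removed for principal chi.\<close>
definition L_dom :: "nat \<Rightarrow> (nat \<Rightarrow> complex) \<Rightarrow> complex set" where
  "L_dom l \<psi> = {s. Re s > 0} - (if principal_char l \<psi> then {1} else {})"

text \<open>L(s,chi) on Re s > 0: the (unique) holomorphic continuation of the Dirichlet series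
  sum_{n \<ge> 1} chi(n) n^(-s) from Re s > 1.\<close>
definition L_fun :: "nat \<Rightarrow> (nat \<Rightarrow> complex) \<Rightarrow> complex \<Rightarrow> complex" where
  "L_fun l \<psi> = (THE f. f holomorphic_on L_dom l \<psi> \<and>
      (\<forall>s. Re s > 1 \<longrightarrow> f s = (\<Sum>n. \<psi> (Suc n) / of_nat (Suc n) powr s)) \<and>
      (\<forall>s. s \<notin> L_dom l \<psi> \<longrightarrow> f s = 0))"

definition N_zeros :: "nat \<Rightarrow> (nat \<Rightarrow> complex) \<Rightarrow> real \<Rightarrow> real \<Rightarrow> real" where
  "N_zeros l \<psi> \<sigma> T = (\<Sum>\<rho>\<in>{\<rho>\<in>L_dom l \<psi>. L_fun l \<psi> \<rho> = 0 \<and> \<sigma> \<le> Re \<rho> \<and> Re \<rho> \<le> 1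
        \<and> 10 \<le> \<bar>Im \<rho>\<bar> \<and> \<bar>Im \<rho>\<bar> \<le> T}. real_of_int (zorder (L_fun l \<psi>) \<rho>))"

end

theory Submission
  imports Defs "HOL-Number_Theory.Number_Theory" "HOL-Analysis.Kronecker_Approximation_Theorem"
begin

text \<open>
  Cauchy's formula for the power series of \<open>(\<Sum>\<mu>(n) e(\<alpha>n) z^n) / (1 - z)\<close> on the circle \<open>\<bar>z\<bar> = exp (-1/x)\<close>
  bounds \<open>S(x, \<alpha>)\<close> by \<open>O(log x)\<close> times a supremum over \<open>\<beta>\<close> of the smoothed sums
  \<open>\<Sum>\<mu>(n) e(\<beta>n) exp (-n/x)\<close>.  Dirichlet approximation gives \<open>\<beta> = h/q + \<theta>\<close> with \<open>q \<le> x^(1-a)\<close> and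
  \<open>q \<bar>\<theta>\<bar> < 1/x^(1-a)\<close> up to a constant; the rational part is expanded in characters modulo \<open>q\<close>,
  while \<open>\<theta>\<close> is absorbed into a complex smoothing parameter \<open>w\<close> with \<open>Re w = 1/x\<close>.

  The remaining sums \<open>\<Sum>\<mu>(n) \<psi>(n) exp (-n w)\<close> are Cahen--Mellin integrals of \<open>\<Gamma>(s) w^(-s) / L(s, \<psi>)\<close>, effectively
  truncated at height about \<open>\<bar>w\<bar> x\<close>.  In every window of unit height the line of integration is moved to
  just right of the nearby zeros, where \<open>1/L\<close> is small by Borel--Caratheodory.  A window with
  edge \<open>\<sigma>\<close> contributes about \<open>x^\<sigma>\<close> times a power of the height; the density hypothesis
  controls the number of such windows over all \<open>\<psi>\<close>, and no edge exceeds \<open>a\<close>.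
\<close>

section \<open>Dirichlet characters\<close>

text \<open>The exponents in the Dirichlet approximation are forced from two sides. The density
  hypothesis counts only zeros of height at least 10; the lower ones are constrained by
  \<open>zero_free\<close> alone and contribute, after normalisation, about sqrt(q) x^a, which is at
  most x^((1+a)/2) exactly when q \<le> x^(1-a). All other zeros enter through V, the modulus times
  the truncation height; q |w| x being O(x^a), V is at most about x^a, and even the line Re s = 1/2
  costs (V x)^(1/2), which is x^((1+a)/2) again. Gauss sums have size about sqrt(q) and the
  expansion in characters divides by \<phi>(q), so the sum over characters is allowed to exceed the
  target by exactly a factor sqrt(q).

  Integrals involving 1/L are treated as increments of a primitive on a simply connected domain, and
  their bounds are mean value estimates along segments. Zeros of L are avoided, never encircled, so
  no residue of 1/L has to be computed.\<close>

lemma mu_1 [simp]: "mu 1 = 1" "mu (Suc 0) = 1"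
  by (simp_all add: mu_def)

lemma mu_0 [simp]: "mu 0 = 0"
  by (simp add: mu_def)

lemma norm_mu_le: "norm (of_int (mu n) :: complex) \<le> 1"
  by (simp add: mu_def norm_power)

lemma mu_mult_coprime:
  assumes "coprime m n"
  shows "mu (m * n) = mu m * mu n"
proof (cases "m = 0 \<or> n = 0")
  case False
  then have "prime_factors (m * n) = prime_factors m \<union> prime_factors n"
    by (simp add: prime_factors_product)
  moreover have "prime_factors m \<inter> prime_factors n = {}"
    using assms by (auto simp: in_prime_factors_iff) (metis coprime_common_divisor not_prime_unit)
  ultimately have "card (prime_factors (m * n)) = card (prime_factors m) + card (prime_factors n)"
    by (simp add: card_Un_disjoint)
  moreover have "squarefree (m * n) \<longleftrightarrow> squarefree m \<and> squarefree n"
    using assms squarefree_mult_coprime squarefree_multD by blast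
  ultimately show ?thesis using False by (auto simp: mu_def power_add)
qed auto

lemma mu_prime: "prime p \<Longrightarrow> mu p = -1"
  by (simp add: mu_def squarefree_prime prime_factorization_prime Suc_leI prime_gt_0_nat)

text \<open>For a prime \<open>p\<close> dividing \<open>n\<close>, multiplication by
  \<open>p\<close> matches the squarefree divisors prime to \<open>p\<close> with the squarefree
  divisors divisible by \<open>p\<close>, and it flips the sign of \<open>mu\<close>.\<close>

lemma sum_mu_divisors:
  assumes n: "n > 1"
  shows "(\<Sum>d | d dvd n. mu d) = 0"
proof -
  obtain p where p: "prime p" "p dvd n" using n prime_factor_nat[of n] by auto
  define D where "D = {d. d dvd n \<and> squarefree d}"
  have fin: "finite {d. d dvd n}" using n by simp
  have "(\<Sum>d | d dvd n. mu d) = (\<Sum>d\<in>D. mu d)"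
    by (rule sum.mono_neutral_right) (use fin in \<open>auto simp: D_def mu_def\<close>)
  also have "D = {d\<in>D. \<not> p dvd d} \<union> {d\<in>D. p dvd d}" by auto
  also have "(\<Sum>d\<in>\<dots>. mu d) = (\<Sum>d\<in>{d\<in>D. \<not> p dvd d}. mu d) + (\<Sum>d\<in>{d\<in>D. p dvd d}. mu d)"
    using fin by (intro sum.union_disjoint) (auto simp: D_def)
  also have "(\<Sum>d\<in>{d\<in>D. p dvd d}. mu d) = (\<Sum>d\<in>{d\<in>D. \<not> p dvd d}. mu (p * d))"
  proof (rule sum.reindex_bij_witness[of _ "\<lambda>d. p * d" "\<lambda>d. d div p"])
    fix d assume d: "d \<in> {d\<in>D. p dvd d}"
    then obtain e where e: "d = p * e" by auto
    have sq: "squarefree (p * e)" using d e by (simp add: D_def)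
    have "\<not> p dvd e"
    proof
      assume "p dvd e"
      then have "p ^ 2 dvd p * e" by (auto simp: power2_eq_square)
      then have "p dvd 1" using sq unfolding squarefree_def by blast
      then show False using p by simp
    qed
    moreover have "e dvd n" "squarefree e" using d e sq
      by (auto simp: D_def intro: dvd_mult_right squarefree_multD)
    ultimately show "d div p \<in> {d\<in>D. \<not> p dvd d}" "p * (d div p) = d"  "mu (p * (d div p)) = mu d"
      using e p by (auto simp: D_def)
  next
    fix d assume d: "d \<in> {d\<in>D. \<not> p dvd d}"
    have cop: "coprime p d" using d p by (simp add: prime_imp_coprime)
    then have "p * d dvd n" using d p by (simp add: D_def divides_mult)
    moreover have "squarefree (p * d)" using cop d p
      by (simp add: D_def squarefree_mult_coprime squarefree_prime)
    ultimately show "p * d \<in> {d\<in>D. p dvd d}" "p * d div p = d" using p by (auto simp: D_def)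
  qed
  also have "\<dots> = (\<Sum>d\<in>{d\<in>D. \<not> p dvd d}. - mu d)"
  proof (rule sum.cong[OF refl])
    fix d assume "d \<in> {d\<in>D. \<not> p dvd d}"
    then have "coprime p d" using p by (simp add: prime_imp_coprime)
    then show "mu (p * d) = - mu d" by (simp add: mu_mult_coprime mu_prime p)
  qed
  finally show ?thesis by (simp add: sum_negf)
qed

section \<open>Elementary properties of characters\<close>

lemma dirichlet_charD:
  assumes "dirichlet_char l \<psi>"
  shows "\<psi> (m * n) = \<psi> m * \<psi> n" "\<psi> 1 = 1" "\<psi> (n + l) = \<psi> n" "\<psi> n = 0 \<longleftrightarrow> \<not> coprime n l"
    "\<psi> (Suc 0) = 1"
  using assms by (auto simp: dirichlet_char_def)

lemma dirichlet_char_period: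
  assumes "dirichlet_char l \<psi>"
  shows "\<psi> (n + k * l) = \<psi> n"
proof (induction k)
  case (Suc k)
  have "\<psi> (n + Suc k * l) = \<psi> ((n + k * l) + l)" by (simp add: algebra_simps)
  then show ?case using Suc dirichlet_charD(3)[OF assms] by metis
qed simp

lemma dirichlet_char_mod:
  assumes "dirichlet_char l \<psi>"
  shows "\<psi> (n mod l) = \<psi> n"
  using dirichlet_char_period[OF assms, of "n mod l" "n div l"] by simp

lemma dirichlet_char_cong:
  assumes "dirichlet_char l \<psi>" "[m = n] (mod l)"
  shows "\<psi> m = \<psi> n"
  using dirichlet_char_mod[OF assms(1)] assms(2) unfolding cong_def by metis

lemma dirichlet_char_power:
  assumes "dirichlet_char l \<psi>"
  shows "\<psi> (n ^ k) = \<psi> n ^ k"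
  by (induction k) (simp_all add: dirichlet_charD[OF assms])

lemma dirichlet_char_root_of_unity:
  assumes "dirichlet_char l \<psi>" "coprime n l"
  shows "\<psi> n ^ totient l = 1"
  using euler_theorem[OF assms(2)] dirichlet_char_cong[OF assms(1), of "n ^ totient l" 1]
  by (simp add: dirichlet_char_power[OF assms(1)] dirichlet_charD[OF assms(1)])

lemma norm_dirichlet_char:
  assumes "dirichlet_char l \<psi>" "l \<ge> 1" "coprime n l"
  shows "norm (\<psi> n) = 1"
proof -
  have "norm (\<psi> n) ^ totient l = 1"
    using dirichlet_char_root_of_unity[OF assms(1,3)] by (metis norm_one norm_power)
  then show ?thesis using assms(2) by (metis norm_ge_zero power_eq_1_iff totient_0_iff not_one_le_zero abs_norm_cancel real_norm_def)
qed

lemma norm_dirichlet_char_le: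
  assumes "dirichlet_char l \<psi>" "l \<ge> 1"
  shows "norm (\<psi> n) \<le> 1"
  using norm_dirichlet_char[OF assms, of n] dirichlet_charD(4)[OF assms(1), of n] by (cases "coprime n l") auto

text \<open>A character is determined by its values on \<open>{..<l}\<close>, and these lie in the
  finite set consisting of 0 and the roots of unity of order dividing
  \<open>totient l\<close>.\<close>

lemma finite_dchars:
  assumes "l \<ge> 1"
  shows "finite (dchars l)"
proof -
  define V where "V = insert 0 {z::complex. z ^ totient l = 1}"
  have "finite {z::complex. z ^ totient l = 1}"
    using assms by (intro finite_roots_unity) (auto simp: Suc_le_eq)
  then have fV: "finite (PiE {..<l} (\<lambda>_. V))" by (intro finite_PiE) (auto simp: V_def)
  have "(\<lambda>\<psi>. restrict \<psi> {..<l}) ` dchars l \<subseteq> PiE {..<l} (\<lambda>_. V)"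
  proof (rule image_subsetI, rule restrict_PiE_iff[THEN iffD2], rule ballI)
    fix \<psi> n assume "\<psi> \<in> dchars l"
    then have "dirichlet_char l \<psi>" by (simp add: dchars_def)
    then show "\<psi> n \<in> V"
      using dirichlet_char_root_of_unity[of l \<psi> n] dirichlet_charD(4)[of l \<psi> n] unfolding V_def by auto
  qed
  moreover have "inj_on (\<lambda>\<psi>. restrict \<psi> {..<l}) (dchars l)"
  proof (rule inj_onI, rule ext)
    fix \<psi> \<phi> n assume h: "\<psi> \<in> dchars l" "\<phi> \<in> dchars l" "restrict \<psi> {..<l} = restrict \<phi> {..<l}"
    have "n mod l < l" using assms by simp
    then have "\<psi> (n mod l) = \<phi> (n mod l)" using h(3) by (metis lessThan_iff restrict_apply')
    then show "\<psi> n = \<phi> n" using h(1,2) dirichlet_char_mod unfolding dchars_def by (metis mem_Collect_eq)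
  qed
  ultimately show ?thesis using fV by (meson finite_image_iff finite_subset)
qed

section \<open>Unit residues and the extension of partial characters\<close>

definition residue_units :: "nat \<Rightarrow> nat set" where
  "residue_units q = {u. u < q \<and> coprime u q}"

lemma finite_residue_units [simp]: "finite (residue_units q)"
  by (simp add: residue_units_def)

lemma mult_bij_residue_units:
  assumes "coprime b q" "q \<ge> 1"
  shows "bij_betw (\<lambda>u. u * b mod q) (residue_units q) (residue_units q)"
proof -
  have inj: "inj_on (\<lambda>u. u * b mod q) (residue_units q)"
  proof (rule inj_onI)
    fix x y assume h: "x \<in> residue_units q" "y \<in> residue_units q" "x * b mod q = y * b mod q"
    then have "[x = y] (mod q)" using assms by (simp add: cong_def[symmetric] cong_mult_rcancel_nat coprime_commute)
    then show "x = y" using h by (simp add: residue_units_def cong_less_modulus_unique_nat)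
  qed
  have "(\<lambda>u. u * b mod q) ` residue_units q \<subseteq> residue_units q"
    using assms by (auto simp: residue_units_def)
  then show ?thesis using inj by (simp add: bij_betw_def endo_inj_surj)
qed

text \<open>A character of a subgroup \<open>H\<close> of \<open>(\<int>/q)\<^sup>\<times>\<close>. Adjoining one generator at a time extends it to all residues, which
  provides enough Dirichlet characters to separate residue classes.\<close>
definition pchar :: "nat \<Rightarrow> nat set \<Rightarrow> (nat \<Rightarrow> complex) \<Rightarrow> bool" where
  "pchar q H \<kappa> \<longleftrightarrow> H \<subseteq> {n. coprime n q} \<and> 1 \<in> H \<and> \<kappa> 1 = 1 \<and>
     (\<forall>m\<in>H. \<forall>n\<in>H. m * n \<in> H \<and> \<kappa> (m * n) = \<kappa> m * \<kappa> n) \<and>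
     (\<forall>m\<in>H. \<forall>n. [m = n] (mod q) \<longrightarrow> n \<in> H \<and> \<kappa> n = \<kappa> m)"

lemma pcharD:
  assumes "pchar q H \<kappa>"
  shows "n \<in> H \<Longrightarrow> coprime n q" "1 \<in> H" "\<kappa> 1 = 1"
    "m \<in> H \<Longrightarrow> n \<in> H \<Longrightarrow> m * n \<in> H" "m \<in> H \<Longrightarrow> n \<in> H \<Longrightarrow> \<kappa> (m * n) = \<kappa> m * \<kappa> n"
    "m \<in> H \<Longrightarrow> [m = n] (mod q) \<Longrightarrow> n \<in> H" "m \<in> H \<Longrightarrow> [m = n] (mod q) \<Longrightarrow> \<kappa> n = \<kappa> m"
  using assms unfolding pchar_def by blast+

lemma pchar_power:
  assumes "pchar q H \<kappa>" "n \<in> H"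
  shows "n ^ k \<in> H" "\<kappa> (n ^ k) = \<kappa> n ^ k"
proof -
  have "n ^ k \<in> H \<and> \<kappa> (n ^ k) = \<kappa> n ^ k"
  proof (induction k)
    case 0
    show ?case using pcharD(2,3)[OF assms(1)] by simp
  next
    case (Suc k)
    then show ?case using pcharD(4,5)[OF assms(1) assms(2), of "n ^ k"] by simp
  qed
  then show "n ^ k \<in> H" "\<kappa> (n ^ k) = \<kappa> n ^ k" by auto
qed

text \<open>Closure under inverses modulo \<open>q\<close>: by Euler's theorem
  \<open>n ^ (totient q - 1)\<close> is an inverse of \<open>n\<close>, and as a power of
  \<open>n\<close> it lies in \<open>H\<close>.\<close>

lemma pchar_cancel:
  assumes "pchar q H \<kappa>" "n \<in> H" "n * k \<in> H" "q \<ge> 1"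
  shows "k \<in> H"
proof -
  have n: "coprime n q" using pcharD(1)[OF assms(1,2)] .
  have t: "totient q > 0" using assms(4) by simp
  have "n ^ (totient q - 1) * (n * k) \<in> H"
    using pcharD(4)[OF assms(1) pchar_power(1)[OF assms(1,2)] assms(3)] .
  moreover have "n ^ (totient q - 1) * (n * k) = n ^ totient q * k"
    using t by (metis Suc_diff_1 mult.assoc power_Suc2)
  moreover have "[n ^ totient q * k = 1 * k] (mod q)"
    by (intro cong_mult euler_theorem n cong_refl)
  ultimately show ?thesis using pcharD(6)[OF assms(1)] by (metis mult_1)
qed

lemma pchar_nonzero:
  assumes "pchar q H \<kappa>" "n \<in> H" "q \<ge> 1"
  shows "\<kappa> n \<noteq> 0"
proof
  assume z: "\<kappa> n = 0"
  have "\<kappa> (n ^ totient q) = \<kappa> 1"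
    using pcharD(7)[OF assms(1) pcharD(2)[OF assms(1)] cong_sym[OF euler_theorem[OF pcharD(1)[OF assms(1,2)]]]] .
  then have "\<kappa> n ^ totient q = 1"
    using pchar_power(2)[OF assms(1,2), of "totient q"] pcharD(3)[OF assms(1)] by simp
  then show False using z assms(3) by (simp add: power_0_left)
qed

text \<open>\<open>m\<close> is the order of \<open>g\<close> modulo \<open>H\<close>, so the only
  constraint on the new value \<open>z\<close> at \<open>g\<close> is
  \<open>z ^ m = \<kappa> (g ^ m)\<close>. The freedom in choosing \<open>z\<close> is what
  separates residue classes later.\<close>

lemma pchar_extend:
  assumes pc: "pchar q H \<kappa>" and q: "q \<ge> 1" and g: "coprime g q"
    and m: "m > 0" "g ^ m \<in> H" "\<And>k. 0 < k \<Longrightarrow> k < m \<Longrightarrow> g ^ k \<notin> H"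
    and z: "z ^ m = \<kappa> (g ^ m)" "z \<noteq> 0"
  obtains H' \<kappa>' where "pchar q H' \<kappa>'" "H \<subseteq> H'" "g \<in> H'" "\<kappa>' g = z" "\<And>n. n \<in> H \<Longrightarrow> \<kappa>' n = \<kappa> n"
proof -
  have mul: "x * y \<in> H" "\<kappa> (x * y) = \<kappa> x * \<kappa> y" if "x \<in> H" "y \<in> H" for x y
    using pcharD(4,5)[OF pc that] by auto
  \<comment> \<open>The exponents \<open>k\<close> with \<open>g ^ k \<in> H\<close> are multiples
    of \<open>m\<close>: cancelling a power of \<open>g ^ m\<close> leaves
    \<open>g ^ (k mod m)\<close> in \<open>H\<close>, against the minimality of
    \<open>m\<close>.\<close>
  have gk: "\<kappa> (g ^ k) = z ^ k" if "g ^ k \<in> H" for k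
  proof -
    have "g ^ (m * (k div m)) * g ^ (k mod m) \<in> H" using that by (simp flip: power_add)
    moreover have H1: "g ^ (m * (k div m)) \<in> H" unfolding power_mult using pchar_power(1)[OF pc m(2)] .
    ultimately have "g ^ (k mod m) \<in> H" using pchar_cancel[OF pc _ _ q] by blast
    then have "k mod m = 0" using m by (metis mod_less_divisor neq0_conv)
    then have k: "k = m * (k div m)" by (metis add.right_neutral mult_div_mod_eq)
    have "\<kappa> (g ^ (m * (k div m))) = z ^ (m * (k div m))"
      unfolding power_mult z(1) using pchar_power(2)[OF pc m(2)] .
    then show ?thesis using k by metis
  qed
  \<comment> \<open>The group generated by \<open>H\<close> and \<open>g\<close>. As
    \<open>g\<close> has finite order modulo \<open>q\<close>, natural exponents suffice. By
    \<open>wd0\<close> and \<open>wd\<close> the value does not depend on the exponent chosen by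
    \<open>SOME\<close>.\<close>
  define H' where "H' = {n. coprime n q \<and> (\<exists>i. n * g ^ i \<in> H)}"
  define \<kappa>' where "\<kappa>' = (\<lambda>n. let i = (SOME i. n * g ^ i \<in> H) in \<kappa> (n * g ^ i) / z ^ i)"
  have wd0: "\<kappa> (n * g ^ i) / z ^ i = \<kappa> (n * g ^ j) / z ^ j" if h: "n * g ^ i \<in> H" "n * g ^ j \<in> H" "i \<le> j" for n i j
  proof -
    obtain k where j: "j = i + k" using h(3) le_Suc_ex by blast
    have e: "n * g ^ j = (n * g ^ i) * g ^ k" by (simp add: j power_add)
    then have "g ^ k \<in> H" using pchar_cancel[OF pc h(1) _ q] h(2) by metis
    then show ?thesis using mul(2)[OF h(1)] gk z(2) by (simp add: e) (simp add: j power_add field_simps)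
  qed
  have wd: "\<kappa>' n = \<kappa> (n * g ^ i) / z ^ i" if "n * g ^ i \<in> H" for n i
  proof -
    define j where "j = (SOME i. n * g ^ i \<in> H)"
    have j: "n * g ^ j \<in> H" unfolding j_def using that by (rule someI)
    have "\<kappa>' n = \<kappa> (n * g ^ j) / z ^ j" by (simp add: \<kappa>'_def j_def Let_def)
    also have "\<dots> = \<kappa> (n * g ^ i) / z ^ i" using wd0[OF that j] wd0[OF j that] by (metis linear)
    finally show ?thesis .
  qed
  have ext: "\<kappa>' n = \<kappa> n" if "n \<in> H" for n using wd[of n 0] that by simp
  have sub: "H \<subseteq> H'"
  proof
    fix n assume n: "n \<in> H"
    then have "n * g ^ 0 \<in> H" by simp
    moreover have "coprime n q" using pcharD(1)[OF pc n] .
    ultimately show "n \<in> H'" unfolding H'_def by blast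
  qed
  have gm: "g * g ^ (m - 1) \<in> H" "g * g ^ (m - 1) = g ^ m" using m(1,2) by (simp_all flip: power_Suc)
  have "\<kappa>' g = z ^ m / z ^ (m - 1)" using wd[OF gm(1)] z(1) gm(2) by simp
  also have "\<dots> = z" using z(2) m(1) by (simp add: field_simps flip: power_Suc)
  finally have \<kappa>'g: "\<kappa>' g = z" .
  have gH: "g \<in> H'" using gm(1) g unfolding H'_def by blast
  have "pchar q H' \<kappa>'"
    unfolding pchar_def
  proof (intro conjI ballI allI impI)
    show "H' \<subseteq> {n. coprime n q}" by (auto simp: H'_def)
    show "1 \<in> H'" "\<kappa>' 1 = 1" using sub ext pcharD(2,3)[OF pc] by auto
    fix a assume a: "a \<in> H'"
    then obtain i where i: "a * g ^ i \<in> H" "coprime a q" by (auto simp: H'_def)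
    { fix b assume "b \<in> H'"
      then obtain j where j: "b * g ^ j \<in> H" "coprime b q" by (auto simp: H'_def)
      have e: "(a * g ^ i) * (b * g ^ j) = (a * b) * g ^ (i + j)" by (simp add: power_add mult_ac)
      have ij: "(a * b) * g ^ (i + j) \<in> H" using mul(1)[OF i(1) j(1)] e by simp
      show "a * b \<in> H'" using ij i j unfolding H'_def by auto
      have "\<kappa> ((a * b) * g ^ (i + j)) = \<kappa> (a * g ^ i) * \<kappa> (b * g ^ j)" using mul(2)[OF i(1) j(1)] e by simp
      then show "\<kappa>' (a * b) = \<kappa>' a * \<kappa>' b" by (simp add: wd[OF ij] wd[OF i(1)] wd[OF j(1)] power_add)
    }
    { fix b assume ab: "[a = b] (mod q)"
      then have "[a * g ^ i = b * g ^ i] (mod q)" by (intro cong_mult cong_refl)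
      then have b: "b * g ^ i \<in> H" "\<kappa> (b * g ^ i) = \<kappa> (a * g ^ i)"
        by (rule pcharD(6)[OF pc i(1)], rule pcharD(7)[OF pc i(1)])
      have "coprime b q" using i(2) ab by (metis cong_imp_coprime)
      then show "b \<in> H'" using b unfolding H'_def by blast
      show "\<kappa>' b = \<kappa>' a" using wd[OF b(1)] wd[OF i(1)] b(2) by simp
    }
  qed
  then show ?thesis using that sub gH \<kappa>'g ext by blast
qed

lemma pchar_order:
  assumes "pchar q H \<kappa>" "q \<ge> 1" "coprime g q"
  obtains m where "m > 0" "g ^ m \<in> H" "\<And>k. 0 < k \<Longrightarrow> k < m \<Longrightarrow> g ^ k \<notin> H"
proof -
  have "g ^ totient q \<in> H"
    using pcharD(6)[OF assms(1) pcharD(2)[OF assms(1)] cong_sym[OF euler_theorem[OF assms(3)]]] .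
  then have ex: "\<exists>m. m > 0 \<and> g ^ m \<in> H" using assms(2) by (metis totient_gt_0_iff less_le_trans zero_less_one)
  define m where "m = (LEAST m. m > 0 \<and> g ^ m \<in> H)"
  have "m > 0 \<and> g ^ m \<in> H" unfolding m_def by (rule LeastI_ex[OF ex])
  moreover have "g ^ k \<notin> H" if "0 < k" "k < m" for k
    using that not_less_Least unfolding m_def by blast
  ultimately show ?thesis using that by blast
qed

lemma complex_root_exists:
  fixes c :: complex
  assumes "c \<noteq> 0" "m > 0"
  obtains z where "z ^ m = c" "z \<noteq> 0"
proof -
  have "exp (Ln c / of_nat m) ^ m = exp (of_nat m * (Ln c / of_nat m))" by (rule exp_of_nat_mult[symmetric])
  then have "exp (Ln c / of_nat m) ^ m = c" using assms by simp
  then show ?thesis using that by simp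
qed

text \<open>Induction on the number of unit residues outside \<open>H\<close>. As \<open>H\<close>
  is a union of residue classes, adjoining a unit \<open>g\<close> outside \<open>H\<close> removes
  at least the residue \<open>g mod q\<close> from that set.\<close>

lemma pchar_extend_full:
  assumes "pchar q H \<kappa>" "q \<ge> 1"
  shows "\<exists>\<psi>. dirichlet_char q \<psi> \<and> (\<forall>n\<in>H. \<psi> n = \<kappa> n)"
  using assms
proof (induction "card (residue_units q - H)" arbitrary: H \<kappa> rule: less_induct)
  case less
  note pc = less.prems(1) and q = less.prems(2)
  show ?case
  proof (cases "H = {n. coprime n q}")
    case True
    define \<psi> where "\<psi> = (\<lambda>n. if coprime n q then \<kappa> n else 0)"
    have "dirichlet_char q \<psi>"
      unfolding dirichlet_char_def
    proof (intro conjI allI)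
      show "\<psi> (m * n) = \<psi> m * \<psi> n" for m n using pcharD(5)[OF pc] True by (auto simp: \<psi>_def)
      show "\<psi> 1 = 1" using pcharD(3)[OF pc] by (simp add: \<psi>_def)
      show "\<psi> (n + q) = \<psi> n" for n
      proof -
        have "[n = n + q] (mod q)" by (simp add: cong_def)
        then have "coprime n q \<Longrightarrow> \<kappa> (n + q) = \<kappa> n" using pcharD(7)[OF pc] True by blast
        moreover have "coprime (n + q) q = coprime n q" by (metis coprime_iff_gcd_eq_1 gcd_add1)
        ultimately show ?thesis by (simp add: \<psi>_def)
      qed
      show "\<psi> n = 0 \<longleftrightarrow> \<not> coprime n q" for n
        using pchar_nonzero[OF pc _ q] True by (auto simp: \<psi>_def)
    qed
    moreover have "\<forall>n\<in>H. \<psi> n = \<kappa> n" using True by (simp add: \<psi>_def)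
    ultimately show ?thesis by blast
  next
    case False
    then obtain g where g: "coprime g q" "g \<notin> H" using pcharD(1)[OF pc] by blast
    obtain m where m: "m > 0" "g ^ m \<in> H" "\<And>k. 0 < k \<Longrightarrow> k < m \<Longrightarrow> g ^ k \<notin> H"
      using pchar_order[OF pc q g(1)] by blast
    obtain z where z: "z ^ m = \<kappa> (g ^ m)" "z \<noteq> 0"
      using complex_root_exists[OF pchar_nonzero[OF pc m(2) q] m(1)] by blast
    obtain H' \<kappa>' where H': "pchar q H' \<kappa>'" "H \<subseteq> H'" "g \<in> H'" "\<And>n. n \<in> H \<Longrightarrow> \<kappa>' n = \<kappa> n"
      using pchar_extend[OF pc q g(1) m z] by blast
    have gc: "[g mod q = g] (mod q)" by (simp add: cong_def)
    have "g mod q \<in> residue_units q - H"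
      using g q pcharD(6)[OF pc _ gc] by (auto simp: residue_units_def)
    moreover have "g mod q \<in> H'" using pcharD(6)[OF H'(1,3) cong_sym[OF gc]] .
    ultimately have "residue_units q - H' \<subset> residue_units q - H" using H'(2) by blast
    then have "card (residue_units q - H') < card (residue_units q - H)" by (intro psubset_card_mono) auto
    from less.hyps[OF this H'(1) q] obtain \<psi> where "dirichlet_char q \<psi>" "\<forall>n\<in>H'. \<psi> n = \<kappa>' n" by blast
    then show ?thesis using H'(2,4) by (metis subsetD)
  qed
qed

text \<open>Extend the trivial character on the class of 1. There \<open>m\<close> is the order of
  \<open>a\<close> modulo \<open>q\<close>, at least 2 by assumption, so a primitive root of unity
  of order \<open>m\<close> is an admissible value at \<open>a\<close>.\<close>

lemma dirichlet_char_separates: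
  assumes q: "q \<ge> 1" and a: "coprime a q" "\<not> [a = 1] (mod q)"
  obtains \<psi> where "dirichlet_char q \<psi>" "\<psi> a \<noteq> 1"
proof -
  define H where "H = {n. [n = 1] (mod q)}"
  have pc: "pchar q H (\<lambda>_. 1)"
    unfolding pchar_def H_def
  proof (intro conjI ballI allI impI subsetI)
    show "x \<in> {n. coprime n q}" if "x \<in> {n. [n = 1] (mod q)}" for x
      using that cong_imp_coprime[OF cong_sym, of x 1 q] by simp
    show "m * n \<in> {n. [n = 1] (mod q)}" if "m \<in> {n. [n = 1] (mod q)}" "n \<in> {n. [n = 1] (mod q)}" for m n
      using that cong_mult[of m 1 q n 1] by simp
    show "n \<in> {n. [n = 1] (mod q)}" if "m \<in> {n. [n = 1] (mod q)}" "[m = n] (mod q)" for m n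
      using that by (auto intro: cong_trans cong_sym)
  qed auto
  obtain m where m: "m > 0" "a ^ m \<in> H" "\<And>k. 0 < k \<Longrightarrow> k < m \<Longrightarrow> a ^ k \<notin> H"
    using pchar_order[OF pc q a(1)] by blast
  have "m \<noteq> 1" using m(2) a(2) by (auto simp: H_def)
  then have m2: "m \<ge> 2" using m(1) by simp
  define z where "z = cis (2 * pi / real m)"
  have "z ^ m = cis (real m * (2 * pi / real m))" unfolding z_def by (rule Complex.DeMoivre)
  then have zm: "z ^ m = 1" using m(1) by simp
  have z1: "z \<noteq> 1"
  proof
    assume "z = 1"
    then have "cos (2 * pi / real m) = 1" by (simp add: z_def complex_eq_iff)
    then obtain k :: int where "2 * pi / real m = of_int k * 2 * pi" using cos_one_2pi_int[of "2 * pi / real m"] by auto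
    then have "of_int k * real m = 1" using m(1) by (simp add: field_simps)
    then have "k * int m = 1" by (metis of_int_1 of_int_eq_iff of_int_mult of_int_of_nat_eq)
    then show False using m2 by (simp add: zmult_eq_1_iff)
  qed
  have z: "z ^ m = (\<lambda>_. 1::complex) (a ^ m)" "z \<noteq> 0" using zm by (auto simp: z_def)
  obtain H' \<kappa>' where H': "pchar q H' \<kappa>'" "a \<in> H'" "\<kappa>' a = z"
    using pchar_extend[OF pc q a(1) m z] by blast
  obtain \<psi> where "dirichlet_char q \<psi>" "\<forall>n\<in>H'. \<psi> n = \<kappa>' n"
    using pchar_extend_full[OF H'(1) q] by blast
  then show ?thesis using that H' z1 by metis
qed

section \<open>Additive characters, orthogonality and Gauss sums\<close>

definition e1 :: "real \<Rightarrow> complex" where "e1 x = cis (2 * pi * x)"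

lemma e1_add: "e1 (x + y) = e1 x * e1 y"
  by (simp add: e1_def cis_mult distrib_left)

lemma norm_e1 [simp]: "norm (e1 x) = 1"
  by (simp add: e1_def)

lemma e1_int [simp]: "e1 (of_int k) = 1"
  by (simp add: e1_def cis_multiple_2pi)

lemma e1_0 [simp]: "e1 0 = 1"
  by (simp add: e1_def)

lemma cnj_e1: "cnj (e1 x) = e1 (- x)"
  by (simp add: e1_def cis_cnj)

lemma e1_cong:
  assumes "[a = b] (mod int q)"
  shows "e1 (of_int a / real q) = e1 (of_int b / real q)"
proof (cases "q = 0")
  case False
  obtain k where "a = b + int q * k" using assms by (metis cong_iff_lin cong_sym)
  then have "of_int a / real q = of_int b / real q + of_int k"
    using False by (simp add: field_simps)
  then show ?thesis by (simp add: e1_add)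
qed simp

lemma sum_e1:
  assumes q: "q \<ge> 1"
  shows "(\<Sum>v<q. e1 (of_int (c * int v) / real q)) = (if int q dvd c then of_nat q else 0)"
proof (cases "int q dvd c")
  case True
  have "e1 (of_int (c * int v) / real q) = 1" for v
    using e1_cong[of "c * int v" 0 q] True by (simp add: cong_0_iff)
  then show ?thesis using True by simp
next
  case False
  define z where "z = e1 (of_int c / real q)"
  have pw: "z ^ v = e1 (of_int (c * int v) / real q)" for v
    unfolding z_def e1_def Complex.DeMoivre by (simp add: field_simps)
  have "z \<noteq> 1"
  proof
    assume "z = 1"
    then have "cos (2 * pi * (of_int c / real q)) = 1" by (simp add: z_def e1_def complex_eq_iff)
    then obtain k :: int where "2 * pi * (of_int c / real q) = of_int k * 2 * pi"
      using cos_one_2pi_int by blast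
    then have "of_int c = of_int k * real q" using q by (simp add: field_simps)
    then have "c = k * int q" by (metis of_int_eq_iff of_int_mult of_int_of_nat_eq)
    then show False using False by simp
  qed
  moreover have "z ^ q = 1" unfolding pw using q by simp
  ultimately have "(\<Sum>v<q. z ^ v) = 0" using geometric_sum[of z q] by simp
  then show ?thesis using False by (simp add: pw)
qed

lemma card_residue_units_pos: "q \<ge> 1 \<Longrightarrow> card (residue_units q) > 0"
proof -
  assume q: "q \<ge> 1"
  have "1 mod q \<in> residue_units q" using q by (auto simp: residue_units_def)
  then show ?thesis using card_gt_0_iff finite_residue_units by blast
qed

lemma sum_residue_units_mult:
  assumes "coprime b q" "q \<ge> 1" "\<And>m n. [m = n] (mod q) \<Longrightarrow> f m = f n"
  shows "(\<Sum>u\<in>residue_units q. f (u * b)) = (\<Sum>u\<in>residue_units q. f u)"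
proof -
  have "(\<Sum>u\<in>residue_units q. f (u * b)) = (\<Sum>u\<in>residue_units q. f (u * b mod q))"
    by (intro sum.cong refl assms(3)) (simp add: cong_def)
  also have "\<dots> = (\<Sum>u\<in>residue_units q. f u)"
    by (rule sum.reindex_bij_betw[OF mult_bij_residue_units[OF assms(1,2)]])
  finally show ?thesis .
qed

lemma principal_charI:
  assumes "dirichlet_char q \<psi>" "q \<ge> 1" "\<And>u. u \<in> residue_units q \<Longrightarrow> \<psi> u = 1"
  shows "principal_char q \<psi>"
  unfolding principal_char_def
proof
  fix n
  show "\<psi> n = (if coprime n q then 1 else 0)"
  proof (cases "coprime n q")
    case True
    then have "n mod q \<in> residue_units q" using assms(2) by (simp add: residue_units_def)
    then show ?thesis using True assms(3) dirichlet_char_mod[OF assms(1), of n] by simp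
  qed (use dirichlet_charD(4)[OF assms(1)] in auto)
qed

lemma dirichlet_char_principal:
  assumes "q \<ge> 1" "principal_char q \<psi>"
  shows "dirichlet_char q \<psi>"
proof -
  have "coprime (n + q) q = coprime n q" for n by (metis coprime_iff_gcd_eq_1 gcd_add1)
  then show ?thesis using assms(2) by (simp add: dirichlet_char_def principal_char_def)
qed

lemma sum_nonprincipal_char:
  assumes "dirichlet_char q \<psi>" "q \<ge> 1" "\<not> principal_char q \<psi>"
  shows "(\<Sum>u\<in>residue_units q. \<psi> u) = 0"
proof -
  obtain b where b: "b \<in> residue_units q" "\<psi> b \<noteq> 1" using principal_charI[OF assms(1,2)] assms(3) by blast
  have "(\<Sum>u\<in>residue_units q. \<psi> u) = (\<Sum>u\<in>residue_units q. \<psi> (u * b))"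
    using b assms by (intro sum_residue_units_mult[symmetric] dirichlet_char_cong) (auto simp: residue_units_def)
  also have "\<dots> = (\<Sum>u\<in>residue_units q. \<psi> u) * \<psi> b"
    by (simp add: dirichlet_charD[OF assms(1)] sum_distrib_right)
  finally show ?thesis using b(2) by simp
qed

lemma dirichlet_char_mult:
  assumes "dirichlet_char q \<psi>" "dirichlet_char q \<phi>"
  shows "dirichlet_char q (\<lambda>n. \<psi> n * \<phi> n)"
  using assms unfolding dirichlet_char_def by simp

lemma dirichlet_char_cnj:
  assumes "dirichlet_char q \<psi>"
  shows "dirichlet_char q (\<lambda>n. cnj (\<psi> n))"
  using assms unfolding dirichlet_char_def by simp

lemma cnj_dirichlet_char:
  assumes "dirichlet_char q \<psi>" "q \<ge> 1" "coprime n q"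
  shows "cnj (\<psi> n) * \<psi> n = 1"
  using norm_dirichlet_char[OF assms] by (metis complex_norm_square mult.commute of_real_1 power_one)

text \<open>Multiplication by a character \<open>\<phi>\<close> with
  \<open>\<phi> a \<noteq> 1\<close> permutes \<open>dchars q\<close>, so the sum equals
  \<open>\<phi> a\<close> times itself.\<close>

lemma sum_dchars_eq_0:
  assumes q: "q \<ge> 1" and a: "coprime a q" "\<not> [a = 1] (mod q)"
  shows "(\<Sum>\<psi>\<in>dchars q. \<psi> a) = 0"
proof -
  obtain \<phi> where \<phi>: "dirichlet_char q \<phi>" "\<phi> a \<noteq> 1" using dirichlet_char_separates[OF q a] .
  have inv: "cnj (\<phi> n) * (\<phi> n * \<psi> n) = \<psi> n" "\<phi> n * (cnj (\<phi> n) * \<psi> n) = \<psi> n" if "\<psi> \<in> dchars q" for n \<psi>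
  proof -
    show 1: "cnj (\<phi> n) * (\<phi> n * \<psi> n) = \<psi> n"
    proof (cases "coprime n q")
      case True then show ?thesis using cnj_dirichlet_char[OF \<phi>(1) q True] by (simp add: mult.assoc[symmetric])
    next
      case False then show ?thesis using that dirichlet_charD(4)[of q \<psi> n] by (simp add: dchars_def)
    qed
    then show "\<phi> n * (cnj (\<phi> n) * \<psi> n) = \<psi> n" by (simp add: mult_ac)
  qed
  have "(\<Sum>\<psi>\<in>dchars q. \<psi> a) = (\<Sum>\<psi>\<in>dchars q. \<phi> a * \<psi> a)"
  proof (rule sum.reindex_bij_witness[of _ "\<lambda>\<psi> n. \<phi> n * \<psi> n" "\<lambda>\<psi> n. cnj (\<phi> n) * \<psi> n"])
    fix \<psi> assume "\<psi> \<in> dchars q"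
    then show "(\<lambda>n. \<phi> n * (cnj (\<phi> n) * \<psi> n)) = \<psi>" "(\<lambda>n. cnj (\<phi> n) * (\<phi> n * \<psi> n)) = \<psi>"
      "(\<lambda>n. \<phi> n * \<psi> n) \<in> dchars q" "(\<lambda>n. cnj (\<phi> n) * \<psi> n) \<in> dchars q"
      "\<phi> a * (cnj (\<phi> a) * \<psi> a) = \<psi> a"
      using inv dirichlet_char_mult[OF \<phi>(1)] dirichlet_char_mult[OF dirichlet_char_cnj[OF \<phi>(1)]]
      by (auto simp: dchars_def)
  qed
  also have "\<dots> = \<phi> a * (\<Sum>\<psi>\<in>dchars q. \<psi> a)" by (simp add: sum_distrib_left)
  finally show ?thesis using \<phi>(2) by simp
qed

text \<open>The double sum of \<psi>(u) over all characters and unit residues is evaluated in both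
  orders; each orthogonality relation leaves a single term.\<close>

lemma card_dchars:
  assumes q: "q \<ge> 1"
  shows "card (dchars q) = card (residue_units q)"
proof -
  define p where "p = (\<lambda>n. if coprime n q then 1 else (0::complex))"
  have pp: "principal_char q p" by (simp add: principal_char_def p_def)
  have pd: "p \<in> dchars q" using dirichlet_char_principal[OF q pp] by (simp add: dchars_def)
  have only: "\<not> principal_char q \<psi>" if "\<psi> \<noteq> p" for \<psi>
    using that unfolding principal_char_def p_def by (auto simp: fun_eq_iff)
  have one: "1 mod q \<in> residue_units q" using q by (auto simp: residue_units_def)
  have "(\<Sum>u\<in>residue_units q. \<Sum>\<psi>\<in>dchars q. \<psi> u) = (\<Sum>u\<in>residue_units q. if u = 1 mod q then of_nat (card (dchars q)) else 0)"
  proof (rule sum.cong[OF refl])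
    fix u assume u: "u \<in> residue_units q"
    show "(\<Sum>\<psi>\<in>dchars q. \<psi> u) = (if u = 1 mod q then of_nat (card (dchars q)) else 0)"
    proof (cases "u = 1 mod q")
      case True
      have "\<psi> u = 1" if "\<psi> \<in> dchars q" for \<psi>
        using that dirichlet_char_mod[of q \<psi> 1] dirichlet_charD(2)[of q \<psi>] by (simp add: True dchars_def)
      then have "(\<Sum>\<psi>\<in>dchars q. \<psi> u) = (\<Sum>\<psi>\<in>dchars q. 1)" by (intro sum.cong refl)
      then have "(\<Sum>\<psi>\<in>dchars q. \<psi> u) = of_nat (card (dchars q))" by simp
      then show ?thesis unfolding if_P[OF True] .
    next
      case False
      then have "\<not> [u = 1] (mod q)" using u by (auto simp: cong_def residue_units_def)
      then show ?thesis using sum_dchars_eq_0[OF q] u False by (simp add: residue_units_def)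
    qed
  qed
  also have "\<dots> = of_nat (card (dchars q))" using one by simp
  finally have A: "(\<Sum>u\<in>residue_units q. \<Sum>\<psi>\<in>dchars q. \<psi> u) = of_nat (card (dchars q))" .
  have "(\<Sum>\<psi>\<in>dchars q. \<Sum>u\<in>residue_units q. \<psi> u) = (\<Sum>\<psi>\<in>dchars q. if \<psi> = p then of_nat (card (residue_units q)) else 0)"
  proof (rule sum.cong[OF refl])
    fix \<psi> assume "\<psi> \<in> dchars q"
    then show "(\<Sum>u\<in>residue_units q. \<psi> u) = (if \<psi> = p then of_nat (card (residue_units q)) else 0)"
      using sum_nonprincipal_char[OF _ q only] by (auto simp: dchars_def p_def residue_units_def)
  qed
  also have "\<dots> = of_nat (card (residue_units q))" using pd finite_dchars[OF q] by simp
  finally have B: "(\<Sum>\<psi>\<in>dchars q. \<Sum>u\<in>residue_units q. \<psi> u) = of_nat (card (residue_units q))" .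
  have "(\<Sum>u\<in>residue_units q. \<Sum>\<psi>\<in>dchars q. \<psi> u) = (\<Sum>\<psi>\<in>dchars q. \<Sum>u\<in>residue_units q. \<psi> u)"
    by (rule sum.swap)
  then have "of_nat (card (dchars q)) = (of_nat (card (residue_units q)) :: complex)"
    unfolding A B .
  then show ?thesis by (metis of_nat_eq_iff)
qed

text \<open>A Fourier coefficient on the unit group without the factor 1/\<phi>(q), which
  \<open>char_expansion\<close> puts back. For an additive character \<open>f\<close> it is a Gauss
  sum.\<close>

definition char_coeff :: "nat \<Rightarrow> (nat \<Rightarrow> complex) \<Rightarrow> (nat \<Rightarrow> complex) \<Rightarrow> complex" where
  "char_coeff q f \<psi> = (\<Sum>u\<in>residue_units q. cnj (\<psi> u) * f u)"

lemma sum_dchars_orthogonal: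
  assumes q: "q \<ge> 1" and u: "u \<in> residue_units q" and n: "coprime n q"
  shows "(\<Sum>\<psi>\<in>dchars q. cnj (\<psi> u) * \<psi> n) = (if u = n mod q then of_nat (card (residue_units q)) else 0)"
proof (cases "u = n mod q")
  case True
  have "cnj (\<psi> u) * \<psi> n = 1" if "\<psi> \<in> dchars q" for \<psi>
    using that cnj_dirichlet_char[OF _ q n, of \<psi>] dirichlet_char_mod[of q \<psi> n] by (simp add: True dchars_def)
  then show ?thesis using True by (simp add: card_dchars[OF q])
next
  case False
  have cu: "coprime u q" using u by (simp add: residue_units_def)
  \<comment> \<open>\<open>v\<close> inverts \<open>u\<close>, so the conjugate of \<psi>(u) is
    \<psi>(v), and the sum runs over \<psi>(v n) with v n not congruent to 1.\<close>
  obtain v where v: "[u * v = 1] (mod q)" 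
    using cong_solve_coprime_nat[OF cu] unfolding One_nat_def by blast
  then have cv: "coprime v q" using cong_imp_coprime[OF cong_sym[OF v]] by simp
  have "cnj (\<psi> u) * \<psi> n = \<psi> (v * n)" if "\<psi> \<in> dchars q" for \<psi>
  proof -
    have d: "dirichlet_char q \<psi>" using that by (simp add: dchars_def)
    have "\<psi> u * \<psi> v = 1" using dirichlet_char_cong[OF d v] by (simp add: dirichlet_charD[OF d])
    moreover have "cnj (\<psi> u) * \<psi> u = 1" by (rule cnj_dirichlet_char[OF d q cu])
    ultimately have "cnj (\<psi> u) = \<psi> v" by (metis mult.assoc mult.commute mult_1)
    then show ?thesis by (simp add: dirichlet_charD[OF d])
  qed
  then have "(\<Sum>\<psi>\<in>dchars q. cnj (\<psi> u) * \<psi> n) = (\<Sum>\<psi>\<in>dchars q. \<psi> (v * n))" by simp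
  also have "\<dots> = 0"
  proof (rule sum_dchars_eq_0[OF q])
    show "coprime (v * n) q" using cv n by simp
    show "\<not> [v * n = 1] (mod q)"
    proof
      assume "[v * n = 1] (mod q)"
      then have "[u * (v * n) = u * 1] (mod q)" by (rule cong_mult[OF cong_refl])
      moreover have "[(u * v) * n = 1 * n] (mod q)" using v by (rule cong_mult[OF _ cong_refl])
      ultimately have "[u = n] (mod q)" by (metis cong_sym cong_trans mult.assoc mult.right_neutral mult_1)
      then show False using False u by (auto simp: cong_def residue_units_def)
    qed
  qed
  finally show ?thesis using False by simp
qed

lemma char_expansion:
  assumes q: "q \<ge> 1" and n: "coprime n q" and f: "\<And>m n. [m = n] (mod q) \<Longrightarrow> f m = f n"
  shows "f n = (\<Sum>\<psi>\<in>dchars q. char_coeff q f \<psi> * \<psi> n) / of_nat (card (residue_units q))"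
proof -
  have nm: "n mod q \<in> residue_units q" using q n by (simp add: residue_units_def)
  have "(\<Sum>\<psi>\<in>dchars q. char_coeff q f \<psi> * \<psi> n) = (\<Sum>\<psi>\<in>dchars q. \<Sum>u\<in>residue_units q. (cnj (\<psi> u) * \<psi> n) * f u)"
    by (simp add: char_coeff_def sum_distrib_right sum_distrib_left mult_ac)
  also have "\<dots> = (\<Sum>u\<in>residue_units q. (\<Sum>\<psi>\<in>dchars q. cnj (\<psi> u) * \<psi> n) * f u)"
    by (subst sum.swap) (simp add: sum_distrib_right)
  also have "\<dots> = (\<Sum>u\<in>residue_units q. if u = n mod q then of_nat (card (residue_units q)) * f u else 0)"
    by (intro sum.cong refl) (use sum_dchars_orthogonal[OF q _ n] in auto)
  also have "\<dots> = of_nat (card (residue_units q)) * f (n mod q)" using nm by simp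
  also have "f (n mod q) = f n" by (rule f) (simp add: cong_def)
  finally have E: "(\<Sum>\<psi>\<in>dchars q. char_coeff q f \<psi> * \<psi> n) = of_nat (card (residue_units q)) * f n" .
  have "of_nat (card (residue_units q)) \<noteq> (0::complex)"
    using card_residue_units_pos[OF q] by (metis less_numeral_extra(3) of_nat_eq_0_iff)
  then show ?thesis unfolding E by (rule nonzero_mult_div_cancel_left[symmetric])
qed

text \<open>The modulus is unchanged when \<open>b\<close> is multiplied by a unit \<open>v\<close>; averaging its square over \<open>v\<close> and
  extending the average to all residues leaves the pairs \<open>u, u'\<close> with \<open>d u \<equiv> d u'\<close> modulo \<open>q\<close>.\<close>
lemma norm_char_coeff_e1:
  assumes q: "q \<ge> 1" and \<psi>: "dirichlet_char q \<psi>" and b: "coprime b (int q)" and d: "d dvd q"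
  shows "norm (char_coeff q (\<lambda>u. e1 (of_int (b * int d * int u) / real q)) \<psi>) \<le> sqrt (real q * real d)"
proof -
  define f where "f = (\<lambda>k::int. \<Sum>u\<in>residue_units q. cnj (\<psi> u) * e1 (of_int (k * int u) / real q))"
  define A where "A = norm (f (b * int d))"
  define ph where "ph = card (residue_units q)"
  have d0: "d > 0" using d q by (metis dvd_0_left_iff not_gr0 not_one_le_zero)
  have tw: "norm (f (b * int d * int v)) = A" if v: "v \<in> residue_units q" for v
  proof -
    have cv: "coprime v q" using v by (simp add: residue_units_def)
    have "f (b * int d) = (\<Sum>u\<in>residue_units q. cnj (\<psi> (u * v)) * e1 (of_int (b * int d * int (u * v)) / real q))"
      unfolding f_def
    proof (rule sum_residue_units_mult[OF cv q, symmetric])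
      fix m n assume mn: "[m = n] (mod q)"
      then have "[b * int d * int m = b * int d * int n] (mod int q)"
        by (intro cong_mult cong_refl) (simp add: cong_int_iff)
      then show "cnj (\<psi> m) * e1 (of_int (b * int d * int m) / real q) = cnj (\<psi> n) * e1 (of_int (b * int d * int n) / real q)"
        using dirichlet_char_cong[OF \<psi> mn] e1_cong by metis
    qed
    also have "\<dots> = cnj (\<psi> v) * f (b * int d * int v)"
      by (simp add: f_def sum_distrib_left dirichlet_charD[OF \<psi>] mult_ac)
    finally show ?thesis using norm_dirichlet_char[OF \<psi> q cv] by (simp add: A_def norm_mult)
  qed
  have "real ph * A\<^sup>2 = (\<Sum>v\<in>residue_units q. (norm (f (b * int d * int v)))\<^sup>2)"
    using tw by (simp add: ph_def)
  also have "\<dots> \<le> (\<Sum>v<q. (norm (f (b * int d * int v)))\<^sup>2)"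
    by (rule sum_mono2) (auto simp: residue_units_def)
  finally have 1: "real ph * A\<^sup>2 \<le> (\<Sum>v<q. (norm (f (b * int d * int v)))\<^sup>2)" .
  have sq: "of_real ((norm (f (b * int d * int v)))\<^sup>2) = (\<Sum>u\<in>residue_units q. \<Sum>u'\<in>residue_units q.
       cnj (\<psi> u) * \<psi> u' * e1 (of_int (b * int d * (int u - int u') * int v) / real q))" for v
  proof -
    have "of_real ((norm (f (b * int d * int v)))\<^sup>2) = f (b * int d * int v) * cnj (f (b * int d * int v))"
      by (rule complex_norm_square)
    also have "\<dots> = (\<Sum>u\<in>residue_units q. \<Sum>u'\<in>residue_units q.
       (cnj (\<psi> u) * e1 (of_int (b * int d * int v * int u) / real q)) * (\<psi> u' * e1 (- (of_int (b * int d * int v * int u') / real q))))"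
      by (simp add: f_def sum_product cnj_e1)
    also have "\<dots> = (\<Sum>u\<in>residue_units q. \<Sum>u'\<in>residue_units q.
       cnj (\<psi> u) * \<psi> u' * e1 (of_int (b * int d * (int u - int u') * int v) / real q))"
    proof (intro sum.cong refl)
      fix u u'
      have "of_int (b * int d * (int u - int u') * int v) / real q = of_int (b * int d * int v * int u) / real q + - (of_int (b * int d * int v * int u') / real q)"
        by (simp add: algebra_simps diff_divide_distrib)
      then show "(cnj (\<psi> u) * e1 (of_int (b * int d * int v * int u) / real q)) * (\<psi> u' * e1 (- (of_int (b * int d * int v * int u') / real q)))
         = cnj (\<psi> u) * \<psi> u' * e1 (of_int (b * int d * (int u - int u') * int v) / real q)"
        by (simp only: e1_add mult_ac)
    qed
    finally show ?thesis .
  qed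
  \<comment> \<open>As \<open>b\<close> is a unit, the condition says that u and u' agree modulo
    q/d, which leaves at most \<open>d\<close> values of u' below \<open>q\<close>.\<close>
  have cnt: "card {u'\<in>residue_units q. int q dvd b * int d * (int u - int u')} \<le> d" for u
  proof -
    obtain q' where q': "q = d * q'" using d by auto
    have q'0: "q' > 0" using q' q by (cases q') auto
    have "{u'\<in>residue_units q. int q dvd b * int d * (int u - int u')} \<subseteq> (\<lambda>j. u mod q' + q' * j) ` {..<d}"
    proof
      fix u' assume "u' \<in> {u'\<in>residue_units q. int q dvd b * int d * (int u - int u')}"
      then have u': "u' < q" "int q dvd b * (int d * (int u - int u'))" by (auto simp: residue_units_def mult_ac)
      then have "int q dvd int d * (int u - int u')"
        using b coprime_dvd_mult_right_iff[of "int q" b] by (simp add: coprime_commute)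
      then have "int q' dvd int u - int u'" using d0 by (simp add: q')
      then have "[int u = int u'] (mod int q')" by (simp add: cong_iff_dvd_diff)
      then have "u mod q' = u' mod q'" by (simp only: cong_int_iff) (simp add: cong_def)
      moreover have "u' div q' < d" using u'(1) q' q'0 by (simp add: div_less_iff_less_mult mult.commute)
      ultimately show "u' \<in> (\<lambda>j. u mod q' + q' * j) ` {..<d}"
        by (intro image_eqI[of _ _ "u' div q'"]) auto
    qed
    then have "card {u'\<in>residue_units q. int q dvd b * int d * (int u - int u')} \<le> card ((\<lambda>j. u mod q' + q' * j) ` {..<d})"
      by (intro card_mono) auto
    also have "\<dots> \<le> d" using card_image_le[of "{..<d}"] by simp
    finally show ?thesis .
  qed
  have "of_real (\<Sum>v<q. (norm (f (b * int d * int v)))\<^sup>2) = (\<Sum>v<q. \<Sum>u\<in>residue_units q. \<Sum>u'\<in>residue_units q.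
       cnj (\<psi> u) * \<psi> u' * e1 (of_int (b * int d * (int u - int u') * int v) / real q))"
    unfolding of_real_sum using sq by simp
  also have "\<dots> = (\<Sum>u\<in>residue_units q. \<Sum>v<q. \<Sum>u'\<in>residue_units q.
       cnj (\<psi> u) * \<psi> u' * e1 (of_int (b * int d * (int u - int u') * int v) / real q))"
    by (rule sum.swap)
  also have "\<dots> = (\<Sum>u\<in>residue_units q. \<Sum>u'\<in>residue_units q. \<Sum>v<q.
       cnj (\<psi> u) * \<psi> u' * e1 (of_int (b * int d * (int u - int u') * int v) / real q))"
    by (intro sum.cong refl sum.swap)
  also have "\<dots> = (\<Sum>u\<in>residue_units q. \<Sum>u'\<in>residue_units q. cnj (\<psi> u) * \<psi> u' *
       (if int q dvd b * int d * (int u - int u') then of_nat q else 0))"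
    by (simp only: sum_distrib_left[symmetric] sum_e1[OF q])
  finally have "norm (complex_of_real (\<Sum>v<q. (norm (f (b * int d * int v)))\<^sup>2)) =
     norm (\<Sum>u\<in>residue_units q. \<Sum>u'\<in>residue_units q. cnj (\<psi> u) * \<psi> u' *
       (if int q dvd b * int d * (int u - int u') then of_nat q else 0))" by simp
  also have "\<dots> \<le> (\<Sum>u\<in>residue_units q. real q * real d)"
  proof (rule sum_norm_le)
    fix u assume u: "u \<in> residue_units q"
    have "norm (\<Sum>u'\<in>residue_units q. cnj (\<psi> u) * \<psi> u' * (if int q dvd b * int d * (int u - int u') then of_nat q else 0))
        \<le> (\<Sum>u'\<in>residue_units q. if int q dvd b * int d * (int u - int u') then real q else 0)"
    proof (rule sum_norm_le)
      fix u' assume "u' \<in> residue_units q"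
      have "norm (cnj (\<psi> u) * \<psi> u') \<le> 1"
        using norm_dirichlet_char_le[OF \<psi> q, of u] norm_dirichlet_char_le[OF \<psi> q, of u']
        by (simp add: norm_mult mult_le_one)
      then show "norm (cnj (\<psi> u) * \<psi> u' * (if int q dvd b * int d * (int u - int u') then of_nat q else 0))
         \<le> (if int q dvd b * int d * (int u - int u') then real q else 0)"
        by (simp add: norm_mult mult_left_le_one_le)
    qed
    also have "\<dots> = real (card {u'\<in>residue_units q. int q dvd b * int d * (int u - int u')}) * real q"
      by (simp add: sum.If_cases Int_def)
    also have "\<dots> \<le> real d * real q" using cnt[of u] by (intro mult_right_mono) auto
    finally show "norm (\<Sum>u'\<in>residue_units q. cnj (\<psi> u) * \<psi> u' * (if int q dvd b * int d * (int u - int u') then of_nat q else 0))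
        \<le> real q * real d" by (simp add: mult.commute)
  qed
  also have "\<dots> = real ph * (real q * real d)" by (simp add: ph_def)
  finally have "(\<Sum>v<q. (norm (f (b * int d * int v)))\<^sup>2) \<le> real ph * (real q * real d)"
    by (simp only: norm_of_real)
  then have "real ph * A\<^sup>2 \<le> real ph * (real q * real d)" using 1 by linarith
  then have "A\<^sup>2 \<le> real q * real d" using card_residue_units_pos[OF q] by (simp add: ph_def)
  then have "A \<le> sqrt (real q * real d)" by (rule real_le_rsqrt)
  then show ?thesis by (simp add: A_def f_def char_coeff_def)
qed

section \<open>Primitives and zero-free discs\<close>

text \<open>Intended for unions of half-strips with ragged left edges. Sliding to the right by
  \<open>M\<close> and then contracting inside the convex set \<open>H\<close> shows that
  \<open>S\<close> is contractible, hence simply connected.\<close>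

lemma right_invariant_primitive:
  fixes S H :: "complex set"
  assumes S: "open S" "\<And>s u. s \<in> S \<Longrightarrow> 0 \<le> u \<Longrightarrow> s + of_real u \<in> S"
    and H: "convex H" "H \<noteq> {}" "H \<subseteq> S" "0 \<le> M" "\<And>s. s \<in> S \<Longrightarrow> s + of_real M \<in> H"
    and f: "f holomorphic_on S"
  obtains F where "\<And>s. s \<in> S \<Longrightarrow> (F has_field_derivative f s) (at s)"
proof -
  obtain c where c: "c \<in> H" using H by blast
  have 1: "homotopic_with_canon (\<lambda>_. True) S S (\<lambda>s. s) (\<lambda>s. s + of_real M)"
  proof -
    have "homotopic_with_canon (\<lambda>_. True) S S (\<lambda>s. s) (\<lambda>s. s + of_real M)"
    proof (rule homotopic_with_linear)
      fix x assume x: "x \<in> S"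
      show "closed_segment x (x + of_real M) \<subseteq> S"
      proof
        fix y assume "y \<in> closed_segment x (x + of_real M)"
        then obtain u where u: "0 \<le> u" "u \<le> 1" "y = (1 - u) *\<^sub>R x + u *\<^sub>R (x + of_real M)"
          by (auto simp: in_segment)
        then have "y = x + of_real (u * M)"
          by (simp add: scaleR_conv_of_real algebra_simps)
        then show "y \<in> S" using S(2)[OF x, of "u * M"] u H(4) by simp
      qed
    qed (intro continuous_intros)+
    then show ?thesis .
  qed
  have 2: "homotopic_with_canon (\<lambda>_. True) S S (\<lambda>s. s + of_real M) (\<lambda>s. c)"
  proof (rule homotopic_with_linear)
    fix x assume x: "x \<in> S"
    show "closed_segment (x + of_real M) c \<subseteq> S"
      using H c x by (meson closed_segment_subset dual_order.trans)
  qed (intro continuous_intros)+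
  have "contractible S"
    unfolding contractible_def id_def using homotopic_with_trans[OF 1 2] by blast
  then have "simply_connected S" by (rule contractible_imp_simply_connected)
  then obtain F where "\<forall>z\<in>S. (F has_field_derivative f z) (at z)"
    using simply_connected_eq_global_primitive[OF S(1)] f by blast
  then show ?thesis using that by blast
qed

text \<open>Schwarz's lemma for f / (2M - f), which maps the disc into the unit disc because Re f <
  M.\<close>

lemma Borel_Caratheodory:
  assumes hol: "f holomorphic_on ball 0 R" and R: "0 < R" and f0: "f 0 = 0"
    and Re: "\<And>z. norm z < R \<Longrightarrow> Re (f z) < M" and z: "norm z < R"
  shows "norm (f z) \<le> 2 * M * norm z / (R - norm z)"
proof -
  have M: "M > 0" using Re[of 0] f0 R by simp
  define g where "g = (\<lambda>z. f (of_real R * z) / (of_real (2 * M) - f (of_real R * z)))"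
  have nz: "of_real (2 * M) - f u \<noteq> 0" if "norm u < R" for u
  proof
    assume "of_real (2 * M) - f u = 0"
    then have "Re (f u) = 2 * M" by (metis Re_complex_of_real eq_iff_diff_eq_0)
    then show False using Re[OF that] M by simp
  qed
  have sc: "norm (of_real R * u) < R" if "norm u < 1" for u :: complex
    using that R by (simp add: norm_mult)
  have hg: "g holomorphic_on ball 0 1"
  proof -
    have "(f \<circ> (\<lambda>z. of_real R * z)) holomorphic_on ball 0 1"
      using sc by (intro holomorphic_on_compose_gen[OF _ hol] holomorphic_intros) auto
    then have "(\<lambda>z. f (of_real R * z)) holomorphic_on ball 0 1" by (simp add: o_def)
    then show ?thesis unfolding g_def
      using nz sc by (intro holomorphic_intros) auto
  qed
  have g1: "norm (g u) < 1" if "norm u < 1" for u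
  proof -
    define v where "v = f (of_real R * u)"
    have "Re v < M" unfolding v_def using Re sc[OF that] by blast
    then have "(norm v)\<^sup>2 < (norm (of_real (2 * M) - v))\<^sup>2"
      using M by (simp only: cmod_power2) (simp add: power2_eq_square algebra_simps)
    then have "norm v < norm (of_real (2 * M) - v)"
      by (rule power2_less_imp_less) simp
    then show ?thesis unfolding g_def v_def[symmetric]
      by (auto simp: norm_divide divide_simps)
  qed
  have g0: "g 0 = 0" unfolding g_def using f0 by simp
  define u where "u = z / of_real R"
  have u: "norm u < 1" using z R by (simp add: u_def norm_divide)
  have gu: "norm (g u) \<le> norm u" by (rule Schwarz_Lemma(1)[OF hg g0 g1 u])
  have zu: "of_real R * u = z" using R by (simp add: u_def)
  have n1: "1 + g u \<noteq> 0"
  proof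
    assume "1 + g u = 0" then have "g u = -1" by (metis add.commute eq_neg_iff_add_eq_0)
    then show False using g1[OF u] by simp
  qed
  have gz: "g u * (of_real (2 * M) - f z) = f z"
    using nz[OF z] by (simp add: g_def zu)
  have "f z * (1 + g u) = of_real (2 * M) * g u"
    using gz by (simp add: algebra_simps)
  then have "f z = of_real (2 * M) * g u / (1 + g u)"
    using n1 by (simp add: field_simps)
  moreover have "norm (1 + g u) \<ge> 1 - norm u"
    using gu norm_diff_ineq[of 1 "g u"] by simp
  ultimately have "norm (f z) \<le> 2 * M * norm u / (1 - norm u)"
    using gu M u by (simp add: norm_divide norm_mult) (intro frac_le mult_left_mono; simp)
  also have "\<dots> = 2 * M * norm z / (R - norm z)"
    using R z by (simp add: u_def norm_divide field_simps)
  finally show ?thesis .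
qed

text \<open>The point is that \<open>\<eta>\<close> may be arbitrarily small while \<open>C\<close>
  is uniform in \<open>f\<close>, \<open>s0\<close> and \<open>M\<close>. The Taylor coefficients of
  log f at the centre are O(M) by Borel-Caratheodory on the large disc, but also bounded
  independently of \<open>M\<close> by Cauchy's estimate on the small disc where \<open>f\<close> is
  close to 1. The first bound handles the tail of the series, the second a fixed number
  \<open>k\<close> of initial terms. This takes the place of Hadamard's three circles
  theorem.\<close>

lemma inverse_bound_of_zero_free:
  fixes r1 r R \<eta> :: real
  assumes r1: "0 < r1" "r1 \<le> R" and r: "0 < r" "r < R" and \<eta>: "\<eta> > 0"
  obtains C where "C > 0"
    "\<And>f s0 M z. 1 \<le> M \<Longrightarrow> f holomorphic_on ball s0 R \<Longrightarrow>
       (\<And>z. z \<in> ball s0 R \<Longrightarrow> f z \<noteq> 0 \<and> norm (f z) \<le> exp M) \<Longrightarrow>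
       (\<And>z. z \<in> ball s0 r1 \<Longrightarrow> norm (f z - 1) < 1/2) \<Longrightarrow>
       z \<in> cball s0 r \<Longrightarrow> norm (1 / f z) \<le> C * exp (\<eta> * M)"
proof -
  define \<rho> where "\<rho> = (r + R) / 2"
  have \<rho>: "0 < \<rho>" "r < \<rho>" "\<rho> < R" using r by (auto simp: \<rho>_def)
  \<comment> \<open>This is the Borel-Caratheodory factor at radius \<open>\<rho>\<close>, with 3M
    as the bound for the real part of the logarithm.\<close>
  define B where "B = 6 * \<rho> / (R - \<rho>)"
  have B: "B > 0" using \<rho> by (simp add: B_def)
  define x where "x = r / \<rho>"
  have x: "0 < x" "x < 1" using \<rho> r by (auto simp: x_def)
  have "(\<lambda>k. B * x ^ k / (1 - x)) \<longlonglongrightarrow> B * 0 / (1 - x)"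
    using x by (intro tendsto_intros LIMSEQ_realpow_zero) auto
  then have "(\<lambda>k. B * x ^ k / (1 - x)) \<longlonglongrightarrow> 0" by simp
  then have "\<forall>\<^sub>F k in sequentially. B * x ^ k / (1 - x) < \<eta>"
    using \<eta> order_tendstoD(2) by blast
  then obtain k where k: "B * x ^ k / (1 - x) < \<eta>"
    using eventually_happens'[OF sequentially_bot] by blast
  define D where "D = (\<Sum>j<k. 2 * (r / (r1/2)) ^ j)"
  have main: "norm (1 / f z) \<le> 2 * exp D * exp (\<eta> * M)"
    if M: "1 \<le> M" and hol: "f holomorphic_on ball s0 R"
      and nz: "\<And>z. z \<in> ball s0 R \<Longrightarrow> f z \<noteq> 0 \<and> norm (f z) \<le> exp M"
      and near: "\<And>z. z \<in> ball s0 r1 \<Longrightarrow> norm (f z - 1) < 1/2"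
      and z: "z \<in> cball s0 r" for f s0 M z
  proof -
    have R: "0 < R" using r by simp
    obtain g where g: "g holomorphic_on ball s0 R" "\<And>z. z \<in> ball s0 R \<Longrightarrow> f z = exp (g z)"
    proof (rule contractible_imp_holomorphic_log[OF hol convex_imp_contractible[OF convex_ball]])
      show "f z \<noteq> 0" if "z \<in> ball s0 R" for z using nz[OF that] by blast
    qed blast
    have half: "norm (f z) \<ge> 1/2" if "z \<in> ball s0 r1" for z
      using near[OF that] norm_triangle_ineq2[of 1 "1 - f z"] by (simp add: norm_minus_commute)
    define G where "G = (\<lambda>z. g (s0 + z) - g s0)"
    have hG: "G holomorphic_on ball 0 R"
    proof -
      have "(g \<circ> (\<lambda>z. s0 + z)) holomorphic_on ball 0 R"
        by (intro holomorphic_on_compose_gen[OF _ g(1)] holomorphic_intros) (auto simp: dist_norm)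
      then have "(\<lambda>z. g (s0 + z)) holomorphic_on ball 0 R" by (simp add: o_def)
      then show ?thesis unfolding G_def by (intro holomorphic_intros)
    qed
    have G0: "G 0 = 0" by (simp add: G_def)
    have normf: "norm (f (s0 + u)) = norm (f s0) * exp (Re (G u))" if "norm u < R" for u
      using g(2)[of "s0 + u"] g(2)[of s0] that R
      by (simp add: G_def dist_norm exp_diff)
    have ReG: "Re (G u) < 3 * M" if "norm u < R" for u
    proof -
      have "1/2 * exp (Re (G u)) \<le> norm (f s0) * exp (Re (G u))"
        using half[of s0] r1 by (intro mult_right_mono) auto
      also have "\<dots> \<le> exp M" using normf[OF that] nz[of "s0 + u"] that by (simp add: dist_norm)
      finally have "exp (Re (G u)) \<le> 2 * exp M" by simp
      also have "\<dots> \<le> exp 1 * exp M"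
        using exp_ge_add_one_self[of 1] by simp
      also have "\<dots> \<le> exp (2 * M)" using M by (simp flip: exp_add)
      finally have "Re (G u) \<le> 2 * M" by simp
      then show ?thesis using M by simp
    qed
    have BC: "norm (G u) \<le> B * M" if "norm u \<le> \<rho>" for u
    proof -
      have "norm (G u) \<le> 2 * (3 * M) * norm u / (R - norm u)"
        using Borel_Caratheodory[OF hG R G0 ReG, of u] that \<rho> by simp
      also have "\<dots> \<le> 2 * (3 * M) * \<rho> / (R - \<rho>)"
        using that \<rho> M by (intro frac_le mult_left_mono) auto
      finally show ?thesis by (simp add: B_def algebra_simps)
    qed
    \<comment> \<open>On the small disc \<open>f\<close> stays in the right half-plane, so the
      abstract logarithm \<open>g\<close> differs from \<open>Ln (f z)\<close> by a constant, and
      the latter is at most 1 in modulus.\<close>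
    have small: "norm (G u) \<le> 2" if u: "norm u < r1" for u
    proof -
      have dL: "((\<lambda>z. Ln (f z) - g z) has_field_derivative 0) (at v within ball s0 r1)" if v: "v \<in> ball s0 r1" for v
      proof -
        have vR: "v \<in> ball s0 R" using v r1 by auto
        have rp: "Re (f v) > 0"
          using near[OF v] abs_Re_le_cmod[of "f v - 1"] by simp
        have fd: "(f has_field_derivative deriv f v) (at v)"
          using hol vR by (meson centre_in_ball holomorphic_derivI open_ball)
        have gd: "(g has_field_derivative deriv g v) (at v)"
          using g(1) vR by (meson holomorphic_derivI open_ball)
        have "((\<lambda>z. exp (g z)) has_field_derivative exp (g v) * deriv g v) (at v)"
          using gd by (auto intro!: derivative_eq_intros)
        then have "(f has_field_derivative exp (g v) * deriv g v) (at v)"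
          by (rule has_field_derivative_transform_within_open[OF _ open_ball vR]) (simp add: g(2))
        then have e: "deriv f v = f v * deriv g v"
          using DERIV_imp_deriv g(2)[OF vR] by auto
        have "((\<lambda>z. Ln (f z) - g z) has_field_derivative 0) (at v)"
          using rp nz[OF vR] by (auto intro!: derivative_eq_intros fd gd simp: complex_nonpos_Reals_iff e)
        then show ?thesis by (rule has_field_derivative_at_within)
      qed
      have "\<exists>c. \<forall>v\<in>ball s0 r1. Ln (f v) - g v = c"
        using has_field_derivative_zero_constant[OF convex_ball dL] by blast
      then obtain c where c: "\<And>v. v \<in> ball s0 r1 \<Longrightarrow> g v = Ln (f v) - c"
        by (metis (no_types) diff_diff_eq2 add_diff_cancel_left')
      have "G u = Ln (f (s0 + u)) - Ln (f s0)"
        using c[of "s0 + u"] c[of s0] u r1 by (simp add: G_def dist_norm)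
      moreover have "norm (Ln (f v)) \<le> 1" if "v \<in> ball s0 r1" for v
        using norm_Ln_le[of "f v - 1"] near[OF that] by simp
      moreover have "s0 + u \<in> ball s0 r1" "s0 \<in> ball s0 r1" using u r1 by (auto simp: dist_norm)
      ultimately show ?thesis
        using norm_triangle_ineq4[of "Ln (f (s0 + u))" "Ln (f s0)"] by (smt (verit))
    qed
    define cf where "cf = (\<lambda>n. (deriv ^^ n) G 0 / fact n)"
    have c1: "norm (cf n) \<le> B * M / \<rho> ^ n" for n
    proof -
      have "norm ((deriv ^^ n) G 0) \<le> fact n * (B * M) / \<rho> ^ n"
      proof (rule Cauchy_inequality)
        show "G holomorphic_on ball 0 \<rho>" 
          by (rule holomorphic_on_subset[OF hG]) (use \<rho> in auto)
        show "continuous_on (cball 0 \<rho>) G"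
        proof (rule holomorphic_on_imp_continuous_on[OF holomorphic_on_subset[OF hG]])
          show "cball 0 \<rho> \<subseteq> ball (0::complex) R" using \<rho> by auto
        qed
        show "norm (G x) \<le> B * M" if "norm (0 - x) = \<rho>" for x using that BC by simp
      qed (use \<rho> in auto)
      then show ?thesis by (simp add: cf_def norm_divide field_simps)
    qed
    have c2: "norm (cf n) \<le> 2 / (r1/2) ^ n" for n
    proof -
      have "norm ((deriv ^^ n) G 0) \<le> fact n * 2 / (r1/2) ^ n"
      proof (rule Cauchy_inequality)
        show "G holomorphic_on ball 0 (r1/2)" 
          by (rule holomorphic_on_subset[OF hG]) (use r1 in auto)
        show "continuous_on (cball 0 (r1/2)) G"
        proof (rule holomorphic_on_imp_continuous_on[OF holomorphic_on_subset[OF hG]])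
          show "cball 0 (r1/2) \<subseteq> ball (0::complex) R" using r1 by auto
        qed
        show "norm (G x) \<le> 2" if "norm (0 - x) = r1/2" for x using that small[of x] r1 by simp
      qed (use r1 in auto)
      then show ?thesis by (simp add: cf_def norm_divide field_simps)
    qed
    define u where "u = z - s0"
    have u: "norm u \<le> r" using z by (simp add: u_def dist_norm norm_minus_commute)
    have uR: "norm u < R" using u r by simp
    have sm: "(\<lambda>n. cf n * u ^ n) sums G u"
      using holomorphic_power_series[OF hG, of u] uR by (simp add: cf_def)
    have t1: "norm (cf n * u ^ n) \<le> B * M * x ^ n" for n
    proof -
      have "norm (cf n * u ^ n) \<le> (B * M / \<rho> ^ n) * r ^ n"
        unfolding norm_mult norm_power using c1[of n] u B M \<rho> by (intro mult_mono power_mono) auto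
      then show ?thesis by (simp add: x_def power_divide)
    qed
    have t2: "norm (cf n * u ^ n) \<le> 2 * (r / (r1/2)) ^ n" for n
    proof -
      have "norm (cf n * u ^ n) \<le> (2 / (r1/2) ^ n) * r ^ n"
        unfolding norm_mult norm_power using c2[of n] u r1 by (intro mult_mono power_mono) auto
      then show ?thesis by (simp add: power_divide mult_ac)
    qed
    have gs: "(\<lambda>n. B * M * x ^ (n + k)) sums (B * M * x ^ k / (1 - x))"
      using sums_mult[OF geometric_sums[of x], of "B * M * x ^ k"] x
      by (simp add: power_add mult_ac)
    have "G u = (\<Sum>n. cf (n + k) * u ^ (n + k)) + (\<Sum>n<k. cf n * u ^ n)"
      using suminf_split_initial_segment[of "\<lambda>n. cf n * u ^ n" k] sm
      by (simp add: sums_iff)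
    moreover have "norm (\<Sum>n. cf (n + k) * u ^ (n + k)) \<le> B * M * x ^ k / (1 - x)"
      using norm_suminf_le[of "\<lambda>n. cf (n + k) * u ^ (n + k)" "\<lambda>n. B * M * x ^ (n + k)"] t1 gs
      by (simp add: sums_iff)
    moreover have "norm (\<Sum>n<k. cf n * u ^ n) \<le> D"
      unfolding D_def by (rule sum_norm_le) (use t2 in auto)
    moreover have "B * M * x ^ k / (1 - x) \<le> \<eta> * M"
      using mult_right_mono[OF less_imp_le[OF k], of M] M by (simp add: mult_ac)
    ultimately have "norm (G u) \<le> \<eta> * M + D"
      using norm_triangle_ineq[of "\<Sum>n. cf (n + k) * u ^ (n + k)" "\<Sum>n<k. cf n * u ^ n"] by simp
    then have G: "- Re (G u) \<le> \<eta> * M + D"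
      using abs_Re_le_cmod[of "G u"] by linarith
    have "norm (1 / f z) = exp (- Re (G u)) / norm (f s0)"
      using normf[OF uR] by (simp add: u_def norm_divide exp_minus field_simps)
    also have "\<dots> \<le> exp (\<eta> * M + D) / (1/2)"
      using G half[of s0] r1 by (intro frac_le) auto
    finally show ?thesis by (simp add: exp_add mult_ac)
  qed
  show ?thesis by (rule that[of "2 * exp D"]) (use main in auto)
qed

section \<open>The Gamma function on vertical lines\<close>

text \<open>Compared factor by factor in the Gauss product, using |s + i| \<ge> Re s + i.\<close>

lemma norm_Gamma_le:
  fixes s :: complex
  assumes s: "Re s > 0"
  shows "norm (Gamma s) \<le> Gamma (Re s)"
proof (rule LIMSEQ_le)
  show "(\<lambda>n. norm (Gamma_series s n)) \<longlonglongrightarrow> norm (Gamma s)"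
    by (intro tendsto_norm Gamma_series_LIMSEQ)
  show "Gamma_series (Re s) \<longlonglongrightarrow> Gamma (Re s)" by (rule Gamma_series_LIMSEQ)
  have "norm (Gamma_series s n) \<le> Gamma_series (Re s) n" if n: "n \<ge> 1" for n
  proof -
    have "pochhammer (Re s) (n+1) \<le> norm (pochhammer s (n+1))"
      unfolding pochhammer_prod prod_norm[symmetric]
    proof (rule prod_mono, intro conjI)
      fix i assume "i \<in> {0..<n+1}"
      show "0 \<le> Re s + real i" using s by simp
      show "Re s + real i \<le> norm (s + of_nat i)"
        using complex_Re_le_cmod[of "s + of_nat i"] by simp
    qed
    moreover have "pochhammer (Re s) (n+1) > 0" using s by (rule pochhammer_pos)
    ultimately show ?thesis
      unfolding Gamma_series_def using n
      by (simp add: norm_divide norm_mult) (intro frac_le; simp)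
  qed
  then show "\<exists>N. \<forall>n\<ge>N. norm (Gamma_series s n) \<le> Gamma_series (Re s) n" by blast
qed

text \<open>For z = 1/2 + it one has 1 - z = \<open>cnj z\<close>, so the reflection formula gives
  |\<Gamma>(z)|^2 = \<pi> / cosh(\<pi> t).\<close>

lemma norm_Gamma_half_line:
  "norm (Gamma (Complex (1/2) t)) \<le> 3 * exp (- pi * \<bar>t\<bar> / 2)"
proof -
  define z where "z = Complex (1/2) t"
  have cz: "1 - z = cnj z" by (simp add: z_def complex_eq_iff)
  have "sin (of_real pi * z) = cos (\<i> * of_real (pi * t))"
  proof -
    have "of_real pi * z = \<i> * of_real (pi * t) + of_real pi / 2" by (simp add: z_def complex_eq_iff)
    then show ?thesis by (simp add: sin_add)
  qed
  also have "\<dots> = of_real ((exp (pi * t) + exp (- (pi * t))) / 2)"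
    by (simp add: cos_exp_eq exp_of_real[symmetric] mult.assoc[symmetric])
  finally have sn: "norm (sin (of_real pi * z)) = (exp (pi * t) + exp (- (pi * t))) / 2"
    by (simp only: norm_of_real) (simp add: add_pos_pos less_imp_le)
  have "(norm (Gamma z))\<^sup>2 = norm (Gamma z * Gamma (1 - z))"
    by (simp add: cz cnj_Gamma[symmetric] norm_mult power2_eq_square)
  also have "\<dots> = pi / ((exp (pi * t) + exp (- (pi * t))) / 2)"
    unfolding Gamma_reflection_complex by (simp add: norm_divide sn)
  also have "\<dots> \<le> pi / (exp (pi * \<bar>t\<bar>) / 2)"
    by (intro frac_le divide_right_mono) (auto simp: abs_if)
  also have "\<dots> \<le> 9 * exp (- pi * \<bar>t\<bar>)"
    using pi_less_4 by (simp add: exp_minus field_simps)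
  also have "\<dots> = (3 * exp (- pi * \<bar>t\<bar> / 2))\<^sup>2"
    by (simp add: power_mult_distrib exp_double[symmetric])
  finally show ?thesis unfolding z_def by (rule power2_le_imp_le) simp
qed

text \<open>Convexity between the lines \<open>Re s = 1/2\<close> and \<open>Re s = 3/2\<close>, with the damping factor \<open>exp ((s - i t0)^2)\<close>.\<close>
lemma norm_Gamma_strip_upper:
  assumes \<sigma>: "1/2 \<le> \<sigma>" "\<sigma> \<le> 3/2" and t0: "0 \<le> t0"
  shows "norm (Gamma (Complex \<sigma> t0)) \<le> 6 * exp (9/4) * (1 + t0) powr (\<sigma> - 1/2) * exp (- pi * t0 / 2)"
proof -
  define c where "c = 1 + t0"
  have c: "c \<ge> 1" using t0 by (simp add: c_def)
  \<comment> \<open>Besides the damping, \<open>exp (- s * of_real (ln c))\<close> offsets the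
    additional factor \<open>c\<close> on the line Re s = 3/2, and the last exponential, of modulus
    exp(\<pi> Im s / 2), undoes the decay of \<Gamma> in the upper half-plane.\<close>
  define g where "g = (\<lambda>s. Gamma s * (exp ((s - \<i> * of_real t0)\<^sup>2) * exp (- s * of_real (ln c)) * exp (- \<i> * of_real pi * s / 2)))"
  define B where "B = 6 * exp (9/4::real) * c powr (-1/2)"
  have ng: "norm (g s) = norm (Gamma s) * exp ((Re s)\<^sup>2 - (Im s - t0)\<^sup>2) * c powr (- Re s) * exp (pi * Im s / 2)" for s
    using c by (simp add: g_def norm_mult powr_def power2_eq_square algebra_simps)
  have hol: "g holomorphic_on {s. Re s > 0}"
    unfolding g_def by (intro holomorphic_intros) (auto elim!: nonpos_Ints_cases)
  have "continuous_on {1/2..3/2::real} Gamma"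
    by (intro continuous_intros) (auto elim!: nonpos_Ints_cases)
  then obtain G0 where G0: "\<And>x. x \<in> {1/2..3/2::real} \<Longrightarrow> Gamma x \<le> G0"
    using continuous_attains_sup[of "{1/2..3/2::real}" Gamma] by fastforce
  \<comment> \<open>\<open>Y\<close> is taken so large that the Gaussian damping pushes
    \<open>g\<close> below \<open>B\<close> on the horizontal sides, where \<open>G0\<close> bounds
    \<Gamma> through \<open>norm_Gamma_le\<close>.\<close>
  have "((\<lambda>Y. max 1 G0 * exp (9/4) * exp (- (Y - t0)\<^sup>2 + pi * Y / 2)) \<longlongrightarrow> 0) at_top"
    by real_asymp
  moreover have "B > 0" using c by (simp add: B_def)
  ultimately have "\<forall>\<^sub>F Y in at_top. max 1 G0 * exp (9/4) * exp (- (Y - t0)\<^sup>2 + pi * Y / 2) < B"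
    by (rule order_tendstoD)
  moreover have "\<forall>\<^sub>F Y in at_top. Y > t0" by (rule eventually_gt_at_top)
  ultimately have "\<forall>\<^sub>F Y in at_top. max 1 G0 * exp (9/4) * exp (- (Y - t0)\<^sup>2 + pi * Y / 2) < B \<and> Y > t0"
    by (rule eventually_conj)
  then obtain Y where Y: "max 1 G0 * exp (9/4) * exp (- (Y - t0)\<^sup>2 + pi * Y / 2) < B" "Y > t0"
    using eventually_happens'[OF trivial_limit_at_top_linorder] by blast
  define S where "S = box (Complex (1/2) (-Y)) (Complex (3/2) Y)"
  have S: "S = {s. 1/2 < Re s \<and> Re s < 3/2 \<and> - Y < Im s \<and> Im s < Y}"
    by (auto simp: S_def box_def Basis_complex_def)
  have clS: "closure S \<subseteq> {s. 1/2 \<le> Re s \<and> Re s \<le> 3/2 \<and> - Y \<le> Im s \<and> Im s \<le> Y}"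
  proof -
    have "closure S \<subseteq> cbox (Complex (1/2) (-Y)) (Complex (3/2) Y)"
      unfolding S_def by (intro closure_minimal box_subset_cbox closed_cbox)
    then show ?thesis by (auto simp: cbox_def Basis_complex_def)
  qed
  have frS: "(Re s = 1/2 \<or> Re s = 3/2 \<or> \<bar>Im s\<bar> = Y) \<and> 1/2 \<le> Re s \<and> Re s \<le> 3/2 \<and> \<bar>Im s\<bar> \<le> Y" if "s \<in> frontier S" for s
  proof -
    have "open S" unfolding S_def by (rule open_box)
    then have "s \<in> closure S" "s \<notin> S" using that by (auto simp: frontier_def interior_open)
    then have "1/2 \<le> Re s \<and> Re s \<le> 3/2 \<and> - Y \<le> Im s \<and> Im s \<le> Y"
      "\<not> (1/2 < Re s \<and> Re s < 3/2 \<and> - Y < Im s \<and> Im s < Y)"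
      using clS S by blast+
    then show ?thesis by (smt (verit))
  qed
  have bnd: "norm (g s) \<le> B" if s: "s \<in> frontier S" for s
  proof -
    have ex: "exp (pi * Im s / 2 - pi * \<bar>Im s\<bar> / 2) = exp (- pi * \<bar>Im s\<bar> / 2) * exp (pi * Im s / 2)"
      by (simp add: exp_add[symmetric])
    define v where "v = \<bar>Im s - t0\<bar>"
    have v: "(Im s - t0)\<^sup>2 = v\<^sup>2" "v \<ge> 0" by (auto simp: v_def)
    from frS[OF s] consider "Re s = 1/2" | "Re s = 3/2" | "\<bar>Im s\<bar> = Y" by blast
    then show ?thesis
    proof cases
      case 1
      have "s = Complex (1/2) (Im s)" using 1 by (simp add: complex_eq_iff)
      then have G: "norm (Gamma s) \<le> 3 * exp (- pi * \<bar>Im s\<bar> / 2)" using norm_Gamma_half_line by metis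
      have "(1/2::real)\<^sup>2 = 1/4" by (simp add: power2_eq_square)
      then have e: "(1/2::real)\<^sup>2 - (Im s - t0)\<^sup>2 \<le> 9/4" using zero_le_power2[of "Im s - t0"] by linarith
      have "norm (g s) \<le> (3 * exp (- pi * \<bar>Im s\<bar> / 2)) * exp (9/4) * c powr (-1/2) * exp (pi * Im s / 2)"
        unfolding ng 1 using e by (intro mult_mono G) auto
      also have "\<dots> = 3 * exp (9/4) * c powr (-1/2) * exp (pi * Im s / 2 - pi * \<bar>Im s\<bar> / 2)"
        unfolding ex by (simp only: mult_ac)
      also have "\<dots> \<le> 3 * exp (9/4) * c powr (-1/2) * 1"
        by (intro mult_left_mono) (auto simp: field_simps intro: mult_left_mono)
      also have "\<dots> \<le> B" by (simp add: B_def)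
      finally show ?thesis .
    next
      case 2
      have nn: "Complex (1/2) (Im s) \<notin> \<int>\<^sub>\<le>\<^sub>0" by (auto elim!: nonpos_Ints_cases simp: complex_eq_iff)
      have "s = Complex (1/2) (Im s) + 1" using 2 by (simp add: complex_eq_iff)
      then have "Gamma s = Complex (1/2) (Im s) * Gamma (Complex (1/2) (Im s))"
        using Gamma_plus1[OF nn] by metis
      then have "norm (Gamma s) \<le> (1/2 + \<bar>Im s\<bar>) * (3 * exp (- pi * \<bar>Im s\<bar> / 2))"
        using norm_Gamma_half_line[of "Im s"] cmod_le[of "Complex (1/2) (Im s)"]
        by (simp add: norm_mult mult_mono)
      moreover have "1/2 + \<bar>Im s\<bar> \<le> c * (1 + v)"
      proof -
        have "0 \<le> t0 * v" using t0 v by simp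
        moreover have "\<bar>Im s\<bar> \<le> t0 + v" using t0 by (simp add: v_def abs_if)
        moreover have "c * (1 + v) = 1 + t0 + v + t0 * v" by (simp add: c_def algebra_simps)
        ultimately show ?thesis by linarith
      qed
      ultimately have G: "norm (Gamma s) \<le> (c * (1 + v)) * (3 * exp (- pi * \<bar>Im s\<bar> / 2))"
        by (meson exp_ge_zero mult_nonneg_nonneg mult_right_mono order_trans zero_le_numeral)
      have "(1 + v) * exp (- v\<^sup>2) \<le> 2"
      proof -
        have "1 + v \<le> 2 * (1 + v\<^sup>2)" using zero_le_power2[of "v - 1/2"] v by (simp add: power2_eq_square algebra_simps)
        also have "\<dots> \<le> 2 * exp (v\<^sup>2)" by (intro mult_left_mono exp_ge_add_one_self) simp
        finally show ?thesis by (simp add: exp_minus field_simps)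
      qed
      have e2: "exp ((3/2)\<^sup>2 - v\<^sup>2) = exp (9/4) * exp (- v\<^sup>2)"
        by (simp add: exp_add[symmetric] power2_eq_square)
      have cc: "c * c powr (-3/2) = c powr (-1/2)"
        using c powr_add[of c 1 "-3/2"] by simp
      have "norm (g s) \<le> ((c * (1 + v)) * (3 * exp (- pi * \<bar>Im s\<bar> / 2))) * (exp (9/4) * exp (- v\<^sup>2)) * c powr (-3/2) * exp (pi * Im s / 2)"
        unfolding ng v 2 e2 using c v(2) by (intro mult_mono G) auto
      also have "\<dots> = 3 * exp (9/4) * (c * c powr (-3/2)) * ((1 + v) * exp (- v\<^sup>2)) * exp (pi * Im s / 2 - pi * \<bar>Im s\<bar> / 2)"
        unfolding ex by (simp only: mult_ac)
      also have "\<dots> \<le> 3 * exp (9/4) * (c * c powr (-3/2)) * 2 * 1"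
        using \<open>(1 + v) * exp (- v\<^sup>2) \<le> 2\<close> c v(2)
        by (intro mult_mono mult_nonneg_nonneg add_nonneg_nonneg)
          (auto simp: divide_right_mono intro: mult_left_mono)
      also have "\<dots> = B" unfolding cc by (simp add: B_def)
      finally show ?thesis .
    next
      case 3
      have G: "norm (Gamma s) \<le> max 1 G0"
        using norm_Gamma_le[of s] G0[of "Re s"] frS[OF s] by force
      have "(Y - t0)\<^sup>2 \<le> (Im s - t0)\<^sup>2"
        using 3 Y t0 by (intro abs_le_square_iff[THEN iffD1]) linarith
      have "norm (g s) \<le> max 1 G0 * (exp (9/4) * exp (- (Y - t0)\<^sup>2)) * 1 * exp (pi * Y / 2)"
        unfolding ng
      proof (intro mult_mono G)
        have "(Re s)\<^sup>2 \<le> (3/2)\<^sup>2" using frS[OF s] by (intro power_mono) auto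
        then show "exp ((Re s)\<^sup>2 - (Im s - t0)\<^sup>2) \<le> exp (9 / 4) * exp (- (Y - t0)\<^sup>2)"
          using \<open>(Y - t0)\<^sup>2 \<le> (Im s - t0)\<^sup>2\<close> unfolding exp_add[symmetric] by (simp add: power2_eq_square)
        have "c powr (- Re s) \<le> c powr 0" using c frS[OF s] by (intro powr_mono) auto
        then show "c powr (- Re s) \<le> 1" using c by simp
        have "Im s \<le> Y" using 3 by simp
        then show "exp (pi * Im s / 2) \<le> exp (pi * Y / 2)" by (simp add: divide_right_mono)
      qed (use c in auto)
      also have "\<dots> = max 1 G0 * exp (9/4) * exp (- (Y - t0)\<^sup>2 + pi * Y / 2)"
        by (simp add: exp_add[symmetric] mult.assoc)
      finally show ?thesis using Y by simp
    qed
  qed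
  have p: "norm (g (Complex \<sigma> t0)) \<le> B"
  proof (cases "1/2 < \<sigma> \<and> \<sigma> < 3/2")
    case True
    show ?thesis
    proof (rule maximum_modulus_frontier[of g S])
      show "g holomorphic_on interior S"
        using hol by (rule holomorphic_on_subset) (use interior_subset[of S] S in auto)
      show "continuous_on (closure S) g"
        using holomorphic_on_imp_continuous_on[OF hol] by (rule continuous_on_subset) (use clS in force)
      show "bounded S" by (simp add: S_def)
      show "Complex \<sigma> t0 \<in> S" using True Y t0 by (simp add: S)
    qed (use bnd in auto)
  next
    case False
    then have "Complex \<sigma> t0 \<in> frontier S"
    proof -
      have "Complex \<sigma> t0 \<in> cbox (Complex (1/2) (-Y)) (Complex (3/2) Y)"
        using \<sigma> t0 Y by (auto simp: cbox_def Basis_complex_def)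
      moreover have "S \<noteq> {}"
      proof -
        have "Complex 1 0 \<in> S" using Y t0 by (simp add: S)
        then show ?thesis by blast
      qed
      ultimately have "Complex \<sigma> t0 \<in> closure S" unfolding S_def using closure_box by blast
      moreover have "Complex \<sigma> t0 \<notin> S" using False by (auto simp: S)
      ultimately show ?thesis unfolding S_def by (simp add: frontier_def interior_open open_box)
    qed
    then show ?thesis by (rule bnd)
  qed
  have "norm (Gamma (Complex \<sigma> t0)) * c powr (-\<sigma>) * exp (pi * t0 / 2) * 1
          \<le> norm (Gamma (Complex \<sigma> t0)) * c powr (-\<sigma>) * exp (pi * t0 / 2) * exp (\<sigma>\<^sup>2)"
    by (intro mult_left_mono) auto
  also have "\<dots> \<le> B" using p unfolding ng by (simp add: mult_ac)
  finally have "norm (Gamma (Complex \<sigma> t0)) * (c powr (-\<sigma>) * exp (pi * t0 / 2)) \<le> B" by simp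
  then have "norm (Gamma (Complex \<sigma> t0)) \<le> B / (c powr (-\<sigma>) * exp (pi * t0 / 2))"
    using c by (simp add: pos_le_divide_eq)
  also have "\<dots> = 6 * exp (9/4) * c powr (\<sigma> - 1/2) * exp (- pi * t0 / 2)"
    using c powr_add[of c "-1/2" \<sigma>] by (simp add: B_def powr_minus exp_minus field_simps)
  finally show ?thesis by (simp add: c_def)
qed

lemma norm_Gamma_strip:
  assumes \<sigma>: "1/2 \<le> Re s" "Re s \<le> 3/2"
  shows "norm (Gamma s) \<le> 6 * exp (9/4) * (1 + \<bar>Im s\<bar>) powr (Re s - 1/2) * exp (- pi * \<bar>Im s\<bar> / 2)"
proof (cases "Im s \<ge> 0")
  case True
  then show ?thesis using norm_Gamma_strip_upper[OF \<sigma>, of "Im s"] by simp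
next
  case False
  have "norm (Gamma s) = norm (Gamma (cnj s))" by (simp add: cnj_Gamma[symmetric])
  also have "cnj s = Complex (Re s) (- Im s)" by (simp add: complex_eq_iff)
  finally show ?thesis using norm_Gamma_strip_upper[OF \<sigma>, of "- Im s"] False by simp
qed

text \<open>|w^(-s)| may grow like exp(|Im s| |arg w|), which nearly cancels the decay of \<Gamma>
  when \<open>w\<close> is close to the imaginary axis. What survives comes from \<pi>/2 - |arg w|
  \<ge> sin(\<pi>/2 - |arg w|) = Re w / |w|, so the effective length of the integral is |w| / Re
  w.\<close>

lemma norm_Mellin_kernel:
  assumes s: "1/2 \<le> Re s" "Re s \<le> 3/2" and w: "Re w > 0"
  shows "norm (Gamma s * exp (- s * Ln w)) \<le> 
    6 * exp (9/4) * (1 + \<bar>Im s\<bar>) powr (Re s - 1/2) * norm w powr (- Re s) * exp (- \<bar>Im s\<bar> * (Re w / norm w))"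
proof -
  have w0: "w \<noteq> 0" using w by auto
  have A: "\<bar>Im (Ln w)\<bar> < pi / 2" using Re_Ln_pos_lt[OF w0] w by simp
  have "Re w / norm w = cos (Im (Ln w))"
  proof -
    have "Re w = Re (exp (Ln w))" using w0 by simp
    also have "\<dots> = norm w * cos (Im (Ln w))" using w0 unfolding Re_exp by (simp add: Re_Ln)
    finally show ?thesis using w0 by simp
  qed
  also have "\<dots> = sin (pi/2 - \<bar>Im (Ln w)\<bar>)"
    by (simp add: sin_diff abs_if)
  also have "\<dots> \<le> pi/2 - \<bar>Im (Ln w)\<bar>" by (rule sin_x_le_x) (use A in auto)
  finally have r: "\<bar>Im (Ln w)\<bar> \<le> pi / 2 - Re w / norm w" by simp
  have e: "norm (exp (- s * Ln w)) = norm w powr (- Re s) * exp (Im s * Im (Ln w))"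
    using w0 by (simp add: powr_def exp_add[symmetric])
  have "Im s * Im (Ln w) \<le> \<bar>Im s\<bar> * \<bar>Im (Ln w)\<bar>" by (metis abs_ge_self abs_mult)
  also have "\<dots> \<le> \<bar>Im s\<bar> * (pi / 2 - Re w / norm w)" using r by (intro mult_left_mono) auto
  finally have e2: "exp (Im s * Im (Ln w)) \<le> exp (\<bar>Im s\<bar> * (pi / 2 - Re w / norm w))" by simp
  have "norm (Gamma s * exp (- s * Ln w)) \<le> (6 * exp (9/4) * (1 + \<bar>Im s\<bar>) powr (Re s - 1/2) * exp (- pi * \<bar>Im s\<bar> / 2))
     * (norm w powr (- Re s) * exp (\<bar>Im s\<bar> * (pi / 2 - Re w / norm w)))"
    unfolding norm_mult e using norm_Gamma_strip[OF s] e2 by (intro mult_mono) auto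
  also have "\<dots> = 6 * exp (9/4) * (1 + \<bar>Im s\<bar>) powr (Re s - 1/2) * norm w powr (- Re s) *
      (exp (- pi * \<bar>Im s\<bar> / 2) * exp (\<bar>Im s\<bar> * (pi / 2 - Re w / norm w)))" by (simp add: mult_ac)
  also have "exp (- pi * \<bar>Im s\<bar> / 2) * exp (\<bar>Im s\<bar> * (pi / 2 - Re w / norm w)) = exp (- \<bar>Im s\<bar> * (Re w / norm w))"
    unfolding exp_add[symmetric] by (simp add: algebra_simps)
  finally show ?thesis .
qed

section \<open>Continuation of L-functions\<close>

definition npow :: "nat \<Rightarrow> complex \<Rightarrow> complex" where
  "npow n s = of_nat (Suc n) powr (- s)"

lemma norm_npow: "norm (npow n s) = real (Suc n) powr (- Re s)"
  unfolding npow_def by (subst norm_powr_real_powr) auto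

lemma npow_0 [simp]: "npow 0 s = 1"
  by (simp add: npow_def)

lemma npow_at_0 [simp]: "npow n 0 = 1"
  by (simp add: npow_def del: of_nat_Suc)

lemma npow_holomorphic [holomorphic_intros]:
  assumes "g holomorphic_on A"
  shows "(\<lambda>s. npow n (g s)) holomorphic_on A"
  unfolding npow_def using assms by (intro holomorphic_intros) auto

lemma powr_diff_bound:
  fixes s :: complex
  assumes ab: "1 \<le> a" "a \<le> b" and s: "Re s > 0"
  shows "norm (of_real b powr (- s) - of_real a powr (- s)) \<le> norm s * a powr (- Re s - 1) * (b - a)"
proof -
  let ?S = "closed_segment (complex_of_real a) (complex_of_real b)"
  have S: "\<exists>u. z = of_real u \<and> a \<le> u" if zS: "z \<in> ?S" for z
  proof -
    obtain t where t: "0 \<le> t" "t \<le> 1" "z = (1 - t) *\<^sub>R complex_of_real a + t *\<^sub>R complex_of_real b"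
      using zS by (auto simp: in_segment)
    have "z = of_real (a + t * (b - a))" unfolding t(3) by (simp add: scaleR_conv_of_real algebra_simps)
    then show ?thesis using t ab by (intro exI[of _ "a + t * (b - a)"]) auto
  qed
  have "norm (of_real b powr (- s) - of_real a powr (- s)) \<le> (norm s * a powr (- Re s - 1)) * norm (complex_of_real b - complex_of_real a)"
  proof (rule field_differentiable_bound[where S = ?S and f = "\<lambda>z. z powr (- s)" and f' = "\<lambda>z. - s * z powr (- s - 1)"])
    show "((\<lambda>z. z powr - s) has_field_derivative - s * z powr (- s - 1)) (at z within ?S)" if zS: "z \<in> ?S" for z
    proof -
      obtain u where "z = of_real u" "a \<le> u" using S[OF zS] by blast
      then have "z \<notin> \<real>\<^sub>\<le>\<^sub>0" using ab by (simp add: complex_nonpos_Reals_iff)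
      then show ?thesis by (rule has_field_derivative_at_within[OF has_field_derivative_powr])
    qed
    show "norm (- s * z powr (- s - 1)) \<le> norm s * a powr (- Re s - 1)" if zS: "z \<in> ?S" for z
    proof -
      obtain u where u: "z = of_real u" "a \<le> u" using S[OF zS] by blast
      then have "norm (z powr (- s - 1)) = u powr (- Re s - 1)"
        using ab by (simp add: norm_powr_real_powr)
      also have "\<dots> \<le> a powr (- Re s - 1)" using u ab s by (intro powr_mono2') auto
      finally show ?thesis by (simp add: norm_mult mult_left_mono)
    qed
  qed auto
  also have "norm (complex_of_real b - complex_of_real a) = b - a"
    using ab by (metis abs_of_nonneg diff_ge_0_iff_ge norm_of_real of_real_diff)
  finally show ?thesis .
qed

lemma npow_diff_bound:
  assumes "Re s > 0"
  shows "norm (npow n s - npow (Suc n) s) \<le> norm s * real (Suc n) powr (- Re s - 1)"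
  using powr_diff_bound[OF _ _ assms, of "real (Suc n)" "real (Suc (Suc n))"]
  by (simp add: npow_def norm_minus_commute)

text \<open>With N = n + 1, this is (s - 1) times the difference between N^(-s) and the integral of
  u^(-s) over [N, N + 1]. Keeping the factor s - 1 makes every term entire.\<close>

definition zterm :: "nat \<Rightarrow> complex \<Rightarrow> complex" where
  "zterm n s = (s - 1) * npow n s + npow (Suc n) (s - 1) - npow n (s - 1)"

lemma zterm_bound:
  assumes s: "Re s > 0"
  shows "norm (zterm n s) \<le> norm (s - 1) * norm s * real (Suc n) powr (- Re s - 1)"
proof -
  define a where "a = real (Suc n)"
  have a: "1 \<le> a" by (simp add: a_def)
  let ?S = "closed_segment (complex_of_real a) (complex_of_real (a + 1))"
  have S: "\<exists>u. z = of_real u \<and> a \<le> u \<and> u \<le> a + 1" if zS: "z \<in> ?S" for z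
  proof -
    obtain t where t: "0 \<le> t" "t \<le> 1" "z = (1 - t) *\<^sub>R complex_of_real a + t *\<^sub>R complex_of_real (a + 1)"
      using zS by (auto simp: in_segment)
    have "z = of_real (a + t)" unfolding t(3) by (simp add: scaleR_conv_of_real algebra_simps)
    then show ?thesis using t by (intro exI[of _ "a + t"]) auto
  qed
  \<comment> \<open>Its derivative (s - 1)(a^(-s) - z^(-s)) is small on the segment, and its
    increment over the segment is \<open>zterm n s\<close>.\<close>
  define f where "f = (\<lambda>z. (s - 1) * of_real a powr (- s) * z + z powr (1 - s))"
  have "norm (f (of_real (a + 1)) - f (of_real a)) \<le>
      (norm (s - 1) * (norm s * a powr (- Re s - 1))) * norm (complex_of_real (a + 1) - complex_of_real a)"
  proof (rule field_differentiable_bound[where S = ?S and f' = "\<lambda>z. (s - 1) * (of_real a powr (- s) - z powr (- s))"])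
    show "(f has_field_derivative (s - 1) * (of_real a powr (- s) - z powr (- s))) (at z within ?S)" if zS: "z \<in> ?S" for z
    proof -
      obtain u where "z = of_real u" "a \<le> u" using S[OF zS] by blast
      then have "z \<notin> \<real>\<^sub>\<le>\<^sub>0" using a by (simp add: complex_nonpos_Reals_iff)
      then have "((\<lambda>z. z powr (1 - s)) has_field_derivative (1 - s) * z powr (1 - s - 1)) (at z)"
        by (rule has_field_derivative_powr)
      then have "(f has_field_derivative (s - 1) * of_real a powr (- s) * 1 + (1 - s) * z powr (1 - s - 1)) (at z)"
        unfolding f_def by (intro DERIV_add DERIV_cmult DERIV_ident)
      moreover have "(s - 1) * of_real a powr (- s) * 1 + (1 - s) * z powr (1 - s - 1) = (s - 1) * (of_real a powr (- s) - z powr (- s))"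
        by (simp add: algebra_simps)
      ultimately show ?thesis by (simp add: has_field_derivative_at_within)
    qed
    show "norm ((s - 1) * (of_real a powr (- s) - z powr (- s))) \<le> norm (s - 1) * (norm s * a powr (- Re s - 1))" if zS: "z \<in> ?S" for z
    proof -
      obtain u where u: "z = of_real u" "a \<le> u" "u \<le> a + 1" using S[OF zS] by blast
      have "norm (of_real a powr (- s) - z powr (- s)) \<le> norm s * a powr (- Re s - 1) * (u - a)"
        using powr_diff_bound[OF a u(2) s] u(1) by (simp add: norm_minus_commute)
      also have "\<dots> \<le> norm s * a powr (- Re s - 1) * 1" using u by (intro mult_left_mono) auto
      finally show ?thesis by (simp add: norm_mult mult_left_mono)
    qed
  qed auto
  moreover have "f (of_real (a + 1)) - f (of_real a) = zterm n s"
    by (simp add: f_def zterm_def npow_def a_def algebra_simps)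
  ultimately show ?thesis by (simp add: a_def mult.assoc)
qed

lemma summable_Suc_powr: "\<sigma> > 0 \<Longrightarrow> summable (\<lambda>n. real (Suc n) powr (- \<sigma> - 1))"
  using summable_real_powr_iff[of "- \<sigma> - 1"] summable_Suc_iff[of "\<lambda>n. real n powr (- \<sigma> - 1)"] by simp

text \<open>Common tool for \<open>zeta_reg\<close> and \<open>L_reg\<close>. The quadratic factor
  is locally bounded, so the Weierstrass test applies on small discs; for Re s \<ge> 1/2 comparison
  with the sum of n^(-3/2) leaves a bound polynomial in |s|.\<close>

lemma series_half_plane:
  fixes f :: "nat \<Rightarrow> complex \<Rightarrow> complex"
  assumes hol: "\<And>n. f n holomorphic_on {s. Re s > 0}"
    and bnd: "\<And>n s. Re s > 0 \<Longrightarrow> norm (f n s) \<le> c * (norm s + 1)\<^sup>2 * real (Suc n) powr (- Re s - 1)"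
    and c: "c \<ge> 0"
  shows "(\<lambda>s. \<Sum>n. f n s) holomorphic_on {s. Re s > 0}"
    and "Re s > 0 \<Longrightarrow> summable (\<lambda>n. f n s)"
    and "1/2 \<le> Re s \<Longrightarrow> norm (\<Sum>n. f n s) \<le> c * (norm s + 1)\<^sup>2 * (\<Sum>n. real (Suc n) powr (-3/2))"
proof -
  show "(\<lambda>s. \<Sum>n. f n s) holomorphic_on {s. Re s > 0}"
  proof (rule holomorphic_uniform_sequence)
    show "open {s. Re s > 0}" by (rule open_halfspace_Re_gt)
    show "(\<lambda>s. \<Sum>i<n. f i s) holomorphic_on {s. Re s > 0}" for n
      by (intro holomorphic_intros hol)
    fix x assume "x \<in> {s. Re s > 0}"
    then have x: "Re x > 0" by simp
    define d where "d = Re x / 2"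
    have d: "d > 0" using x by (simp add: d_def)
    have cb: "d \<le> Re s \<and> norm s \<le> norm x + d" if "s \<in> cball x d" for s
    proof -
      have "norm (x - s) \<le> d" using that by (simp add: dist_norm)
      then have "\<bar>Re (x - s)\<bar> \<le> d" using abs_Re_le_cmod order_trans by blast
      moreover have "norm s \<le> norm x + norm (x - s)" by (metis norm_minus_commute norm_triangle_sub)
      ultimately show ?thesis using \<open>norm (x - s) \<le> d\<close> by (auto simp: d_def abs_if split: if_splits)
    qed
    have "uniform_limit (cball x d) (\<lambda>n s. \<Sum>i<n. f i s) (\<lambda>s. \<Sum>n. f n s) sequentially"
    proof (rule Weierstrass_m_test_ev[OF eventuallyI])
      show "summable (\<lambda>n. c * (norm x + d + 1)\<^sup>2 * real (Suc n) powr (- d - 1))"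
        by (intro summable_mult summable_Suc_powr d)
      show "\<forall>s\<in>cball x d. norm (f n s) \<le> c * (norm x + d + 1)\<^sup>2 * real (Suc n) powr (- d - 1)" for n
      proof
        fix s assume s: "s \<in> cball x d"
        have "norm (f n s) \<le> c * (norm s + 1)\<^sup>2 * real (Suc n) powr (- Re s - 1)"
          using cb[OF s] d by (intro bnd) linarith
        also have "\<dots> \<le> c * (norm x + d + 1)\<^sup>2 * real (Suc n) powr (- d - 1)"
          using cb[OF s] c by (intro mult_mono mult_left_mono power_mono powr_mono) auto
        finally show "norm (f n s) \<le> c * (norm x + d + 1)\<^sup>2 * real (Suc n) powr (- d - 1)" .
      qed
    qed
    moreover have "cball x d \<subseteq> {s. Re s > 0}" using cb d by force
    ultimately show "\<exists>d>0. cball x d \<subseteq> {s. Re s > 0} \<and> uniform_limit (cball x d) (\<lambda>n s. \<Sum>i<n. f i s) (\<lambda>s. \<Sum>n. f n s) sequentially"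
      using d by blast
  qed
  show sm: "summable (\<lambda>n. f n s)" if "Re s > 0" for s
    by (rule summable_comparison_test'[OF summable_mult[OF summable_Suc_powr[OF that]] bnd[OF that]])
  assume s: "1/2 \<le> Re s"
  have "norm (\<Sum>n. f n s) \<le> (\<Sum>n. c * (norm s + 1)\<^sup>2 * real (Suc n) powr (-3/2))"
  proof (rule norm_suminf_le)
    show "summable (\<lambda>n. c * (norm s + 1)\<^sup>2 * real (Suc n) powr (-3/2))"
      using summable_Suc_powr[of "1/2"] by (intro summable_mult) simp
    show "norm (f n s) \<le> c * (norm s + 1)\<^sup>2 * real (Suc n) powr (-3/2)" for n
      by (rule order_trans[OF bnd]) (use s c in \<open>auto intro!: mult_left_mono powr_mono\<close>)
  qed
  also have "\<dots> = c * (norm s + 1)\<^sup>2 * (\<Sum>n. real (Suc n) powr (-3/2))"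
    using summable_Suc_powr[of "1/2"] by (intro suminf_mult) simp
  finally show "norm (\<Sum>n. f n s) \<le> c * (norm s + 1)\<^sup>2 * (\<Sum>n. real (Suc n) powr (-3/2))" .
qed

lemma npow_tendsto_0:
  assumes "Re s > 0"
  shows "(\<lambda>n. npow n s) \<longlonglongrightarrow> 0"
proof (rule tendsto_norm_zero_cancel)
  have "filterlim (\<lambda>n. real (Suc n)) at_top sequentially"
    using filterlim_compose[OF filterlim_real_sequentially filterlim_Suc] by simp
  then have "(\<lambda>n. real (Suc n) powr (- Re s)) \<longlonglongrightarrow> 0"
    by (rule tendsto_neg_powr[rotated]) (use assms in simp)
  then show "(\<lambda>n. norm (npow n s)) \<longlonglongrightarrow> 0" by (simp only: norm_npow)
qed

text \<open>\<open>(s - 1) \<zeta>(s)\<close>, continued to the right half-plane.\<close>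
definition zeta_reg :: "complex \<Rightarrow> complex" where
  "zeta_reg s = 1 + (\<Sum>n. zterm n s)"

lemma zterm_bound2:
  assumes "Re s > 0"
  shows "norm (zterm n s) \<le> 1 * (norm s + 1)\<^sup>2 * real (Suc n) powr (- Re s - 1)"
proof -
  have "norm (s - 1) * norm s \<le> (norm s + 1) * (norm s + 1)"
    using norm_triangle_ineq4[of s 1] by (intro mult_mono) auto
  then have "norm (s - 1) * norm s * real (Suc n) powr (- Re s - 1) \<le> (norm s + 1)\<^sup>2 * real (Suc n) powr (- Re s - 1)"
    by (intro mult_right_mono) (auto simp: power2_eq_square)
  from order_trans[OF zterm_bound[OF assms, of n] this] show ?thesis by simp
qed

lemma zterm_holomorphic: "zterm n holomorphic_on A"
  unfolding zterm_def by (intro holomorphic_intros)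

lemmas zterm_series = series_half_plane[of zterm 1, OF zterm_holomorphic zterm_bound2, simplified]

lemma zeta_reg_holomorphic: "zeta_reg holomorphic_on {s. Re s > 0}"
  unfolding zeta_reg_def by (intro holomorphic_intros zterm_series(1))

lemma zeta_reg_1 [simp]: "zeta_reg 1 = 1"
  by (simp add: zeta_reg_def zterm_def)

lemma npow_summable:
  assumes "Re s > 1"
  shows "summable (\<lambda>n. norm (npow n s))"
  using summable_Suc_powr[of "Re s - 1"] assms by (simp add: norm_npow)

lemma zeta_reg_series:
  assumes s: "Re s > 1"
  shows "zeta_reg s = (s - 1) * (\<Sum>n. npow n s)"
proof -
  have p: "(\<Sum>n<N. zterm n s) = (s - 1) * (\<Sum>n<N. npow n s) + npow N (s - 1) - 1" for N
    by (induction N) (auto simp: zterm_def algebra_simps)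
  have "(\<lambda>N. (s - 1) * (\<Sum>n<N. npow n s) + npow N (s - 1) - 1) \<longlonglongrightarrow> (s - 1) * (\<Sum>n. npow n s) + 0 - 1"
    using s by (intro tendsto_diff tendsto_add tendsto_mult_left tendsto_const npow_tendsto_0
        summable_LIMSEQ[OF summable_norm_cancel[OF npow_summable[OF s]]]) simp
  then have "(\<lambda>n. zterm n s) sums ((s - 1) * (\<Sum>n. npow n s) - 1)"
    unfolding sums_def p by simp
  then show ?thesis by (simp add: zeta_reg_def sums_iff)
qed

text \<open>The mean of \<open>\<psi>\<close> over a period, which is the residue of L(s, \<psi>) at
  1. Subtracting it from the coefficients makes their partial sums bounded; the subtracted part is
  carried by \<open>zeta_reg\<close>.\<close>

definition char_mean :: "nat \<Rightarrow> (nat \<Rightarrow> complex) \<Rightarrow> complex" where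
  "char_mean q \<psi> = (\<Sum>u\<in>residue_units q. \<psi> u) / of_nat q"

definition char_disc :: "nat \<Rightarrow> (nat \<Rightarrow> complex) \<Rightarrow> nat \<Rightarrow> complex" where
  "char_disc q \<psi> n = (\<Sum>m<n. (\<psi> (Suc m) - char_mean q \<psi>))"

lemma sum_period:
  fixes f :: "nat \<Rightarrow> complex"
  assumes "\<And>n. f (n + q) = f n"
  shows "(\<Sum>m<q. f (m + n)) = (\<Sum>m<q. f m)"
proof (induction n)
  case (Suc n)
  have "(\<Sum>m<q. f (m + Suc n)) + f n = (\<Sum>m<q. f (m + n)) + f (q + n)"
    using sum.lessThan_Suc_shift[of "\<lambda>m. f (m + n)" q] sum.lessThan_Suc[of "\<lambda>m. f (m + n)" q]
    by (simp add: add.commute)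
  then show ?case using Suc assms[of n] by (simp add: add.commute)
qed simp

lemma norm_char_mean:
  assumes "dirichlet_char q \<psi>" "q \<ge> 1"
  shows "norm (char_mean q \<psi>) \<le> 1"
proof -
  have "norm (\<Sum>u\<in>residue_units q. \<psi> u) \<le> (\<Sum>u\<in>residue_units q. 1)"
    by (rule sum_norm_le) (rule norm_dirichlet_char_le[OF assms])
  also have "\<dots> \<le> real q"
    using card_mono[of "{..<q}" "residue_units q"] by (auto simp: residue_units_def)
  finally show ?thesis using assms(2) by (simp add: char_mean_def norm_divide divide_simps)
qed

text \<open>The centred coefficients sum to zero over a period, so \<open>char_disc q \<psi>\<close>
  is periodic and fewer than \<open>q\<close> terms of modulus at most 2 remain.\<close>

lemma norm_char_disc:
  assumes d: "dirichlet_char q \<psi>" and q: "q \<ge> 1"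
  shows "norm (char_disc q \<psi> n) \<le> 2 * real q"
proof -
  define f where "f = (\<lambda>m. \<psi> (Suc m) - char_mean q \<psi>)"
  have per: "f (m + q) = f m" for m using dirichlet_charD(3)[OF d, of "Suc m"] by (simp add: f_def)
  have U: "(\<Sum>m<q. \<psi> m) = (\<Sum>u\<in>residue_units q. \<psi> u)"
    by (rule sum.mono_neutral_right) (use dirichlet_charD(4)[OF d] in \<open>auto simp: residue_units_def\<close>)
  have "(\<Sum>m<q. \<psi> (m + 1)) = (\<Sum>m<q. \<psi> m)" by (rule sum_period) (rule dirichlet_charD(3)[OF d])
  then have z: "(\<Sum>m<q. f m) = 0" using q by (simp add: f_def sum_subtractf U char_mean_def)
  have step: "char_disc q \<psi> (q + n) = char_disc q \<psi> n" for n
  proof -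
    have "char_disc q \<psi> (q + n) = (\<Sum>m<n. f m) + (\<Sum>m<q. f (m + n))"
      unfolding char_disc_def f_def[symmetric] by (induction q) auto
    then show ?thesis using z by (simp only: sum_period[of f, OF per]) (simp add: char_disc_def f_def)
  qed
  have "char_disc q \<psi> (k * q + n) = char_disc q \<psi> n" for k n
    by (induction k) (use step in \<open>simp_all add: add.assoc\<close>)
  then have "char_disc q \<psi> n = char_disc q \<psi> (n mod q)" by (metis div_mult_mod_eq)
  moreover have "norm (char_disc q \<psi> (n mod q)) \<le> (\<Sum>m<n mod q. 2)"
    unfolding char_disc_def
  proof (rule sum_norm_le)
    fix m show "norm (\<psi> (Suc m) - char_mean q \<psi>) \<le> 2"
      using norm_triangle_ineq4[of "\<psi> (Suc m)" "char_mean q \<psi>"] norm_char_mean[OF d q] norm_dirichlet_char_le[OF d q, of "Suc m"] by linarith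
  qed
  moreover have "real (n mod q) \<le> real q" using q by (simp add: less_imp_le)
  ultimately show ?thesis by simp
qed

text \<open>Abel summation of the Dirichlet series with centred coefficients
  \<open>\<psi> (Suc n) - char_mean q \<psi>\<close>, which extends it from Re s > 1 to Re s >
  0.\<close>

definition L_reg :: "nat \<Rightarrow> (nat \<Rightarrow> complex) \<Rightarrow> complex \<Rightarrow> complex" where
  "L_reg q \<psi> s = (\<Sum>n. char_disc q \<psi> (Suc n) * (npow n s - npow (Suc n) s))"

lemma L_reg_term_bound:
  assumes d: "dirichlet_char q \<psi>" and q: "q \<ge> 1" and s: "Re s > 0"
  shows "norm (char_disc q \<psi> (Suc n) * (npow n s - npow (Suc n) s)) \<le> 2 * real q * (norm s + 1)\<^sup>2 * real (Suc n) powr (- Re s - 1)"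
proof -
  have "norm s \<le> (norm s + 1)\<^sup>2" by (simp add: power2_eq_square algebra_simps)
  then have "norm s * real (Suc n) powr (- Re s - 1) \<le> (norm s + 1)\<^sup>2 * real (Suc n) powr (- Re s - 1)"
    by (intro mult_right_mono) auto
  then have "norm (npow n s - npow (Suc n) s) \<le> (norm s + 1)\<^sup>2 * real (Suc n) powr (- Re s - 1)"
    using npow_diff_bound[OF s, of n] by linarith
  then have "norm (char_disc q \<psi> (Suc n)) * norm (npow n s - npow (Suc n) s) \<le> (2 * real q) * ((norm s + 1)\<^sup>2 * real (Suc n) powr (- Re s - 1))"
    using norm_char_disc[OF d q] by (intro mult_mono) auto
  then show ?thesis by (simp add: norm_mult mult.assoc)
qed

lemma L_reg_series:
  assumes d: "dirichlet_char q \<psi>" and q: "q \<ge> 1"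
  shows "L_reg q \<psi> holomorphic_on {s. Re s > 0}"
    and "1/2 \<le> Re s \<Longrightarrow> norm (L_reg q \<psi> s) \<le> 2 * real q * (norm s + 1)\<^sup>2 * (\<Sum>n. real (Suc n) powr (-3/2))"
    and "Re s > 1 \<Longrightarrow> L_reg q \<psi> s = (\<Sum>n. (\<psi> (Suc n) - char_mean q \<psi>) * npow n s)"
proof -
  have h: "(\<lambda>s. char_disc q \<psi> (Suc n) * (npow n s - npow (Suc n) s)) holomorphic_on {s. Re s > 0}" for n
    by (intro holomorphic_intros)
  note S = series_half_plane[of "\<lambda>n s. char_disc q \<psi> (Suc n) * (npow n s - npow (Suc n) s)" "2 * real q", OF h L_reg_term_bound[OF d q], simplified]
  show "L_reg q \<psi> holomorphic_on {s. Re s > 0}" using S(1) by (simp add: L_reg_def[abs_def])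
  show "1/2 \<le> Re s \<Longrightarrow> norm (L_reg q \<psi> s) \<le> 2 * real q * (norm s + 1)\<^sup>2 * (\<Sum>n. real (Suc n) powr (-3/2))"
    using S(3)[of s] by (simp add: L_reg_def)
  assume s: "Re s > 1"
  have p: "(\<Sum>n<N. (\<psi> (Suc n) - char_mean q \<psi>) * npow n s) = char_disc q \<psi> N * npow N s +
      (\<Sum>n<N. char_disc q \<psi> (Suc n) * (npow n s - npow (Suc n) s))" for N
    by (induction N) (auto simp: char_disc_def algebra_simps)
  have "(\<lambda>N. char_disc q \<psi> N * npow N s) \<longlonglongrightarrow> 0"
  proof (rule tendsto_norm_zero_cancel, rule tendsto_sandwich[OF _ _ tendsto_const])
    show "(\<lambda>N. 2 * real q * norm (npow N s)) \<longlonglongrightarrow> 0"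
      using tendsto_mult_right_zero[OF tendsto_norm_zero[OF npow_tendsto_0]] s by auto
    show "\<forall>\<^sub>F N in sequentially. norm (char_disc q \<psi> N * npow N s) \<le> 2 * real q * norm (npow N s)"
      by (intro always_eventually allI) (simp add: norm_mult mult_right_mono norm_char_disc[OF d q])
  qed auto
  moreover have "(\<lambda>N. \<Sum>n<N. char_disc q \<psi> (Suc n) * (npow n s - npow (Suc n) s)) \<longlonglongrightarrow> L_reg q \<psi> s"
    unfolding L_reg_def by (intro summable_LIMSEQ S(2)) (use s in auto)
  ultimately have "(\<lambda>n. (\<psi> (Suc n) - char_mean q \<psi>) * npow n s) sums (0 + L_reg q \<psi> s)"
    unfolding sums_def p by (rule tendsto_add)
  then show "L_reg q \<psi> s = (\<Sum>n. (\<psi> (Suc n) - char_mean q \<psi>) * npow n s)" by (simp add: sums_iff)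
qed

lemma char_mean_eq:
  assumes "dirichlet_char q \<psi>" "q \<ge> 1"
  shows "\<not> principal_char q \<psi> \<Longrightarrow> char_mean q \<psi> = 0" "principal_char q \<psi> \<Longrightarrow> char_mean q \<psi> \<noteq> 0"
proof -
  show "\<not> principal_char q \<psi> \<Longrightarrow> char_mean q \<psi> = 0"
    by (simp add: char_mean_def sum_nonprincipal_char[OF assms])
  assume "principal_char q \<psi>"
  then have "(\<Sum>u\<in>residue_units q. \<psi> u) = (\<Sum>u\<in>residue_units q. 1)"
    by (intro sum.cong) (auto simp: principal_char_def residue_units_def)
  also have "\<dots> = of_nat (card (residue_units q))" by simp
  also have "\<dots> \<noteq> 0" using card_residue_units_pos[OF assms(2)] by (metis less_numeral_extra(3) of_nat_eq_0_iff)
  finally show "char_mean q \<psi> \<noteq> 0" using assms(2) by (simp add: char_mean_def)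
qed

lemma char_npow_summable:
  assumes "dirichlet_char q \<psi>" "q \<ge> 1" "Re s > 1"
  shows "summable (\<lambda>n. norm (\<psi> (Suc n) * npow n s))"
  by (rule summable_comparison_test'[OF npow_summable[OF assms(3)]])
    (use norm_dirichlet_char_le[OF assms(1,2)] in \<open>auto simp: norm_mult intro!: mult_left_le_one_le\<close>)

text \<open>The value 0 outside \<open>L_dom q \<psi>\<close> is the default prescribed by
  \<open>L_fun\<close>, so that the two can be equal as functions.\<close>

definition L_ext :: "nat \<Rightarrow> (nat \<Rightarrow> complex) \<Rightarrow> complex \<Rightarrow> complex" where
  "L_ext q \<psi> s = (if s \<in> L_dom q \<psi> then L_reg q \<psi> s + char_mean q \<psi> * zeta_reg s / (s - 1) else 0)"

lemma open_L_dom: "open (L_dom q \<psi>)"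
  unfolding L_dom_def by (intro open_Diff open_halfspace_Re_gt) auto

lemma connected_L_dom: "connected (L_dom q \<psi>)"
proof (cases "principal_char q \<psi>")
  case True
  have "connected ({s. Re s > 0} - {1::complex})"
    by (rule connected_open_delete) (auto intro!: open_halfspace_Re_gt convex_connected convex_halfspace_Re_gt)
  then show ?thesis using True by (simp add: L_dom_def)
next
  case False
  then show ?thesis by (auto simp: L_dom_def intro!: convex_connected convex_halfspace_Re_gt)
qed

lemma in_L_dom: "Re s > 1 \<Longrightarrow> s \<in> L_dom q \<psi>"
  by (auto simp: L_dom_def)

lemma L_ext_holomorphic:
  assumes d: "dirichlet_char q \<psi>" and q: "q \<ge> 1"
  shows "L_ext q \<psi> holomorphic_on L_dom q \<psi>"
proof -
  have sub: "L_dom q \<psi> \<subseteq> {s. Re s > 0}" by (auto simp: L_dom_def)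
  note hl = holomorphic_on_subset[OF L_reg_series(1)[OF d q] sub]
  note hz = holomorphic_on_subset[OF zeta_reg_holomorphic sub]
  have "(\<lambda>s. L_reg q \<psi> s + char_mean q \<psi> * zeta_reg s / (s - 1)) holomorphic_on L_dom q \<psi>"
  proof (cases "principal_char q \<psi>")
    case True
    then have "\<And>s. s \<in> L_dom q \<psi> \<Longrightarrow> s - 1 \<noteq> 0" by (auto simp: L_dom_def)
    then show ?thesis by (intro holomorphic_intros hl hz) auto
  next
    case False
    then show ?thesis using hl by (simp add: char_mean_eq(1)[OF d q])
  qed
  then show ?thesis by (rule holomorphic_transform) (simp add: L_ext_def)
qed

lemma npow_eq: "\<psi> (Suc n) * npow n s = \<psi> (Suc n) / of_nat (Suc n) powr s"
  by (simp add: npow_def powr_minus divide_inverse)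

lemma L_ext_series:
  assumes d: "dirichlet_char q \<psi>" and q: "q \<ge> 1" and s: "Re s > 1"
  shows "L_ext q \<psi> s = (\<Sum>n. \<psi> (Suc n) * npow n s)"
proof -
  have s1: "s - 1 \<noteq> 0" using s by auto
  note sm = summable_norm_cancel[OF npow_summable[OF s]] summable_norm_cancel[OF char_npow_summable[OF d q s]]
  have "L_reg q \<psi> s = (\<Sum>n. \<psi> (Suc n) * npow n s - char_mean q \<psi> * npow n s)"
    using L_reg_series(3)[OF d q s] by (simp add: algebra_simps)
  also have "\<dots> = (\<Sum>n. \<psi> (Suc n) * npow n s) - char_mean q \<psi> * (\<Sum>n. npow n s)"
    using sm by (simp add: suminf_diff[symmetric] suminf_mult summable_mult)
  finally show ?thesis using s1 by (simp add: L_ext_def in_L_dom[OF s] zeta_reg_series[OF s])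
qed

lemma L_fun_eq_L_ext:
  assumes d: "dirichlet_char q \<psi>" and q: "q \<ge> 1"
  shows "L_fun q \<psi> = L_ext q \<psi>"
  unfolding L_fun_def
proof (rule the_equality)
  show "L_ext q \<psi> holomorphic_on L_dom q \<psi> \<and>
    (\<forall>s. 1 < Re s \<longrightarrow> L_ext q \<psi> s = (\<Sum>n. \<psi> (Suc n) / of_nat (Suc n) powr s)) \<and> (\<forall>s. s \<notin> L_dom q \<psi> \<longrightarrow> L_ext q \<psi> s = 0)"
    using L_ext_holomorphic[OF d q] L_ext_series[OF d q] by (simp add: npow_eq) (simp add: L_ext_def)
  fix f assume f: "f holomorphic_on L_dom q \<psi> \<and>
    (\<forall>s. 1 < Re s \<longrightarrow> f s = (\<Sum>n. \<psi> (Suc n) / of_nat (Suc n) powr s)) \<and> (\<forall>s. s \<notin> L_dom q \<psi> \<longrightarrow> f s = 0)"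
  show "f = L_ext q \<psi>"
  proof
    fix s
    show "f s = L_ext q \<psi> s"
    proof (cases "s \<in> L_dom q \<psi>")
      case True
      show ?thesis
      proof (rule analytic_continuation_open[where f = f and g = "L_ext q \<psi>" and s = "{s. Re s > 1}" and s' = "L_dom q \<psi>"])
        show "{s. Re s > 1} \<noteq> {}" using exI[of "\<lambda>s. Re s > 1" 2] by auto
        show "f z = L_ext q \<psi> z" if "z \<in> {s. 1 < Re s}" for z
          using f that L_ext_series[OF d q, of z] by (simp add: npow_eq)
      qed (use f True L_ext_holomorphic[OF d q] in \<open>auto simp: open_L_dom connected_L_dom in_L_dom open_halfspace_Re_gt\<close>)
    next
      case False
      then show ?thesis using f by (simp add: L_ext_def)
    qed
  qed
qed

lemma L_fun_series:
  assumes "dirichlet_char q \<psi>" "q \<ge> 1" "Re s > 1"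
  shows "L_fun q \<psi> s = (\<Sum>n. \<psi> (Suc n) * npow n s)"
  using L_ext_series[OF assms] L_fun_eq_L_ext[OF assms(1,2)] by simp

lemma npow_mult: "npow m s * npow n s = of_nat (Suc m * Suc n) powr (- s)"
  unfolding npow_def
  by (subst powr_times_real[symmetric]) (auto simp del: of_nat_Suc of_nat_mult simp: of_nat_mult[symmetric])

lemma mu_npow_summable:
  assumes "dirichlet_char q \<psi>" "q \<ge> 1" "Re s > 1"
  shows "summable (\<lambda>n. norm (of_int (mu (Suc n)) * \<psi> (Suc n) * npow n s))"
  by (rule summable_comparison_test'[OF char_npow_summable[OF assms]])
    (use norm_mu_le in \<open>auto simp: norm_mult mult.assoc simp del: norm_of_int intro!: mult_left_le_one_le\<close>)

definition mu_series :: "(nat \<Rightarrow> complex) \<Rightarrow> complex \<Rightarrow> complex" where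
  "mu_series \<psi> s = (\<Sum>n. of_int (mu (Suc n)) * \<psi> (Suc n) * npow n s)"

text \<open>Absolute convergence permits arranging the double series by the product k of the two
  indices; the inner sum over divisors of k is \<open>sum_mu_divisors\<close>, and only k = 1
  survives.\<close>

lemma mu_series_L_fun:
  assumes d: "dirichlet_char q \<psi>" and q: "q \<ge> 1" and s: "Re s > 1"
  shows "mu_series \<psi> s * L_fun q \<psi> s = 1"
proof -
  define f where "f = (\<lambda>n. of_int (mu (Suc n)) * \<psi> (Suc n) * npow n s)"
  define g where "g = (\<lambda>n. \<psi> (Suc n) * npow n s)"
  define h where "h = (\<lambda>(k,m). of_int (mu m) * \<psi> k * of_nat k powr (- s))"
  have sf: "summable (\<lambda>n. norm (f n))" unfolding f_def by (rule mu_npow_summable[OF d q s])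
  have sg: "summable (\<lambda>n. norm (g n))" unfolding g_def by (rule char_npow_summable[OF d q s])
  have hf: "(f has_sum mu_series \<psi> s) UNIV"
    using norm_summable_imp_has_sum[OF sf] summable_norm_cancel[OF sf] by (simp add: mu_series_def f_def summable_sums)
  have hg: "(g has_sum L_fun q \<psi> s) UNIV"
    using norm_summable_imp_has_sum[OF sg] summable_norm_cancel[OF sg] by (simp add: L_fun_series[OF d q s] g_def summable_sums)
  have af: "(\<lambda>x. norm (f x)) summable_on UNIV" and ag: "(\<lambda>x. norm (g x)) summable_on UNIV"
    using norm_summable_imp_summable_on[of "\<lambda>n. norm (f n)"] norm_summable_imp_summable_on[of "\<lambda>n. norm (g n)"] sf sg by auto
  have "(\<lambda>x. norm (case x of (m,n) \<Rightarrow> f m * g n)) summable_on UNIV \<times> UNIV"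
  proof (rule Infinite_Sum.abs_summable_on_Sigma_iff[THEN iffD2], intro conjI ballI)
    show "(\<lambda>y. norm (case (m, y) of (m, n) \<Rightarrow> f m * g n)) summable_on UNIV" for m
      using ag by (simp add: norm_mult summable_on_cmult_right)
    have "(\<lambda>m. norm (f m) * infsum (\<lambda>n. norm (g n)) UNIV) summable_on UNIV"
      by (intro summable_on_cmult_left af)
    then show "(\<lambda>m. norm (infsum (\<lambda>y. norm (case (m, y) of (m, n) \<Rightarrow> f m * g n)) UNIV)) summable_on UNIV"
      using ag by (simp add: norm_mult infsum_cmult_right' infsum_nonneg)
  qed
  then have sm: "(\<lambda>(m,n). f m * g n) summable_on UNIV \<times> UNIV"
    by (rule Infinite_Sum.abs_summable_summable)
  \<comment> \<open>The index pair (m, n) stands for the factors m + 1 and n + 1; its image is the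
    product together with the divisor carrying \<open>mu\<close>.\<close>
  define b where "b = (\<lambda>(m,n). (Suc m * Suc n, Suc m))"
  have bij: "bij_betw b (UNIV \<times> UNIV) (Sigma {1..} (\<lambda>k. {m. m dvd k}))"
  proof (rule bij_betwI[where g = "\<lambda>(k,m). (m - 1, k div m - 1)"])
    show "b \<in> UNIV \<times> UNIV \<rightarrow> Sigma {1..} (\<lambda>k. {m. m dvd k})" 
      by (auto simp: b_def simp del: mult_Suc mult_Suc_right)
    show "(\<lambda>(k,m). (m - 1, k div m - 1)) (b x) = x" for x
      by (cases x) (simp add: b_def del: mult_Suc mult_Suc_right)
    show "b ((\<lambda>(k,m). (m - 1, k div m - 1)) y) = y" if "y \<in> Sigma {1..} (\<lambda>k. {m. m dvd k})" for y
    proof -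
      obtain k m where y: "y = (k, m)" by (cases y)
      have m: "m dvd k" "k \<ge> 1" using that y by auto
      then obtain j where j: "k = m * j" by auto
      then have "m > 0" "j > 0" using m by auto
      then obtain m' j' where "m = Suc m'" "j = Suc j'" by (metis gr0_implies_Suc)
      then show ?thesis by (simp add: y b_def j del: mult_Suc mult_Suc_right)
    qed
  qed auto
  have fh: "(case x of (m,n) \<Rightarrow> f m * g n) = h (b x)" for x
  proof (cases x)
    case (Pair m n)
    have "f m * g n = of_int (mu (Suc m)) * (\<psi> (Suc m) * \<psi> (Suc n)) * (npow m s * npow n s)"
      by (simp add: f_def g_def mult_ac)
    then show ?thesis by (simp only: npow_mult dirichlet_charD(1)[OF d, symmetric]) (simp add: Pair h_def b_def)
  qed
  have fh': "(\<lambda>(m,n). f m * g n) = (\<lambda>x. h (b x))" by (rule ext) (rule fh)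
  have smh: "h summable_on Sigma {1..} (\<lambda>k. {m. m dvd k})"
    using sm unfolding fh' summable_on_reindex_bij_betw[OF bij] .
  have "mu_series \<psi> s * L_fun q \<psi> s = infsum (\<lambda>m. infsum (\<lambda>n. f m * g n) UNIV) UNIV"
    using hf hg by (simp add: infsumI infsum_cmult_right' infsum_cmult_left')
  also have "\<dots> = infsum (\<lambda>(m,n). f m * g n) (UNIV \<times> UNIV)"
    using infsum_Sigma_banach[OF sm] by simp
  also have "\<dots> = infsum h (Sigma {1..} (\<lambda>k. {m. m dvd k}))"
    unfolding fh' by (rule infsum_reindex_bij_betw[OF bij])
  also have "\<dots> = infsum (\<lambda>k. infsum (\<lambda>m. h (k, m)) {m. m dvd k}) {1..}"
    using infsum_Sigma_banach[OF smh] by simp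
  also have "\<dots> = infsum (\<lambda>k::nat. if k = 1 then 1 else 0) {1..}"
  proof (rule Infinite_Sum.infsum_cong)
    fix k :: nat assume k: "k \<in> {1..}"
    have "infsum (\<lambda>m. h (k, m)) {m. m dvd k} = (\<Sum>m | m dvd k. of_int (mu m)) * \<psi> k * of_nat k powr (- s)"
      using k by (subst infsum_finite) (auto simp: h_def sum_distrib_right)
    also have "(\<Sum>m | m dvd k. of_int (mu m)) = (of_int (\<Sum>m | m dvd k. mu m) :: complex)" by simp
    also have "(\<Sum>m | m dvd k. mu m) = (if k = 1 then 1 else 0)"
      using sum_mu_divisors[of k] k by (cases "k = 1") auto
    finally show "infsum (\<lambda>m. h (k, m)) {m. m dvd k} = (if k = 1 then 1 else 0)"
      using dirichlet_charD[OF d] by simp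
  qed
  also have "\<dots> = infsum (\<lambda>k::nat. if k = 1 then 1 else 0) {1::nat}"
    by (rule infsum_cong_neutral) auto
  finally show ?thesis by simp
qed

section \<open>Bounds for the inverse of an L-function\<close>

lemma telescoping_cube:
  fixes a :: real
  assumes "a > 0"
  shows "1 / (a * (a + 1) * (a + 2)) = 1/2 * (1 / (a * (a + 1)) - 1 / ((a + 1) * (a + 2)))"
proof -
  have "a \<noteq> 0" "a + 1 \<noteq> 0" "a + 2 \<noteq> 0" using assms by auto
  then show ?thesis by (simp add: divide_simps)
qed

text \<open>For n \<ge> 2, n^(-3) \<le> 1/((n-1) n (n+1)), and these bounds telescope to
  1/4.\<close>

lemma L_near_1:
  assumes d: "dirichlet_char q \<psi>" and q: "q \<ge> 1" and s: "Re s \<ge> 3"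
  shows "norm (L_fun q \<psi> s - 1) \<le> 1/4"
proof -
  have s1: "Re s > 1" using s by simp
  define f where "f = (\<lambda>n. \<psi> (Suc n) * npow n s)"
  have sm: "summable f" unfolding f_def using char_npow_summable[OF d q s1] by (rule summable_norm_cancel)
  have "L_fun q \<psi> s - 1 = (\<Sum>n. f (Suc n))"
    using suminf_split_head[OF sm] dirichlet_charD[OF d] by (simp add: L_fun_series[OF d q s1] f_def)
  also have "norm \<dots> \<le> (\<Sum>n. 1/2 * (1 / (real (Suc n) * real (Suc (Suc n))) - 1 / (real (Suc (Suc n)) * real (Suc (Suc (Suc n))))))"
  proof (rule norm_suminf_le)
    fix n
    have "norm (f (Suc n)) \<le> 1 * real (Suc (Suc n)) powr (- Re s)"
      unfolding f_def norm_mult norm_npow using norm_dirichlet_char_le[OF d q] by (intro mult_right_mono) auto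
    also have "\<dots> \<le> real (Suc (Suc n)) powr (- real 3)" using s by (simp add: powr_mono)
    also have "\<dots> = 1 / real (Suc (Suc n)) ^ 3" by (subst powr_minus, subst powr_realpow) (auto simp: divide_inverse)
    also have "\<dots> \<le> 1 / (real (Suc n) * real (Suc (Suc n)) * real (Suc (Suc (Suc n))))"
      by (intro frac_le) (auto simp: power3_eq_cube algebra_simps intro!: add_pos_nonneg)
    also have "\<dots> = 1/2 * (1 / (real (Suc n) * real (Suc (Suc n))) - 1 / (real (Suc (Suc n)) * real (Suc (Suc (Suc n)))))"
      using telescoping_cube[of "real (Suc n)"] by (simp add: add.commute)
    finally show "norm (f (Suc n)) \<le> \<dots>" .
  next
    have l: "(\<lambda>n. 1 / (real (Suc n) * real (Suc (Suc n)))) \<longlonglongrightarrow> 0" by real_asymp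
    show "summable (\<lambda>n. 1/2 * (1 / (real (Suc n) * real (Suc (Suc n))) - 1 / (real (Suc (Suc n)) * real (Suc (Suc (Suc n))))))"
      using telescope_sums'[OF l] by (intro summable_mult) (auto simp: sums_iff)
  qed
  also have "\<dots> = 1/4"
  proof -
    have l: "(\<lambda>n. 1 / (real (Suc n) * real (Suc (Suc n)))) \<longlonglongrightarrow> 0" by real_asymp
    show ?thesis using sums_mult[OF telescope_sums'[OF l], of "1/2"] by (simp add: sums_iff)
  qed
  finally show ?thesis .
qed

lemma L_fun_principal:
  assumes d: "dirichlet_char q \<psi>" and q: "q \<ge> 1" and p: "principal_char q \<psi>" and s: "Re s > 0" "s \<noteq> 1"
  shows "(s - 1) * L_fun q \<psi> s = (s - 1) * L_reg q \<psi> s + char_mean q \<psi> * zeta_reg s"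
  using s p by (simp add: L_fun_eq_L_ext[OF d q] L_ext_def L_dom_def field_simps)

lemma L_fun_nonprincipal:
  assumes d: "dirichlet_char q \<psi>" and q: "q \<ge> 1" and p: "\<not> principal_char q \<psi>" and s: "Re s > 0"
  shows "L_fun q \<psi> s = L_reg q \<psi> s"
  using s p by (simp add: L_fun_eq_L_ext[OF d q] L_ext_def L_dom_def char_mean_eq(1)[OF d q])

text \<open>For principal \<open>\<psi>\<close> the pole of L at 1 turns into a zero of 1/L; there
  1/L is written as (s - 1)/F with F(1) \<noteq> 0.\<close>

lemma inverse_L_holomorphic:
  assumes d: "dirichlet_char q \<psi>" and q: "q \<ge> 1" and S: "S \<subseteq> {s. Re s > 0}"
    and nz: "\<And>s. s \<in> S \<Longrightarrow> s \<in> L_dom q \<psi> \<Longrightarrow> L_fun q \<psi> s \<noteq> 0"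
  shows "(\<lambda>s. 1 / L_fun q \<psi> s) holomorphic_on S"
proof (cases "principal_char q \<psi>")
  case True
  define F where "F = (\<lambda>s. (s - 1) * L_reg q \<psi> s + char_mean q \<psi> * zeta_reg s)"
  have hF: "F holomorphic_on S" unfolding F_def
    by (intro holomorphic_intros holomorphic_on_subset[OF L_reg_series(1)[OF d q] S] holomorphic_on_subset[OF zeta_reg_holomorphic S])
  have F1: "F 1 \<noteq> 0" using char_mean_eq(2)[OF d q True] by (simp add: F_def)
  have Fs: "(s - 1) * L_fun q \<psi> s = F s" if "s \<in> S" "s \<noteq> 1" for s
    using L_fun_principal[OF d q True, of s] that S by (auto simp: F_def)
  have Fn: "F s \<noteq> 0" if "s \<in> S" for s
  proof (cases "s = 1")
    case False
    then have "s \<in> L_dom q \<psi>" using that S True by (auto simp: L_dom_def)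
    then have "L_fun q \<psi> s \<noteq> 0" using nz that by blast
    then show ?thesis using Fs[OF that False] False by (metis mult_eq_0_iff right_minus_eq)
  qed (use F1 in simp)
  have "(\<lambda>s. (s - 1) / F s) holomorphic_on S" using Fn by (intro holomorphic_intros hF) auto
  then show ?thesis
  proof (rule holomorphic_transform)
    fix s assume s: "s \<in> S"
    show "(s - 1) / F s = 1 / L_fun q \<psi> s"
    proof (cases "s = 1")
      case True' : True
      \<comment> \<open>\<open>L_fun\<close> is 0 at its pole by default, and 1/0 = 0 is precisely
        the value that the holomorphic quotient takes at 1.\<close>
      have "L_fun q \<psi> 1 = 0" using True by (simp add: L_fun_eq_L_ext[OF d q] L_ext_def L_dom_def)
      then show ?thesis using True' by simp
    next
      case False
      then show ?thesis using Fs[OF s False] by (metis divide_divide_eq_left' mult.commute div_self eq_iff_diff_eq_0 mult.right_neutral nonzero_divide_mult_cancel_left)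
    qed
  qed
next
  case False
  have "L_fun q \<psi> s \<noteq> 0" if "s \<in> S" for s using nz[OF that] that S False by (auto simp: L_dom_def)
  moreover have "L_fun q \<psi> holomorphic_on S"
    using holomorphic_on_subset[OF L_reg_series(1)[OF d q] S]
    by (rule holomorphic_transform) (use S L_fun_nonprincipal[OF d q False] in auto)
  ultimately show ?thesis by (intro holomorphic_intros) auto
qed

definition L_zeros :: "nat \<Rightarrow> (nat \<Rightarrow> complex) \<Rightarrow> real \<Rightarrow> real \<Rightarrow> complex set" where
  "L_zeros l \<psi> \<sigma> T = {\<rho>\<in>L_dom l \<psi>. L_fun l \<psi> \<rho> = 0 \<and> \<sigma> \<le> Re \<rho> \<and> Re \<rho> \<le> 1
        \<and> 10 \<le> \<bar>Im \<rho>\<bar> \<and> \<bar>Im \<rho>\<bar> \<le> T}"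

text \<open>Finiteness follows from compactness of the box and L(2) \<noteq> 0. Each zero has order
  at least 1, so the count with multiplicity in \<open>N_zeros\<close> dominates the number of
  distinct zeros.\<close>

lemma L_zeros_finite_card:
  assumes d: "dirichlet_char q \<psi>" and q: "q \<ge> 1" and \<sigma>: "\<sigma> > 0"
  shows "finite (L_zeros q \<psi> \<sigma> T)" "real (card (L_zeros q \<psi> \<sigma> T)) \<le> N_zeros q \<psi> \<sigma> T"
proof -
  have hol: "L_fun q \<psi> holomorphic_on L_dom q \<psi>" using L_ext_holomorphic[OF d q] L_fun_eq_L_ext[OF d q] by simp
  have L2: "L_fun q \<psi> 2 \<noteq> 0" using mu_series_L_fun[OF d q, of 2] by auto
  have dom2: "2 \<in> L_dom q \<psi>" by (rule in_L_dom) simp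
  define K where "K = cbox (Complex \<sigma> (- \<bar>T\<bar>)) (Complex 1 \<bar>T\<bar>) \<inter> {z. 10 \<le> \<bar>Im z\<bar>}"
  have cK: "compact K" unfolding K_def
    by (intro compact_Int_closed compact_cbox closed_Collect_le continuous_intros)
  have Ksub: "K \<subseteq> L_dom q \<psi>" using \<sigma> by (auto simp: K_def L_dom_def cbox_def Basis_complex_def)
  have sub: "L_zeros q \<psi> \<sigma> T \<subseteq> {z\<in>K. L_fun q \<psi> z = 0}"
    by (auto simp: L_zeros_def K_def cbox_def Basis_complex_def)
  show fin: "finite (L_zeros q \<psi> \<sigma> T)"
  proof (cases "L_fun q \<psi> constant_on L_dom q \<psi>")
    case True
    then have "L_fun q \<psi> z \<noteq> 0" if "z \<in> L_dom q \<psi>" for z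
      using that L2 dom2 unfolding constant_on_def by metis
    then have "L_zeros q \<psi> \<sigma> T = {}" by (auto simp: L_zeros_def)
    then show ?thesis by simp
  next
    case False
    from holomorphic_compact_finite_zeros[OF hol open_L_dom connected_L_dom cK Ksub False] sub
    show ?thesis by (rule rev_finite_subset)
  qed
  have "1 \<le> real_of_int (zorder (L_fun q \<psi>) z)" if z: "z \<in> L_zeros q \<psi> \<sigma> T" for z
  proof -
    have "z \<in> L_dom q \<psi>" "L_fun q \<psi> z = 0" using z by (auto simp: L_zeros_def)
    then have "zorder (L_fun q \<psi>) z > 0"
      using zorder_exist_zero[OF hol open_L_dom connected_L_dom, of z] L2 dom2 by auto
    then show ?thesis by linarith
  qed
  then have "(\<Sum>z\<in>L_zeros q \<psi> \<sigma> T. 1) \<le> (\<Sum>z\<in>L_zeros q \<psi> \<sigma> T. real_of_int (zorder (L_fun q \<psi>) z))"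
    by (rule sum_mono)
  then show "real (card (L_zeros q \<psi> \<sigma> T)) \<le> N_zeros q \<psi> \<sigma> T"
    by (simp add: N_zeros_def L_zeros_def)
qed

text \<open>The factor (s - 1)/(s0 - 1) removes the pole of a principal L-function and stays near 1
  close to \<open>s0\<close>, since |s0 - 1| \<ge> 7/2. The errors 1/7 and 1/4 and their product add
  up to less than 1/2.\<close>

lemma norm_shifted_ratio:
  assumes s0: "s0 = Complex (\<sigma>0 + 4) t" and \<sigma>0: "1/2 \<le> \<sigma>0" "\<sigma>0 \<le> 1"
    and s: "s \<in> ball s0 (1/2)" and L: "norm (l - 1) \<le> 1/4"
  shows "norm ((s - 1) / (s0 - 1) * l - 1) < 1/2"
proof -
  have n0: "norm (s0 - 1) \<ge> 7/2" using complex_Re_le_cmod[of "s0 - 1"] s0 \<sigma>0 by simp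
  then have s01: "s0 - 1 \<noteq> 0" by auto
  define u where "u = (s - s0) / (s0 - 1)"
  have "norm u \<le> (1/2) / (7/2)" unfolding u_def norm_divide
    using n0 s by (intro frac_le) (auto simp: dist_norm norm_minus_commute)
  then have u: "norm u \<le> 1/7" by simp
  have e: "(s - 1) / (s0 - 1) = 1 + u" using s01 by (simp add: u_def field_simps)
  have "(s - 1) / (s0 - 1) * l - 1 = u + (l - 1) + u * (l - 1)" unfolding e by (simp add: algebra_simps)
  also have "norm \<dots> \<le> norm u + norm (l - 1) + norm u * norm (l - 1)"
    by (metis norm_triangle_mono norm_triangle_ineq norm_mult order_refl)
  also have "\<dots> \<le> 1/7 + 1/4 + 1/7 * (1/4)"
    using u L by (intro add_mono mult_mono) auto
  also have "\<dots> < 1/2" by simp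
  finally show ?thesis .
qed

text \<open>\<open>inverse_bound_of_zero_free\<close> on the disc of radius 4 about \<sigma>0 + 4 +
  i Im s. This disc touches the line Re z = \<sigma>0, stays within height 4 of \<open>s\<close>,
  and has its centre where L is close to 1; shrinking the radius by \<delta> still keeps
  \<open>s\<close> inside.\<close>

lemma inverse_L_bound:
  fixes \<delta> \<eta> :: real
  assumes \<delta>: "0 < \<delta>" "\<delta> \<le> 1" and \<eta>: "\<eta> > 0"
  obtains C where "C > 0"
    "\<And>q \<psi> \<sigma>0 s. q \<ge> 1 \<Longrightarrow> dirichlet_char q \<psi> \<Longrightarrow> 1/2 \<le> \<sigma>0 \<Longrightarrow> \<sigma>0 \<le> 1 \<Longrightarrow>
       (\<And>z. z \<in> L_dom q \<psi> \<Longrightarrow> \<sigma>0 < Re z \<Longrightarrow> \<bar>Im z - Im s\<bar> < 4 \<Longrightarrow> L_fun q \<psi> z \<noteq> 0) \<Longrightarrow>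
       \<sigma>0 + \<delta> \<le> Re s \<Longrightarrow> Re s \<le> 2 \<Longrightarrow> norm (1 / L_fun q \<psi> s) \<le> C * (real q * (\<bar>Im s\<bar> + 2)) powr \<eta>"
proof -
  define Z where "Z = (\<Sum>n. real (Suc n) powr (-3/2))"
  have Z: "Z \<ge> 0" unfolding Z_def using summable_Suc_powr[of "1/2"] by (intro suminf_nonneg) auto
  \<comment> \<open>The summand 3 ensures exp M \<ge> 3 \<ge> e, hence M \<ge> 1; the coefficient
    300 exceeds 250 + 25, which arises for principal characters.\<close>
  define Cc where "Cc = 3 + 300 * Z"
  \<comment> \<open>The division by 3 offsets the cube in \<open>exp M = Cc * X ^ 3\<close>.\<close>
  define \<eta>' where "\<eta>' = \<eta> / 3"
  have "\<eta>' > 0" using \<eta> by (simp add: \<eta>'_def)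
  obtain C0 where C0: "C0 > 0" "\<And>f s0 M z. 1 \<le> M \<Longrightarrow> f holomorphic_on ball s0 4 \<Longrightarrow>
       (\<And>z. z \<in> ball s0 4 \<Longrightarrow> f z \<noteq> 0 \<and> norm (f z) \<le> exp M) \<Longrightarrow>
       (\<And>z. z \<in> ball s0 (1/2) \<Longrightarrow> norm (f z - 1) < 1/2) \<Longrightarrow>
       z \<in> cball s0 (4 - \<delta>) \<Longrightarrow> norm (1 / f z) \<le> C0 * exp (\<eta>' * M)"
    using inverse_bound_of_zero_free[of "1/2" 4 "4 - \<delta>" \<eta>'] \<delta> \<open>\<eta>' > 0\<close> by auto
  have main: "norm (1 / L_fun q \<psi> s) \<le> C0 * Cc powr \<eta>' * (real q * (\<bar>Im s\<bar> + 2)) powr \<eta>"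
    if q: "q \<ge> 1" and d: "dirichlet_char q \<psi>" and \<sigma>0: "1/2 \<le> \<sigma>0" "\<sigma>0 \<le> 1"
      and nz: "\<And>z. z \<in> L_dom q \<psi> \<Longrightarrow> \<sigma>0 < Re z \<Longrightarrow> \<bar>Im z - Im s\<bar> < 4 \<Longrightarrow> L_fun q \<psi> z \<noteq> 0"
      and s: "\<sigma>0 + \<delta> \<le> Re s" "Re s \<le> 2" for q \<psi> \<sigma>0 s
  proof -
    define t where "t = Im s"
    define X where "X = real q * (\<bar>t\<bar> + 2)"
    have q1: "real q \<ge> 1" using q by simp
    have Xt: "X \<ge> \<bar>t\<bar> + 2" using mult_right_mono[OF q1, of "\<bar>t\<bar> + 2"] by (simp add: X_def)
    have X: "X \<ge> 2" using Xt by simp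
    define M where "M = ln (Cc * X ^ 3)"
    have X3: "X ^ 3 \<ge> 1" using X by (intro one_le_power) simp
    have CX: "Cc * X ^ 3 \<ge> 3" using mult_mono[of 3 Cc 1 "X^3"] Z X3 by (simp add: Cc_def)
    have eM: "exp M = Cc * X ^ 3" unfolding M_def using CX by simp
    have M1: "M \<ge> 1"
    proof -
      have "exp (1::real) \<le> 3" using exp_le by simp
      then show ?thesis using CX eM by (metis exp_le_cancel_iff order_trans)
    qed
    have Cc0: "Cc > 0" using Z by (simp add: Cc_def)
    have "exp (\<eta>' * M) = (Cc * X ^ 3) powr \<eta>'" using Cc0 X by (simp add: M_def powr_def)
    also have "\<dots> = Cc powr \<eta>' * X powr \<eta>"
    proof -
      have "X ^ 3 = X powr 3" using X by (simp add: powr_numeral)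
      then have "(X ^ 3) powr \<eta>' = X powr \<eta>" by (simp add: powr_powr \<eta>'_def)
      then show ?thesis using X Cc0 by (simp add: powr_mult)
    qed
    finally have eX: "exp (\<eta>' * M) = Cc powr \<eta>' * X powr \<eta>" .
    define s0 where "s0 = Complex (\<sigma>0 + 4) t"
    have ball: "Re z > \<sigma>0 \<and> \<bar>Im z - t\<bar> < 4 \<and> norm z + 1 \<le> 5 * (\<bar>t\<bar> + 2)" if z: "z \<in> ball s0 4" for z
    proof -
      have n: "norm (z - s0) < 4" using z by (simp add: dist_norm norm_minus_commute)
      have "\<bar>Re (z - s0)\<bar> < 4" "\<bar>Im (z - s0)\<bar> < 4" using n abs_Re_le_cmod abs_Im_le_cmod order_le_less_trans by blast+
      moreover have "norm z \<le> norm s0 + norm (z - s0)" by (rule norm_triangle_sub)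
      moreover have "norm s0 \<le> \<bar>\<sigma>0 + 4\<bar> + \<bar>t\<bar>" using cmod_le[of s0] by (simp add: s0_def)
      ultimately show ?thesis using n \<sigma>0 by (simp add: s0_def abs_less_iff)
    qed
    have pos: "Re z > 0" if "z \<in> ball s0 4" for z using ball[OF that] \<sigma>0 by linarith
    have half: "1/2 \<le> Re z" if "z \<in> ball s0 4" for z using ball[OF that] \<sigma>0 by linarith
    have nzL: "L_fun q \<psi> z \<noteq> 0" if "z \<in> ball s0 4" "z \<in> L_dom q \<psi>" for z
      using nz[OF that(2)] ball[OF that(1)] by (simp add: t_def)
    have sub: "ball s0 4 \<subseteq> {z. Re z > 0}" using pos by blast
    have Lr: "norm (L_reg q \<psi> z) \<le> 50 * Z * (real q * (\<bar>t\<bar> + 2)\<^sup>2)" if z: "z \<in> ball s0 4" for z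
    proof -
      have "(norm z + 1)\<^sup>2 \<le> (5 * (\<bar>t\<bar> + 2))\<^sup>2" using ball[OF z] by (intro power_mono) auto
      then have le: "2 * real q * (norm z + 1)\<^sup>2 * Z \<le> 2 * real q * (5 * (\<bar>t\<bar> + 2))\<^sup>2 * Z"
        using Z by (intro mult_right_mono mult_left_mono) auto
      have "norm (L_reg q \<psi> z) \<le> 2 * real q * (norm z + 1)\<^sup>2 * Z"
        unfolding Z_def by (rule L_reg_series(2)[OF d q half[OF z]])
      also note le
      also have "2 * real q * (5 * (\<bar>t\<bar> + 2))\<^sup>2 * Z = 50 * Z * (real q * (\<bar>t\<bar> + 2)\<^sup>2)"
        by (simp add: power2_eq_square algebra_simps)
      finally show ?thesis .
    qed
    have zr: "norm (zeta_reg z) \<le> 1 + 25 * Z * (\<bar>t\<bar> + 2)\<^sup>2" if z: "z \<in> ball s0 4" for z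
    proof -
      have "(norm z + 1)\<^sup>2 \<le> (5 * (\<bar>t\<bar> + 2))\<^sup>2" using ball[OF z] by (intro power_mono) auto
      then have le: "(norm z + 1)\<^sup>2 * Z \<le> (5 * (\<bar>t\<bar> + 2))\<^sup>2 * Z" using Z by (intro mult_right_mono) auto
      have "norm (zeta_reg z) \<le> 1 + norm (\<Sum>n. zterm n z)"
        unfolding zeta_reg_def using norm_triangle_ineq[of 1 "\<Sum>n. zterm n z"] by simp
      also have "norm (\<Sum>n. zterm n z) \<le> 1 * (norm z + 1)\<^sup>2 * Z"
        unfolding Z_def by (rule series_half_plane(3)[OF zterm_holomorphic zterm_bound2 _ half[OF z]]) simp_all
      also have "1 * (norm z + 1)\<^sup>2 * Z \<le> (5 * (\<bar>t\<bar> + 2))\<^sup>2 * Z" using le by simp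
      also have "(5 * (\<bar>t\<bar> + 2))\<^sup>2 * Z = 25 * Z * (\<bar>t\<bar> + 2)\<^sup>2"
        by (simp add: power2_eq_square algebra_simps)
      finally show ?thesis by simp
    qed
    have near: "norm (L_fun q \<psi> z - 1) \<le> 1/4" if z: "z \<in> ball s0 (1/2)" for z
    proof -
      have "norm (z - s0) < 1/2" using z by (simp add: dist_norm norm_minus_commute)
      then have "\<bar>Re (z - s0)\<bar> < 1/2" using abs_Re_le_cmod order_le_less_trans by blast
      then have "\<bar>Re z - (\<sigma>0 + 4)\<bar> < 1/2" by (simp add: s0_def)
      then have "Re z \<ge> 3" using \<sigma>0 by linarith
      then show ?thesis by (rule L_near_1[OF d q])
    qed
    have scb: "s \<in> cball s0 (4 - \<delta>)"
    proof -
      have "s0 - s = of_real (\<sigma>0 + 4 - Re s)" by (simp add: s0_def t_def complex_eq_iff)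
      then have "norm (s0 - s) = \<bar>\<sigma>0 + 4 - Re s\<bar>" by (simp only: norm_of_real)
      then show ?thesis using s \<sigma>0 by (simp add: dist_norm)
    qed
    have qX: "real q * (\<bar>t\<bar> + 2)\<^sup>2 \<le> X ^ 2"
    proof -
      have "real q * 1 \<le> real q * real q" using q1 by (intro mult_left_mono) auto
      from mult_right_mono[OF this, of "(\<bar>t\<bar> + 2)\<^sup>2"]
      show ?thesis by (simp add: X_def power_mult_distrib power2_eq_square mult_ac)
    qed
    have X23: "X ^ 2 \<le> X ^ 3" using X by (intro power_increasing) auto
    show ?thesis
    proof (cases "principal_char q \<psi>")
      case False
      have Leq: "L_fun q \<psi> z = L_reg q \<psi> z" if "z \<in> ball s0 4" for z
        using L_fun_nonprincipal[OF d q False pos[OF that]] .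
      have "norm (1 / L_fun q \<psi> s) \<le> C0 * exp (\<eta>' * M)"
      proof (rule C0(2)[OF M1 _ _ _ scb])
        show "L_fun q \<psi> holomorphic_on ball s0 4"
          using holomorphic_on_subset[OF L_reg_series(1)[OF d q] sub] by (rule holomorphic_transform) (simp add: Leq)
        fix z assume z: "z \<in> ball s0 4"
        have "norm (L_fun q \<psi> z) \<le> 50 * Z * X ^ 3"
          unfolding Leq[OF z] using Lr[OF z] mult_left_mono[of "real q * (\<bar>t\<bar> + 2)\<^sup>2" "X ^ 3" "50 * Z"] qX X23 Z by linarith
        also have "\<dots> \<le> exp M" unfolding eM Cc_def using Z X by (intro mult_right_mono) auto
        finally show "L_fun q \<psi> z \<noteq> 0 \<and> norm (L_fun q \<psi> z) \<le> exp M"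
          using nzL[OF z] pos[OF z] False by (auto simp: L_dom_def)
      next
        show "norm (L_fun q \<psi> z - 1) < 1/2" if "z \<in> ball s0 (1/2)" for z
          using near[OF that] by simp
      qed
      then show ?thesis by (simp add: eX X_def t_def mult.assoc)
    next
      case True
      have n0: "norm (s0 - 1) \<ge> 7/2" using complex_Re_le_cmod[of "s0 - 1"] \<sigma>0 by (simp add: s0_def)
      then have s01: "s0 - 1 \<noteq> 0" by auto
      \<comment> \<open>(z - 1) L(z), divided by s0 - 1 so that it is close to 1 near the centre.
        Written through \<open>L_reg\<close> and \<open>zeta_reg\<close> it has its correct value at
        z = 1 as well.\<close>
      define F where "F = (\<lambda>z. ((z - 1) * L_reg q \<psi> z + char_mean q \<psi> * zeta_reg z) / (s0 - 1))"
      have Fe: "F z = (z - 1) / (s0 - 1) * L_fun q \<psi> z" if "Re z > 0" "z \<noteq> 1" for z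
        using L_fun_principal[OF d q True that] by (simp add: F_def)
      have "norm (1 / F s) \<le> C0 * exp (\<eta>' * M)"
      proof (rule C0(2)[OF M1 _ _ _ scb])
        show "F holomorphic_on ball s0 4" unfolding F_def using s01
          by (intro holomorphic_intros holomorphic_on_subset[OF L_reg_series(1)[OF d q] sub] holomorphic_on_subset[OF zeta_reg_holomorphic sub]) auto
        fix z assume z: "z \<in> ball s0 4"
        have "F z \<noteq> 0"
        proof (cases "z = 1")
          case True' : True
          then show ?thesis using char_mean_eq(2)[OF d q True] s01 by (simp add: F_def)
        next
          case False
          then have "L_fun q \<psi> z \<noteq> 0" using nzL[OF z] pos[OF z] by (auto simp: L_dom_def)
          then show ?thesis using Fe[OF pos[OF z] False] False s01 by simp
        qed
        moreover have "norm (F z) \<le> exp M"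
        proof -
          have "norm (F z) \<le> norm ((z - 1) * L_reg q \<psi> z + char_mean q \<psi> * zeta_reg z) / 1"
            unfolding F_def norm_divide using n0 by (intro divide_left_mono) auto
          also have "\<dots> \<le> norm (z - 1) * norm (L_reg q \<psi> z) + norm (char_mean q \<psi>) * norm (zeta_reg z)"
            by (simp add: norm_triangle_mono norm_mult)
          also have "\<dots> \<le> (5 * (\<bar>t\<bar> + 2)) * (50 * Z * (real q * (\<bar>t\<bar> + 2)\<^sup>2)) + 1 * (1 + 25 * Z * (\<bar>t\<bar> + 2)\<^sup>2)"
          proof (intro add_mono mult_mono Lr z zr norm_char_mean[OF d q])
            show "norm (z - 1) \<le> 5 * (\<bar>t\<bar> + 2)" using norm_triangle_ineq4[of z 1] ball[OF z] by simp
          qed auto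
          also have "\<dots> = 250 * Z * ((\<bar>t\<bar> + 2) * (real q * (\<bar>t\<bar> + 2)\<^sup>2)) + 1 + 25 * Z * (\<bar>t\<bar> + 2)\<^sup>2" by simp
          also have "\<dots> \<le> 250 * Z * X ^ 3 + X ^ 3 + 25 * Z * X ^ 3"
          proof (intro add_mono mult_left_mono X3)
            have "(\<bar>t\<bar> + 2) * (real q * (\<bar>t\<bar> + 2)\<^sup>2) \<le> X * X ^ 2" using Xt qX X by (intro mult_mono) auto
            then show "(\<bar>t\<bar> + 2) * (real q * (\<bar>t\<bar> + 2)\<^sup>2) \<le> X ^ 3" by (simp add: power3_eq_cube power2_eq_square mult.assoc)
            have "(\<bar>t\<bar> + 2)\<^sup>2 \<le> X ^ 2" using Xt by (intro power_mono) auto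
            then show "(\<bar>t\<bar> + 2)\<^sup>2 \<le> X ^ 3" using X23 by linarith
          qed (use Z in auto)
          also have "\<dots> \<le> exp M" 
          proof -
            have "0 \<le> Z * X ^ 3" using Z X3 by (intro mult_nonneg_nonneg) linarith+
            then show ?thesis unfolding eM Cc_def using X3 by (simp add: algebra_simps)
          qed
          finally show ?thesis .
        qed
        ultimately show "F z \<noteq> 0 \<and> norm (F z) \<le> exp M" by blast
      next
        fix z assume z: "z \<in> ball s0 (1/2)"
        have z4: "z \<in> ball s0 4" using z by auto
        have "z \<noteq> 1"
        proof
          assume "z = 1"
          then have "norm (s0 - 1) < 1/2" using z by (simp add: dist_norm)
          then show False using n0 by simp
        qed
        then show "norm (F z - 1) < 1/2"
          using Fe[OF pos[OF z4]] norm_shifted_ratio[OF s0_def \<sigma>0 z near[OF z]] by simp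
      qed
      then have *: "norm (1 / F s) \<le> C0 * exp (\<eta>' * M)" .
      \<comment> \<open>Returning from \<open>F\<close> to \<open>L_fun\<close> loses nothing
        because |s - 1| \<le> |s0 - 1|; at s = 1 the default value makes the left side 0.\<close>
      have "norm (1 / L_fun q \<psi> s) \<le> norm (1 / F s)"
      proof (cases "s = 1")
        case True' : True
        have "L_fun q \<psi> 1 = 0" using True by (simp add: L_fun_eq_L_ext[OF d q] L_ext_def L_dom_def)
        then show ?thesis using True' by simp
      next
        case False
        have "Re s > 0" using s \<delta> \<sigma>0 by simp
        then have F: "F s = (s - 1) / (s0 - 1) * L_fun q \<psi> s" using Fe False by blast
        have "norm (s - 1) \<le> norm (s0 - 1)"
        proof -
          have "(Re s - 1)\<^sup>2 \<le> (\<sigma>0 + 3)\<^sup>2"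
            using s \<sigma>0 \<delta> by (intro abs_le_square_iff[THEN iffD1]) linarith
          then show ?thesis by (simp add: cmod_def s0_def t_def add.commute)
        qed
        then have "norm (F s) \<le> 1 * norm (L_fun q \<psi> s)"
          unfolding F norm_mult norm_divide using n0 by (intro mult_right_mono) (auto simp: divide_le_eq_1)
        moreover have "F s \<noteq> 0"
        proof -
          have "s \<in> ball s0 4" using scb \<delta> by auto
          then have "L_fun q \<psi> s \<noteq> 0" using nzL \<open>Re s > 0\<close> False by (auto simp: L_dom_def)
          then show ?thesis using F False s01 by simp
        qed
        ultimately show ?thesis by (simp add: norm_divide frac_le)
      qed
      then show ?thesis using * by (simp add: eX X_def t_def mult.assoc)
    qed
  qed
  show ?thesis
    by (rule that[of "C0 * Cc powr \<eta>'"]) (use C0(1) Z main in \<open>auto simp: Cc_def\<close>)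
qed

section \<open>The Cahen--Mellin integral\<close>

text \<open>This is \<open>s \<Gamma>(s - k) w^(k - s)\<close>: the line of integration moves left by \<open>k\<close>, picking up
  the poles of \<open>\<Gamma>\<close> one by one.\<close>
definition shifted_kernel :: "complex \<Rightarrow> nat \<Rightarrow> complex \<Rightarrow> complex" where
  "shifted_kernel w k s = Gamma (s + 1) * exp ((of_nat k - s) * Ln w) / (\<Prod>j\<in>{1..k}. s - of_nat j)"

lemma not_nonpos_Int_of_Re_pos: "Re s > 0 \<Longrightarrow> s \<notin> \<int>\<^sub>\<le>\<^sub>0"
  by (auto elim!: nonpos_Ints_cases)

lemma exp_of_nat_Ln: "w \<noteq> 0 \<Longrightarrow> exp (of_nat k * Ln w) = w ^ k"
  by (simp add: exp_of_nat_mult)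

lemma shifted_kernel_shift:
  assumes "Re s > 0"
  shows "shifted_kernel w k (s - 1) / (s - 1) = shifted_kernel w (Suc k) s / s"
proof -
  have s0: "s \<noteq> 0" using assms by auto
  have G: "Gamma (s + 1) = s * Gamma s" using Gamma_plus1 not_nonpos_Int_of_Re_pos[OF assms] by blast
  have pr: "(\<Prod>j\<in>{1..Suc k}. s - of_nat j) = (s - 1) * (\<Prod>j\<in>{1..k}. s - 1 - of_nat j)"
  proof (induction k)
    case (Suc k)
    have "(\<Prod>j\<in>{1..Suc (Suc k)}. s - of_nat j) = (\<Prod>j\<in>{1..Suc k}. s - of_nat j) * (s - of_nat (Suc (Suc k)))"
      by (rule prod.nat_ivl_Suc'[THEN trans]) (simp_all add: mult.commute)
    also have "\<dots> = (s - 1) * ((\<Prod>j\<in>{1..k}. s - 1 - of_nat j) * (s - 1 - of_nat (Suc k)))"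
      unfolding Suc by (simp add: algebra_simps)
    also have "(\<Prod>j\<in>{1..k}. s - 1 - of_nat j) * (s - 1 - of_nat (Suc k)) = (\<Prod>j\<in>{1..Suc k}. s - 1 - of_nat j)"
      by simp
    finally show ?case .
  qed simp
  have e: "exp ((of_nat k - (s - 1)) * Ln w) = exp ((of_nat (Suc k) - s) * Ln w)"
    by (simp add: algebra_simps)
  show ?thesis using s0 unfolding shifted_kernel_def pr e G by simp
qed

lemma shifted_kernel_0:
  assumes "w \<noteq> 0"
  shows "shifted_kernel w k 0 = (- w) ^ k / fact k"
proof -
  have "(\<Prod>j\<in>{1..k}. 0 - complex_of_nat j) = (-1) ^ k * fact k"
    by (induction k) (simp_all add: algebra_simps)
  then show ?thesis
    using exp_of_nat_Ln[OF assms, of k] by (simp add: shifted_kernel_def power_minus[of w] field_simps)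
qed

lemma shifted_kernel_holomorphic: "shifted_kernel w k holomorphic_on {s. -1 < Re s \<and> Re s < 1}"
  unfolding shifted_kernel_def
proof (intro holomorphic_intros)
  show "\<And>z. z \<in> {s. -1 < Re s \<and> Re s < 1} \<Longrightarrow> z + 1 \<notin> \<int>\<^sub>\<le>\<^sub>0"
    by (rule not_nonpos_Int_of_Re_pos) auto
  fix z :: complex assume "z \<in> {s. -1 < Re s \<and> Re s < 1}"
  then have "z - of_nat j \<noteq> 0" if "j \<in> {1..k}" for j
    using that by (auto simp: complex_eq_iff)
  then show "(\<Prod>j\<in>{1..k}. z - of_nat j) \<noteq> 0" by (simp add: prod_zero_iff)
qed

definition line_integral :: "complex \<Rightarrow> real \<Rightarrow> nat \<Rightarrow> complex" where
  "line_integral w K k = contour_integral (linepath (Complex (1/2) (-K)) (Complex (1/2) K)) (\<lambda>s. shifted_kernel w k s / s)"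

lemma contour_integral_linepath_shift:
  "contour_integral (linepath (a - c) (b - c)) f = contour_integral (linepath a b) (\<lambda>s. f (s - c))"
  unfolding contour_integral_integral
proof -
  have "linepath (a - c) (b - c) x = linepath a b x - c" for x
    by (simp add: linepath_def algebra_simps)
  then show "integral {0..1} (\<lambda>t. f (linepath (a - c) (b - c) t) * vector_derivative (linepath (a - c) (b - c)) (at t)) =
     integral {0..1} (\<lambda>t. f (linepath a b t - c) * vector_derivative (linepath a b) (at t))"
    by simp
qed

text \<open>The rectangle between the real parts -1/2 and 1/2 encloses only the pole at 0. Its left
  side, translated by 1, is the line Re s = 1/2 again with \<open>Suc k\<close> for
  \<open>k\<close>, so the kernel moves instead of the line. The horizontal sides have length 1 and
  contribute at most \<open>B\<close> each.\<close>

lemma line_integral_step: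
  assumes K: "K > 0" and w: "w \<noteq> 0" and B: "\<And>s. \<bar>Im s\<bar> = K \<Longrightarrow> \<bar>Re s\<bar> \<le> 1/2 \<Longrightarrow> norm (shifted_kernel w k s / s) \<le> B"
  shows "norm (line_integral w K k - line_integral w K (Suc k) - 2 * pi * \<i> * ((- w) ^ k / fact k)) \<le> 2 * B"
proof -
  define g where "g = (\<lambda>s. shifted_kernel w k s / s)"
  define a1 where "a1 = Complex (-1/2) (-K)"
  define a2 where "a2 = Complex (1/2) (-K)"
  define a3 where "a3 = Complex (1/2) K"
  define a4 where "a4 = Complex (-1/2) K"
  define S where "S = {s. -1 < Re s \<and> Re s < (1::real)}"
  have S: "convex S" "open S"
  proof -
    have "S = {s. Re s > -1} \<inter> {s. Re s < 1}" by (auto simp: S_def)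
    then show "convex S" "open S"
      by (simp_all add: convex_Int convex_halfspace_Re_gt convex_halfspace_Re_lt open_Int open_halfspace_Re_gt open_halfspace_Re_lt)
  qed
  have rp: "rectpath a1 a3 = linepath a1 a2 +++ linepath a2 a3 +++ linepath a3 a4 +++ linepath a4 a1"
    by (simp add: rectpath_def a1_def a2_def a3_def a4_def Let_def)
  have inS: "a1 \<in> S" "a2 \<in> S" "a3 \<in> S" "a4 \<in> S" by (simp_all add: S_def a1_def a2_def a3_def a4_def)
  have hol: "g holomorphic_on S - {0}" unfolding g_def
    using holomorphic_on_subset[OF shifted_kernel_holomorphic, of "S - {0}"]
    by (intro holomorphic_intros) (auto simp: S_def)
  have seg: "closed_segment x y \<subseteq> S - {0}"
    if "x \<in> S" "y \<in> S" "0 \<notin> closed_segment x y" for x y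
    using closed_segment_subset[OF that(1,2) S(1)] that(3) by blast
  have same_Im: "Im s = Im x \<and> Re s \<in> closed_segment (Re x) (Re y)" if "s \<in> closed_segment x y" "Im x = Im y" for s x y
    using that by (auto simp: closed_segment_same_Im)
  have same_Re: "Re s = Re x" if "s \<in> closed_segment x y" "Re x = Re y" for s x y
    using that by (auto simp: closed_segment_same_Re)
  have n0: "0 \<notin> closed_segment a1 a2" "0 \<notin> closed_segment a2 a3" "0 \<notin> closed_segment a3 a4" "0 \<notin> closed_segment a4 a1"
    using same_Im[of 0 a1 a2] same_Im[of 0 a3 a4] same_Re[of 0 a2 a3] same_Re[of 0 a4 a1] K
    by (auto simp: a1_def a2_def a3_def a4_def)
  note segs = seg[OF inS(1,2) n0(1)] seg[OF inS(2,3) n0(2)] seg[OF inS(3,4) n0(3)] seg[OF inS(4,1) n0(4)]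
  have ci: "g contour_integrable_on linepath x y" if "closed_segment x y \<subseteq> S - {0}" for x y
    using holomorphic_on_imp_continuous_on[OF hol] that
    by (intro contour_integrable_continuous_linepath) (rule continuous_on_subset)
  have "((\<lambda>s. shifted_kernel w k s / (s - 0)) has_contour_integral (2 * pi * \<i> * winding_number (rectpath a1 a3) 0 * shifted_kernel w k 0)) (rectpath a1 a3)"
  proof (rule Cauchy_integral_formula_convex_simple[OF S(1)])
    show "shifted_kernel w k holomorphic_on S" unfolding S_def by (rule shifted_kernel_holomorphic)
    show "0 \<in> interior S" using S(2) by (simp add: interior_open S_def)
    show "path_image (rectpath a1 a3) \<subseteq> S - {0}"
      unfolding rp using segs by (auto simp: path_image_join)
  qed auto
  moreover have "winding_number (rectpath a1 a3) 0 = 1"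
    by (rule winding_number_rectpath) (use K in \<open>auto simp: a1_def a3_def box_def Basis_complex_def\<close>)
  ultimately have "(g has_contour_integral (2 * pi * \<i> * ((- w) ^ k / fact k))) (rectpath a1 a3)"
    by (simp add: shifted_kernel_0[OF w] g_def)
  then have "contour_integral (rectpath a1 a3) g = 2 * pi * \<i> * ((- w) ^ k / fact k)"
    by (rule contour_integral_unique)
  moreover have "contour_integral (rectpath a1 a3) g = contour_integral (linepath a1 a2) g + (contour_integral (linepath a2 a3) g
      + (contour_integral (linepath a3 a4) g + contour_integral (linepath a4 a1) g))"
    unfolding rp using segs ci by (subst contour_integral_join; (intro contour_integrable_joinI)?; simp)+
  moreover have "contour_integral (linepath a4 a1) g = - contour_integral (linepath a1 a4) g"
    using contour_integral_reverse_linepath[of a1 a4 g] ci[of a1 a4] segs(4)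
      holomorphic_on_imp_continuous_on[OF hol] by (simp add: closed_segment_commute continuous_on_subset)
  moreover have "contour_integral (linepath a1 a4) g = line_integral w K (Suc k)"
  proof -
    have e: "a1 = Complex (1/2) (-K) - 1" "a4 = Complex (1/2) K - 1" by (simp_all add: a1_def a4_def complex_eq_iff)
    have "contour_integral (linepath a1 a4) g = contour_integral (linepath (Complex (1/2) (-K)) (Complex (1/2) K)) (\<lambda>s. g (s - 1))"
      unfolding e by (rule contour_integral_linepath_shift)
    also have "\<dots> = line_integral w K (Suc k)"
      unfolding line_integral_def
    proof (rule contour_integral_cong[OF refl])
      fix s assume "s \<in> path_image (linepath (Complex (1/2) (-K)) (Complex (1/2) K))"
      then have "Re s = 1/2" using same_Re[of s "Complex (1/2) (-K)" "Complex (1/2) K"] by simp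
      then show "g (s - 1) = shifted_kernel w (Suc k) s / s" unfolding g_def by (intro shifted_kernel_shift) simp
    qed
    finally show ?thesis .
  qed
  moreover have "contour_integral (linepath a2 a3) g = line_integral w K k"
    by (simp add: line_integral_def a2_def a3_def g_def)
  ultimately have e: "line_integral w K k - line_integral w K (Suc k) - 2 * pi * \<i> * ((- w) ^ k / fact k)
     = - (contour_integral (linepath a1 a2) g + contour_integral (linepath a3 a4) g)"
    by (simp add: algebra_simps)
  have "norm (shifted_kernel w k (Complex 0 K) / Complex 0 K) \<le> B" using K by (intro B) auto
  then have B0: "0 \<le> B" by (rule order_trans[OF norm_ge_zero])
  have b1: "norm (contour_integral (linepath a1 a2) g) \<le> B * norm (a2 - a1)"
  proof (rule contour_integral_bound_linepath[OF ci[OF segs(1)] B0])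
    fix s assume "s \<in> closed_segment a1 a2"
    then have "Im s = -K" "\<bar>Re s\<bar> \<le> 1/2"
      using same_Im[of s a1 a2] by (auto simp: a1_def a2_def closed_segment_eq_real_ivl)
    then show "norm (g s) \<le> B" unfolding g_def using K by (intro B) auto
  qed
  have b2: "norm (contour_integral (linepath a3 a4) g) \<le> B * norm (a4 - a3)"
  proof (rule contour_integral_bound_linepath[OF ci[OF segs(3)] B0])
    fix s assume "s \<in> closed_segment a3 a4"
    then have "Im s = K" "\<bar>Re s\<bar> \<le> 1/2"
      using same_Im[of s a3 a4] by (auto simp: a3_def a4_def closed_segment_eq_real_ivl)
    then show "norm (g s) \<le> B" unfolding g_def using K by (intro B) auto
  qed
  have n: "a2 - a1 = 1" "a4 - a3 = -1" by (simp_all add: a1_def a2_def a3_def a4_def complex_eq_iff)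
  have "norm (- (contour_integral (linepath a1 a2) g + contour_integral (linepath a3 a4) g)) \<le> B + B"
    unfolding norm_minus_cancel using b1 b2 by (intro norm_triangle_mono) (simp_all add: n)
  then show ?thesis unfolding e by simp
qed

text \<open>Each of the k + 1 factors |s - j| is at least K \<ge> 2|w| and so absorbs a factor |w|
  with a gain of 1/2. The horizontal errors therefore form a geometric series in
  \<open>k\<close>.\<close>

lemma shifted_kernel_top_bound:
  assumes w: "Re w > 0" and K: "K \<ge> 2 * norm w" and s: "\<bar>Im s\<bar> = K" "\<bar>Re s\<bar> \<le> 1/2"
    and E: "\<And>s. \<bar>Im s\<bar> = K \<Longrightarrow> 1/2 \<le> Re s \<Longrightarrow> Re s \<le> 3/2 \<Longrightarrow> norm (Gamma s * exp (- s * Ln w)) \<le> E"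
  shows "norm (shifted_kernel w k s / s) \<le> E * (1/2) ^ Suc k"
proof -
  have w0: "w \<noteq> 0" using w by auto
  have K0: "K > 0" using K w0 by (smt (verit) zero_less_norm_iff)
  have ge: "norm (s - of_nat j) \<ge> K" for j using abs_Im_le_cmod[of "s - of_nat j"] s by simp
  have "\<bar>Re s\<bar> \<le> 1/2 \<Longrightarrow> 1/2 \<le> Re (s + 1) \<and> Re (s + 1) \<le> 3/2" by (auto simp: abs_le_iff)
  then have E1: "norm (Gamma (s + 1) * exp (- (s + 1) * Ln w)) \<le> E" using E[of "s + 1"] s by simp
  then have E0: "E \<ge> 0" using norm_ge_zero order_trans by blast
  have p: "K ^ k \<le> norm (\<Prod>j\<in>{1..k}. s - of_nat j)"
  proof -
    have "(\<Prod>j\<in>{1..k}. K) \<le> (\<Prod>j\<in>{1..k}. norm (s - of_nat j))" using ge K0 by (intro prod_mono) auto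
    then show ?thesis by (simp add: prod_norm)
  qed
  have "exp ((of_nat k - s) * Ln w) = exp (- (s + 1) * Ln w) * exp (of_nat (Suc k) * Ln w)"
    by (simp add: exp_add[symmetric] algebra_simps)
  also have "exp (of_nat (Suc k) * Ln w) = w ^ Suc k" by (rule exp_of_nat_Ln[OF w0])
  finally have e: "exp ((of_nat k - s) * Ln w) = exp (- (s + 1) * Ln w) * w ^ Suc k" .
  have "norm (shifted_kernel w k s / s) = norm (Gamma (s + 1) * exp (- (s + 1) * Ln w)) * norm w ^ Suc k / (norm (\<Prod>j\<in>{1..k}. s - of_nat j) * norm s)"
    unfolding shifted_kernel_def e by (simp add: norm_mult norm_divide norm_power mult_ac)
  also have "\<dots> \<le> E * norm w ^ Suc k / (K ^ k * K)"
    using E1 E0 p ge[of 0] K0 by (intro frac_le mult_mono mult_right_mono mult_pos_pos) auto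
  also have "\<dots> = E * (norm w / K) ^ Suc k" by (simp add: power_divide)
  also have "\<dots> \<le> E * (1/2) ^ Suc k"
    using E0 K K0 by (intro mult_left_mono power_mono) (auto simp: divide_le_eq)
  finally show ?thesis .
qed

text \<open>On Re s = 1/2 one has |s - j| \<ge> j/2, so the denominator is at least N!/2^N, against
  a numerator of order |w|^N.\<close>

lemma line_integral_tendsto_0:
  assumes w: "Re w > 0" and K: "K > 0"
  shows "(\<lambda>N. line_integral w K N) \<longlonglongrightarrow> 0"
proof -
  have w0: "w \<noteq> 0" using w by auto
  define A where "A = 6 * exp (9/4) * norm w powr (- 1/2)"
  have A: "A \<ge> 0" by (simp add: A_def)
  define D where "D = (\<lambda>N. A * ((2 * norm w) ^ N / fact N))"
  have sk: "norm (shifted_kernel w N s / s) \<le> D N" if s: "Re s = 1/2" for s N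
  proof -
    have s0: "s \<noteq> 0" using s by auto
    have G: "Gamma (s + 1) = s * Gamma s" using Gamma_plus1 not_nonpos_Int_of_Re_pos[of s] s by simp
    have "exp ((of_nat N - s) * Ln w) = exp (- s * Ln w) * exp (of_nat N * Ln w)"
      by (simp add: exp_add[symmetric] algebra_simps)
    then have e: "exp ((of_nat N - s) * Ln w) = exp (- s * Ln w) * w ^ N" by (simp only: exp_of_nat_Ln[OF w0])
    have "norm (Gamma s * exp (- s * Ln w)) \<le> 6 * exp (9/4) * (1 + \<bar>Im s\<bar>) powr (Re s - 1/2) * norm w powr (- Re s) * exp (- \<bar>Im s\<bar> * (Re w / norm w))"
      using s by (intro norm_Mellin_kernel w) auto
    also have "\<dots> \<le> A * 1"
    proof -
      have "exp (- \<bar>Im s\<bar> * (Re w / norm w)) \<le> 1" using w by simp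
      moreover have "1 + \<bar>Im s\<bar> \<noteq> 0" by linarith
      ultimately show ?thesis using mult_left_mono[of "exp (- \<bar>Im s\<bar> * (Re w / norm w))" 1 A] A by (simp add: A_def s)
    qed
    finally have kA: "norm (Gamma s * exp (- s * Ln w)) \<le> A" by simp
    have p: "fact N / 2 ^ N \<le> norm (\<Prod>j\<in>{1..N}. s - of_nat j)"
    proof -
      have "(\<Prod>j\<in>{1..N}. real j / 2) \<le> (\<Prod>j\<in>{1..N}. norm (s - of_nat j))"
      proof (rule prod_mono)
        fix j assume "j \<in> {1..N}"
        then show "0 \<le> real j / 2 \<and> real j / 2 \<le> norm (s - of_nat j)"
          using abs_Re_le_cmod[of "s - of_nat j"] s by auto
      qed
      moreover have "(\<Prod>j\<in>{1..N}. real j / 2) = fact N / 2 ^ N"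
        by (simp add: prod_dividef fact_prod)
      ultimately show ?thesis by (simp add: prod_norm)
    qed
    have "norm (shifted_kernel w N s / s) = norm (Gamma s * exp (- s * Ln w)) * norm w ^ N / norm (\<Prod>j\<in>{1..N}. s - of_nat j)"
      unfolding shifted_kernel_def e G using s0 by (simp add: norm_mult norm_divide norm_power)
    also have "\<dots> \<le> A * norm w ^ N / (fact N / 2 ^ N)"
      using kA A p by (intro frac_le mult_mono mult_right_mono) auto
    finally show ?thesis by (simp add: D_def power_mult_distrib mult_ac)
  qed
  have "(\<lambda>N. (2 * norm w) ^ N / fact N) \<longlonglongrightarrow> 0"
    using summable_LIMSEQ_zero[OF summable_exp[of "2 * norm w"]] by (simp add: divide_inverse mult.commute)
  then have D0: "(\<lambda>N. D N * (2 * K)) \<longlonglongrightarrow> 0" unfolding D_def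
    by (intro tendsto_mult_left_zero tendsto_mult_right_zero)
  show ?thesis
  proof (rule Lim_null_comparison[OF always_eventually[OF allI] D0])
    fix N
    have "norm (line_integral w K N) \<le> D N * norm (Complex (1/2) K - Complex (1/2) (-K))"
      unfolding line_integral_def
    proof (rule contour_integral_bound_linepath)
      have Re: "Re s = 1/2" if "s \<in> closed_segment (Complex (1/2) (-K)) (Complex (1/2) K)" for s
        using that by (auto simp: closed_segment_same_Re)
      show "(\<lambda>s. shifted_kernel w N s / s) contour_integrable_on linepath (Complex (1/2) (-K)) (Complex (1/2) K)"
      proof (rule contour_integrable_continuous_linepath, rule holomorphic_on_imp_continuous_on, rule holomorphic_on_divide)
        show "shifted_kernel w N holomorphic_on closed_segment (Complex (1/2) (-K)) (Complex (1/2) K)"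
          by (rule holomorphic_on_subset[OF shifted_kernel_holomorphic]) (use Re in force)
      qed (use Re in \<open>force intro!: holomorphic_intros\<close>)+
      show "0 \<le> D N" using A by (simp add: D_def)
      show "norm (shifted_kernel w N s / s) \<le> D N" if "s \<in> closed_segment (Complex (1/2) (-K)) (Complex (1/2) K)" for s
        using sk Re[OF that] by blast
    qed
    also have "Complex (1/2) K - Complex (1/2) (-K) = \<i> * of_real (2 * K)" by (simp add: complex_eq_iff)
    finally show "norm (line_integral w K N) \<le> D N * (2 * K)" using K by (simp add: norm_mult)
  qed
qed

text \<open>The residues picked up are the terms of the power series of exp(-w), and the errors of
  all the shifts add up to at most 2E.\<close>

lemma line_integral_exp:
  assumes w: "Re w > 0" and K: "K \<ge> 2 * norm w"
    and E: "\<And>s. \<bar>Im s\<bar> = K \<Longrightarrow> 1/2 \<le> Re s \<Longrightarrow> Re s \<le> 3/2 \<Longrightarrow> norm (Gamma s * exp (- s * Ln w)) \<le> E"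
  shows "norm (line_integral w K 0 - 2 * pi * \<i> * exp (- w)) \<le> 2 * E"
proof -
  have w0: "w \<noteq> 0" using w by auto
  have K0: "K > 0" using K w0 by (smt (verit) zero_less_norm_iff)
  have "norm (Gamma (Complex 1 K) * exp (- Complex 1 K * Ln w)) \<le> E" using K0 by (intro E) auto
  then have E0: "E \<ge> 0" by (rule order_trans[OF norm_ge_zero])
  have st: "norm (line_integral w K k - line_integral w K (Suc k) - 2 * pi * \<i> * ((- w) ^ k / fact k)) \<le> E * (1/2) ^ k" for k
    using line_integral_step[OF K0 w0 shifted_kernel_top_bound[OF w K _ _ E], of k] by simp
  have fin: "norm (line_integral w K 0 - line_integral w K N - 2 * pi * \<i> * (\<Sum>k<N. (- w) ^ k / fact k)) \<le> 2 * E" for N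
  proof -
    have "line_integral w K 0 - line_integral w K N - 2 * pi * \<i> * (\<Sum>k<N. (- w) ^ k / fact k)
        = (\<Sum>k<N. line_integral w K k - line_integral w K (Suc k) - 2 * pi * \<i> * ((- w) ^ k / fact k))"
      by (induction N) (simp_all add: algebra_simps)
    also have "norm \<dots> \<le> (\<Sum>k<N. E * (1/2) ^ k)" by (rule sum_norm_le) (rule st)
    also have "\<dots> = E * (\<Sum>k<N. (1/2) ^ k)" by (simp add: sum_distrib_left)
    also have "\<dots> \<le> E * 2" using E0 by (intro mult_left_mono) (simp_all add: geometric_sum)
    finally show ?thesis by simp
  qed
  have "(\<lambda>N. \<Sum>k<N. (- w) ^ k / fact k) \<longlonglongrightarrow> exp (- w)"
    using exp_converges[of "- w"] by (simp add: sums_def scaleR_conv_of_real divide_inverse mult.commute)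
  then have "(\<lambda>N. norm (line_integral w K 0 - line_integral w K N - 2 * pi * \<i> * (\<Sum>k<N. (- w) ^ k / fact k)))
      \<longlonglongrightarrow> norm (line_integral w K 0 - 0 - 2 * pi * \<i> * exp (- w))"
    by (intro tendsto_intros line_integral_tendsto_0 w K0)
  then show ?thesis using fin by (intro LIMSEQ_le_const2[where X = "\<lambda>N. norm (line_integral w K 0 - line_integral w K N - 2 * pi * \<i> * (\<Sum>k<N. (- w) ^ k / fact k))"]) auto
qed

text \<open>Replaces the estimate of a vertical integral by an integrable majorant: \<open>P\<close>
  is a primitive of \<open>f\<close> and \<open>\<phi>\<close> one of the majorant.\<close>

lemma vertical_primitive_bound:
  assumes P: "\<And>t. a \<le> t \<Longrightarrow> t \<le> b \<Longrightarrow> (P has_field_derivative f (Complex \<sigma> t)) (at (Complex \<sigma> t))" and ab: "a \<le> b"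
    and \<phi>: "\<And>t. a \<le> t \<Longrightarrow> t \<le> b \<Longrightarrow> (\<phi> has_real_derivative \<phi>' t) (at t)"
    and le: "\<And>t. a \<le> t \<Longrightarrow> t \<le> b \<Longrightarrow> norm (f (Complex \<sigma> t)) \<le> \<phi>' t"
  shows "norm (P (Complex \<sigma> b) - P (Complex \<sigma> a)) \<le> \<phi> b - \<phi> a"
proof (cases "a = b")
  case False
  have dC: "((\<lambda>t. Complex \<sigma> t) has_vector_derivative \<i>) (at t)" for t
    unfolding complex_eq_iff Complex_eq by (auto intro!: derivative_eq_intros)
  have dP: "((\<lambda>t. P (Complex \<sigma> t)) has_vector_derivative \<i> * f (Complex \<sigma> t)) (at t)" if "a \<le> t" "t \<le> b" for t
    using field_vector_diff_chain_at[OF dC P[OF that]] by (simp add: o_def)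
  show ?thesis
  proof (rule differentiable_bound_general)
    show "a < b" using ab False by simp
    show "continuous_on {a..b} (\<lambda>t. P (Complex \<sigma> t))"
    proof (intro continuous_at_imp_continuous_on ballI)
      fix x assume "x \<in> {a..b}"
      then show "isCont (\<lambda>t. P (Complex \<sigma> t)) x" using has_vector_derivative_continuous[OF dP[of x]] by simp
    qed
    show "continuous_on {a..b} \<phi>"
    proof (intro continuous_at_imp_continuous_on ballI)
      fix x assume "x \<in> {a..b}"
      then show "isCont \<phi> x" using DERIV_isCont[OF \<phi>[of x]] by simp
    qed
    show "((\<lambda>t. P (Complex \<sigma> t)) has_vector_derivative \<i> * f (Complex \<sigma> t)) (at t)" if "a < t" "t < b" for t using dP that by simp
    show "(\<phi> has_vector_derivative \<phi>' t) (at t)" if "a < t" "t < b" for t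
      using \<phi> that by (simp add: has_real_derivative_iff_has_vector_derivative)
    show "norm (\<i> * f (Complex \<sigma> t)) \<le> \<phi>' t" if "a < t" "t < b" for t using le that by (simp add: norm_mult)
  qed
qed simp

lemma half_plane_primitive:
  assumes "f holomorphic_on {s. Re s > 0}"
  obtains P where "\<And>s. Re s > 0 \<Longrightarrow> (P has_field_derivative f s) (at s)"
proof -
  obtain P where P: "\<And>s. s \<in> {s. Re s > 0} \<Longrightarrow> (P has_field_derivative f s) (at s)"
    using right_invariant_primitive[of "{s. Re s > 0}" "{s. Re s > 0}" 0 f] assms exI[of "\<lambda>s. Re s > 0" 1]
    by (force simp: open_halfspace_Re_gt convex_halfspace_Re_gt)
  show ?thesis by (rule that) (use P in simp)
qed

lemma kernel_holomorphic: "(\<lambda>s. Gamma s * exp (- s * Ln w)) holomorphic_on {s. Re s > 0}"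
  using not_nonpos_Int_of_Re_pos by (intro holomorphic_intros) auto

text \<open>In contrast to \<open>line_integral_exp\<close>, \<open>K\<close> need not be large
  compared with |w|. The increment from \<open>K\<close> to a large \<open>K'\<close> is bounded by
  the tail of the integral on Re s = 3/2, and then \<open>K'\<close> tends to infinity.\<close>

lemma Mellin_truncated:
  assumes w: "Re w > 0" and K: "K \<ge> 0" and T: "T = norm w / Re w"
    and P: "\<And>s. Re s > 0 \<Longrightarrow> (P has_field_derivative (Gamma s * exp (- s * Ln w))) (at s)"
  shows "norm (P (Complex (3/2) K) - P (Complex (3/2) (-K)) - 2 * pi * \<i> * exp (- w)) \<le>
    2 * (6 * exp (9/4)) * norm w powr (-3/2) * ((T * (1 + K) + T\<^sup>2) * exp (- K / T))"
proof -
  define f where "f = (\<lambda>s. Gamma s * exp (- s * Ln w))"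
  have w0: "w \<noteq> 0" using w by auto
  have nw: "norm w > 0" using w0 by simp
  have T0: "T > 0" using w nw T by simp
  define c where "c = 6 * exp (9/4) * norm w powr (-3/2)"
  have c0: "c \<ge> 0" by (simp add: c_def)
  \<comment> \<open>The integral of (1 + u) exp(-u/T) over u \<ge> t, that is, up to
    \<open>c\<close> the tail of the majorant \<open>f32\<close>.\<close>
  define \<Phi> where "\<Phi> = (\<lambda>t. (T * (1 + t) + T\<^sup>2) * exp (- t / T))"
  define D where "D = (\<lambda>K. P (Complex (3/2) K) - P (Complex (3/2) (-K)))"
  have \<Phi>0: "\<Phi> t \<ge> 0" if "t \<ge> 0" for t using that T0 by (simp add: \<Phi>_def)
  have fb: "norm (f s) \<le> 6 * exp (9/4) * (1 + \<bar>Im s\<bar>) powr (Re s - 1/2) * norm w powr (- Re s) * exp (- \<bar>Im s\<bar> / T)"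
    if "1/2 \<le> Re s" "Re s \<le> 3/2" for s
    using norm_Mellin_kernel[OF that w] by (simp add: f_def T)
  have f32: "norm (f (Complex (3/2) t)) \<le> c * ((1 + \<bar>t\<bar>) * exp (- \<bar>t\<bar> / T))" for t
    using fb[of "Complex (3/2) t"] by (simp add: c_def mult_ac)
  have tail: "norm (D K' - D K) \<le> 2 * c * \<Phi> K" if KK: "K \<le> K'" for K'
  proof -
    have d1: "((\<lambda>t. - c * \<Phi> t) has_real_derivative c * ((1 + t) * exp (- t / T))) (at t)" for t
      unfolding \<Phi>_def using T0
      by (auto intro!: derivative_eq_intros simp: field_simps power2_eq_square)
    have d2: "((\<lambda>t. c * \<Phi> (- t)) has_real_derivative c * ((1 - t) * exp (t / T))) (at t)" for t
      unfolding \<Phi>_def using T0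
      by (auto intro!: derivative_eq_intros simp: field_simps power2_eq_square)
    have "norm (P (Complex (3/2) K') - P (Complex (3/2) K)) \<le> - c * \<Phi> K' - (- c * \<Phi> K)"
    proof (rule vertical_primitive_bound[where f = f and \<phi>' = "\<lambda>t. c * ((1 + t) * exp (- t / T))"])
      show "norm (f (Complex (3/2) t)) \<le> c * ((1 + t) * exp (- t / T))" if "K \<le> t" "t \<le> K'" for t
        using f32[of t] that K by simp
    qed (use P KK d1 in \<open>auto simp: f_def\<close>)
    moreover have "norm (P (Complex (3/2) (-K)) - P (Complex (3/2) (-K'))) \<le> c * \<Phi> (- (- K)) - c * \<Phi> (- (- K'))"
    proof (rule vertical_primitive_bound[where f = f and \<phi>' = "\<lambda>t. c * ((1 - t) * exp (t / T))" and \<phi> = "\<lambda>t. c * \<Phi> (- t)"])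
      show "norm (f (Complex (3/2) t)) \<le> c * ((1 - t) * exp (t / T))" if "- K' \<le> t" "t \<le> - K" for t
        using f32[of t] that K by simp
    qed (use P KK d2 in \<open>auto simp: f_def\<close>)
    moreover have "c * \<Phi> K' \<ge> 0" using \<Phi>0[of K'] KK K c0 by simp
    moreover have "D K' - D K = (P (Complex (3/2) K') - P (Complex (3/2) K)) + (P (Complex (3/2) (-K)) - P (Complex (3/2) (-K')))"
      by (simp add: D_def)
    ultimately show ?thesis
      using norm_triangle_ineq[of "P (Complex (3/2) K') - P (Complex (3/2) K)" "P (Complex (3/2) (-K)) - P (Complex (3/2) (-K'))"] by simp
  qed
  define E where "E = (\<lambda>K. 6 * exp (9/4) * (1 + K) * (norm w powr (-1/2) + norm w powr (-3/2)) * exp (- K / T))"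
  have Eb: "norm (f s) \<le> E K'" if s: "\<bar>Im s\<bar> = K'" "1/2 \<le> Re s" "Re s \<le> 3/2" for s K'
  proof -
    have "norm w powr (- Re s) \<le> norm w powr (-1/2) + norm w powr (-3/2)"
    proof (cases "norm w \<ge> 1")
      case True
      then have "norm w powr (- Re s) \<le> norm w powr (-1/2)" using s by (intro powr_mono) auto
      then show ?thesis by (simp add: add_increasing2)
    next
      case False
      then have "norm w powr (- Re s) \<le> norm w powr (-3/2)" using s nw by (intro powr_mono') auto
      then show ?thesis by (simp add: add_increasing)
    qed
    moreover have "(1 + \<bar>Im s\<bar>) powr (Re s - 1/2) \<le> (1 + K') powr 1" 
      using s powr_mono[of "Re s - 1/2" 1 "1 + K'"] by simp
    ultimately show ?thesis
      using s unfolding E_def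
      by (intro order_trans[OF fb] mult_mono) auto
  qed
  \<comment> \<open>Passes from Re s = 3/2 to the line Re s = 1/2 of \<open>line_integral\<close>;
    the two horizontal segments cost \<open>E K'\<close> each.\<close>
  have lim: "norm (D K' - 2 * pi * \<i> * exp (- w)) \<le> 4 * E K'" if K': "K' \<ge> 2 * norm w" for K'
  proof -
    have K'0: "K' > 0" using K' nw by linarith
    have lb: "norm (line_integral w K' 0 - 2 * pi * \<i> * exp (- w)) \<le> 2 * E K'"
      by (rule line_integral_exp[OF w K']) (rule Eb[unfolded f_def])
    have hc: "norm (P (Complex (3/2) y) - P (Complex (1/2) y)) \<le> E K' * 1" if y: "\<bar>y\<bar> = K'" for y
    proof -
      have seg: "Im s = y \<and> 1/2 \<le> Re s \<and> Re s \<le> 3/2" if "s \<in> closed_segment (Complex (1/2) y) (Complex (3/2) y)" for s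
        using that by (auto simp: closed_segment_same_Im closed_segment_eq_real_ivl)
      have "norm (P (Complex (3/2) y) - P (Complex (1/2) y)) \<le> E K' * norm (Complex (3/2) y - Complex (1/2) y)"
      proof (rule field_differentiable_bound[where S = "closed_segment (Complex (1/2) y) (Complex (3/2) y)" and f' = f])
        fix s assume s: "s \<in> closed_segment (Complex (1/2) y) (Complex (3/2) y)"
        show "(P has_field_derivative f s) (at s within closed_segment (Complex (1/2) y) (Complex (3/2) y))"
          unfolding f_def using seg[OF s] by (intro has_field_derivative_at_within[OF P]) simp
        show "norm (f s) \<le> E K'" using seg[OF s] y by (intro Eb) auto
      qed auto
      also have "Complex (3/2) y - Complex (1/2) y = 1" by (simp add: complex_eq_iff)
      finally show ?thesis by simp
    qed
    have "line_integral w K' 0 = P (Complex (1/2) K') - P (Complex (1/2) (-K'))"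
    proof -
      have seg: "Re s = 1/2" if "s \<in> closed_segment (Complex (1/2) (-K')) (Complex (1/2) K')" for s
        using that by (auto simp: closed_segment_same_Re)
      have "(f has_contour_integral (P (pathfinish (linepath (Complex (1/2) (-K')) (Complex (1/2) K'))) - P (pathstart (linepath (Complex (1/2) (-K')) (Complex (1/2) K')))))
         (linepath (Complex (1/2) (-K')) (Complex (1/2) K'))"
      proof (rule contour_integral_primitive[where S = "closed_segment (Complex (1/2) (-K')) (Complex (1/2) K')"])
        show "(P has_field_derivative f x) (at x within closed_segment (Complex (1/2) (-K')) (Complex (1/2) K'))"
          if "x \<in> closed_segment (Complex (1/2) (-K')) (Complex (1/2) K')" for x
          unfolding f_def using seg[OF that] by (intro has_field_derivative_at_within[OF P]) simp
      qed auto
      then have "contour_integral (linepath (Complex (1/2) (-K')) (Complex (1/2) K')) f = P (Complex (1/2) K') - P (Complex (1/2) (-K'))"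
        by (simp add: contour_integral_unique)
      moreover have "line_integral w K' 0 = contour_integral (linepath (Complex (1/2) (-K')) (Complex (1/2) K')) f"
        unfolding line_integral_def
      proof (rule contour_integral_cong[OF refl])
        fix s assume "s \<in> path_image (linepath (Complex (1/2) (-K')) (Complex (1/2) K'))"
        then have "Re s > 0" "s \<noteq> 0" using seg[of s] by auto
        then show "shifted_kernel w 0 s / s = f s"
          using Gamma_plus1[OF not_nonpos_Int_of_Re_pos] by (simp add: shifted_kernel_def f_def)
      qed
      ultimately show ?thesis by simp
    qed
    then have "D K' - 2 * pi * \<i> * exp (- w) = (line_integral w K' 0 - 2 * pi * \<i> * exp (- w)) +
        ((P (Complex (3/2) K') - P (Complex (1/2) K')) + - (P (Complex (3/2) (-K')) - P (Complex (1/2) (-K'))))"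
      by (simp add: D_def)
    also have "norm \<dots> \<le> 2 * E K' + (E K' * 1 + E K' * 1)"
      using lb hc[of K'] hc[of "- K'"] K'0
      by (intro norm_triangle_mono) (simp_all only: norm_minus_cancel abs_minus_cancel abs_of_pos)
    finally show ?thesis by simp
  qed
  have "((\<lambda>K'. 4 * E K') \<longlongrightarrow> 0) at_top"
    unfolding E_def using T0 by real_asymp
  then have "((\<lambda>K'. 2 * c * \<Phi> K + 4 * E K') \<longlongrightarrow> 2 * c * \<Phi> K + 0) at_top"
    by (intro tendsto_intros)
  moreover have "\<forall>\<^sub>F K' in at_top. norm (D K - 2 * pi * \<i> * exp (- w)) \<le> 2 * c * \<Phi> K + 4 * E K'"
    using eventually_ge_at_top[of "max K (2 * norm w)"]
  proof eventually_elim
    case (elim K')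
    have "norm (D K - 2 * pi * \<i> * exp (- w)) \<le> norm (D K' - D K) + norm (D K' - 2 * pi * \<i> * exp (- w))"
      using norm_triangle_ineq4[of "D K' - 2 * pi * \<i> * exp (- w)" "D K' - D K"] by simp
    then show ?case using tail[of K'] lim[of K'] elim by simp
  qed
  ultimately have "norm (D K - 2 * pi * \<i> * exp (- w)) \<le> 2 * c * \<Phi> K + 0"
    by (intro tendsto_lowerbound[of _ _ at_top]) auto
  then show ?thesis by (simp add: D_def c_def \<Phi>_def mult_ac)
qed

section \<open>Contour shift for character sums\<close>

definition mu_exp :: "(nat \<Rightarrow> complex) \<Rightarrow> complex \<Rightarrow> complex" where
  "mu_exp \<psi> w = (\<Sum>n. of_int (mu (Suc n)) * \<psi> (Suc n) * exp (- (of_nat (Suc n) * w)))"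

lemma Ln_of_nat_mult: "w \<noteq> 0 \<Longrightarrow> Ln (of_nat (Suc n) * w) = of_real (ln (real (Suc n))) + Ln w"
  using Ln_times_of_real[of "real (Suc n)" w] by (simp del: of_nat_Suc)

text \<open>On Re s = 3/2 the series for 1/L converges absolutely. The points (n + 1) w share the
  ratio T of modulus to real part, so one truncation height serves all terms, and the errors are
  proportional to the summable (n + 1)^(-3/2).\<close>

lemma mu_exp_primitive:
  assumes d: "dirichlet_char q \<psi>" and q: "q \<ge> 1" and w: "Re w > 0" and K: "K \<ge> 0" and T: "T = norm w / Re w"
    and F: "\<And>t. \<bar>t\<bar> \<le> K \<Longrightarrow> (F has_field_derivative (Gamma (Complex (3/2) t) * exp (- Complex (3/2) t * Ln w) * mu_series \<psi> (Complex (3/2) t))) (at (Complex (3/2) t))"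
  shows "norm (F (Complex (3/2) K) - F (Complex (3/2) (-K)) - 2 * pi * \<i> * mu_exp \<psi> w) \<le>
     2 * (6 * exp (9/4)) * norm w powr (-3/2) * ((T * (1 + K) + T\<^sup>2) * exp (- K / T)) * (\<Sum>n. real (Suc n) powr (-3/2))"
proof -
  have w0: "w \<noteq> 0" using w by auto
  define f where "f = (\<lambda>s. Gamma s * exp (- s * Ln w))"
  define c where "c = (\<lambda>n. of_int (mu (Suc n)) * \<psi> (Suc n))"
  have cn: "norm (c n) \<le> 1" for n unfolding c_def norm_mult
    using norm_mu_le norm_dirichlet_char_le[OF d q] by (intro mult_le_one) auto
  define wn where "wn = (\<lambda>n. of_nat (Suc n) * w)"
  have wn: "Re (wn n) > 0" "norm (wn n) / Re (wn n) = T" "norm (wn n) = real (Suc n) * norm w" for n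
    using w by (simp_all add: wn_def T norm_mult del: of_nat_Suc)
  have "\<exists>P. \<forall>s. Re s > 0 \<longrightarrow> (P has_field_derivative (Gamma s * exp (- s * Ln (wn n)))) (at s)" for n
    using half_plane_primitive[OF kernel_holomorphic[of "wn n"]] by blast
  then obtain P where P: "\<And>n s. Re s > 0 \<Longrightarrow> (P n has_field_derivative (Gamma s * exp (- s * Ln (wn n)))) (at s)"
    by metis
  have ker: "Gamma s * exp (- s * Ln (wn n)) = f s * npow n s" for n s
  proof -
    have "npow n s = exp (- s * of_real (ln (real (Suc n))))"
      unfolding npow_def powr_def by (simp del: of_nat_Suc add: Ln_of_nat)
    then show ?thesis unfolding f_def wn_def Ln_of_nat_mult[OF w0]
      by (simp add: exp_add[symmetric] algebra_simps)
  qed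
  define DP where "DP = (\<lambda>n. P n (Complex (3/2) K) - P n (Complex (3/2) (-K)))"
  define DF where "DF = F (Complex (3/2) K) - F (Complex (3/2) (-K))"
  let ?S = "closed_segment (Complex (3/2) (-K)) (Complex (3/2) K)"
  have seg: "s = Complex (3/2) (Im s) \<and> \<bar>Im s\<bar> \<le> K" if "s \<in> ?S" for s
    using that K by (auto simp: closed_segment_same_Re complex_eq_iff closed_segment_eq_real_ivl)
  have segRe: "Re s = 3/2" if "s \<in> ?S" for s
    using that by (auto simp: closed_segment_same_Re)
  have contf: "continuous_on ?S f"
  proof (rule holomorphic_on_imp_continuous_on)
    show "f holomorphic_on ?S" unfolding f_def
      by (rule holomorphic_on_subset[OF kernel_holomorphic]) (auto dest: segRe)
  qed
  have "bounded (f ` ?S)" using contf by (intro compact_imp_bounded compact_continuous_image) auto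
  then obtain Mf where Mf: "\<And>s. s \<in> ?S \<Longrightarrow> norm (f s) \<le> Mf" by (auto simp: bounded_iff)
  define Rn where "Rn = (\<lambda>N. \<Sum>n. real (Suc (n + N)) powr (-3/2))"
  have smz: "summable (\<lambda>n. real (Suc n) powr (-3/2))" using summable_Suc_powr[of "1/2"] by simp
  have Rn0: "Rn \<longlonglongrightarrow> 0"
    unfolding Rn_def using suminf_exist_split2[OF smz] by (simp add: add.commute)
  have ser: "norm (mu_series \<psi> s - (\<Sum>n<N. c n * npow n s)) \<le> Rn N" if s: "s \<in> ?S" for s N
  proof -
    have Re: "Re s = 3/2" by (rule segRe[OF s])
    have "summable (\<lambda>n. norm (c n * npow n s))"
      unfolding c_def by (rule mu_npow_summable[OF d q]) (simp add: Re)
    then have sm: "summable (\<lambda>n. c n * npow n s)" by (rule summable_norm_cancel)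
    have "mu_series \<psi> s - (\<Sum>n<N. c n * npow n s) = (\<Sum>n. c (n + N) * npow (n + N) s)"
      unfolding mu_series_def c_def[symmetric] using suminf_minus_initial_segment[OF sm] by (simp add: c_def)
    also have "norm \<dots> \<le> Rn N" unfolding Rn_def
    proof (rule norm_suminf_le)
      show "norm (c (n + N) * npow (n + N) s) \<le> real (Suc (n + N)) powr (-3/2)" for n
        unfolding norm_mult norm_npow Re using cn[of "n + N"] by (simp add: mult_left_le_one_le del: of_nat_Suc)
      show "summable (\<lambda>n. real (Suc (n + N)) powr (-3/2))"
        using smz summable_iff_shift[of "\<lambda>n. real (Suc n) powr (-3/2)" N] by simp
    qed
    finally show ?thesis .
  qed
  have Mf0: "Mf \<ge> 0" using order_trans[OF norm_ge_zero Mf[OF ends_in_segment(2)]] .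
  have diffN: "norm (DF - (\<Sum>n<N. c n * DP n)) \<le> Mf * Rn N * (2 * K)" for N
  proof -
    define G where "G = (\<lambda>s. F s - (\<Sum>n<N. c n * P n s))"
    have "norm (G (Complex (3/2) K) - G (Complex (3/2) (-K))) \<le> (Mf * Rn N) * norm (Complex (3/2) K - Complex (3/2) (-K))"
    proof (rule field_differentiable_bound[where S = ?S and f' = "\<lambda>s. f s * (mu_series \<psi> s - (\<Sum>n<N. c n * npow n s))"])
      fix s assume s: "s \<in> ?S"
      have Re: "Re s > 0" using segRe[OF s] by simp
      have F1: "(F has_field_derivative f s * mu_series \<psi> s) (at s)"
        using F[of "Im s"] seg[OF s] by (auto simp: f_def)
      have P1: "(P n has_field_derivative f s * npow n s) (at s)" for n
        using P[OF Re, of n] unfolding ker .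
      have "(G has_field_derivative f s * mu_series \<psi> s - (\<Sum>n<N. c n * (f s * npow n s))) (at s)"
        unfolding G_def by (intro DERIV_diff F1 DERIV_sum DERIV_cmult P1)
      moreover have "f s * mu_series \<psi> s - (\<Sum>n<N. c n * (f s * npow n s)) = f s * (mu_series \<psi> s - (\<Sum>n<N. c n * npow n s))"
        by (simp add: right_diff_distrib sum_distrib_left mult_ac)
      ultimately have "(G has_field_derivative f s * (mu_series \<psi> s - (\<Sum>n<N. c n * npow n s))) (at s)"
        by (simp only:)
      then show "(G has_field_derivative f s * (mu_series \<psi> s - (\<Sum>n<N. c n * npow n s))) (at s within ?S)"
        by (rule has_field_derivative_at_within)
      show "norm (f s * (mu_series \<psi> s - (\<Sum>n<N. c n * npow n s))) \<le> Mf * Rn N"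
        unfolding norm_mult using Mf[OF s] ser[OF s] Mf0 by (intro mult_mono) auto
    qed auto
    also have "Complex (3/2) K - Complex (3/2) (-K) = \<i> * of_real (2 * K)" by (simp add: complex_eq_iff)
    also have "G (Complex (3/2) K) - G (Complex (3/2) (-K)) = DF - (\<Sum>n<N. c n * DP n)"
      by (simp add: G_def DF_def DP_def right_diff_distrib sum_subtractf)
    finally show ?thesis using K by (simp add: norm_mult)
  qed
  have "(\<lambda>N. Mf * Rn N * (2 * K)) \<longlonglongrightarrow> Mf * 0 * (2 * K)" by (intro tendsto_intros Rn0)
  then have "(\<lambda>N. Mf * Rn N * (2 * K)) \<longlonglongrightarrow> 0" by simp
  then have "(\<lambda>N. DF - (\<Sum>n<N. c n * DP n)) \<longlonglongrightarrow> 0"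
    by (rule Lim_null_comparison[OF always_eventually[OF allI[OF diffN]]])
  then have "(\<lambda>N. DF - (DF - (\<Sum>n<N. c n * DP n))) \<longlonglongrightarrow> DF - 0" by (intro tendsto_diff tendsto_const)
  then have sDF: "(\<lambda>n. c n * DP n) sums DF" by (simp add: sums_def)
  define B where "B = 2 * (6 * exp (9/4)) * norm w powr (-3/2) * ((T * (1 + K) + T\<^sup>2) * exp (- K / T))"
  have mt: "norm (DP n - 2 * pi * \<i> * exp (- wn n)) \<le> B * real (Suc n) powr (-3/2)" for n
  proof -
    have "norm (DP n - 2 * pi * \<i> * exp (- wn n)) \<le> 2 * (6 * exp (9/4)) * norm (wn n) powr (-3/2) * ((T * (1 + K) + T\<^sup>2) * exp (- K / T))"
      unfolding DP_def by (rule Mellin_truncated[OF wn(1) K wn(2)[symmetric] P])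
    also have "norm (wn n) powr (-3/2) = real (Suc n) powr (-3/2) * norm w powr (-3/2)"
      unfolding wn(3) by (simp add: powr_mult)
    finally show ?thesis by (simp add: B_def mult_ac)
  qed
  have dsm: "norm (c n * DP n - c n * (2 * pi * \<i> * exp (- wn n))) \<le> B * real (Suc n) powr (-3/2)" for n
  proof -
    have "norm (c n * DP n - c n * (2 * pi * \<i> * exp (- wn n))) = norm (c n) * norm (DP n - 2 * pi * \<i> * exp (- wn n))"
      by (simp add: norm_mult[symmetric] right_diff_distrib)
    also have "\<dots> \<le> 1 * norm (DP n - 2 * pi * \<i> * exp (- wn n))" using cn by (intro mult_right_mono) auto
    finally show ?thesis using mt[of n] by simp
  qed
  have smB: "summable (\<lambda>n. B * real (Suc n) powr (-3/2))" by (intro summable_mult smz)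
  have smd: "summable (\<lambda>n. c n * DP n - c n * (2 * pi * \<i> * exp (- wn n)))"
    by (rule summable_comparison_test'[OF smB dsm])
  have "(\<lambda>n. c n * DP n - (c n * DP n - c n * (2 * pi * \<i> * exp (- wn n)))) sums (DF - (\<Sum>n. c n * DP n - c n * (2 * pi * \<i> * exp (- wn n))))"
    by (intro sums_diff sDF summable_sums smd)
  then have s2: "(\<lambda>n. (2 * pi * \<i>) * (c n * exp (- wn n))) sums (DF - (\<Sum>n. c n * DP n - c n * (2 * pi * \<i> * exp (- wn n))))"
    by (simp add: mult_ac)
  have "2 * pi * \<i> \<noteq> (0::complex)" by simp
  from sums_mult_D[OF s2 this] have "mu_exp \<psi> w = (DF - (\<Sum>n. c n * DP n - c n * (2 * pi * \<i> * exp (- wn n)))) / (2 * pi * \<i>)"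
    by (simp add: mu_exp_def c_def wn_def sums_iff del: of_nat_Suc)
  then have "DF - 2 * pi * \<i> * mu_exp \<psi> w = (\<Sum>n. c n * DP n - c n * (2 * pi * \<i> * exp (- wn n)))"
    by simp
  also have "norm \<dots> \<le> (\<Sum>n. B * real (Suc n) powr (-3/2))" by (rule norm_suminf_le[OF dsm smB])
  also have "\<dots> = B * (\<Sum>n. real (Suc n) powr (-3/2))" by (rule suminf_mult[OF smz])
  finally show ?thesis by (simp add: DF_def B_def)
qed

lemma nat_floor_bounds:
  fixes x :: real
  assumes "0 \<le> x"
  shows "real (nat \<lfloor>x\<rfloor>) \<le> x" "x < real (nat \<lfloor>x\<rfloor>) + 1"
proof -
  have "real (nat \<lfloor>x\<rfloor>) = of_int \<lfloor>x\<rfloor>" using assms by simp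
  then show "real (nat \<lfloor>x\<rfloor>) \<le> x" "x < real (nat \<lfloor>x\<rfloor>) + 1" using floor_correct[of x] by linarith+
qed

text \<open>\<open>\<Omega>\<close> is a union of overlapping half-strips, one for each window, with
  independent left edges. The contour is a staircase through the points \<open>p i\<close>: right to
  the larger of two neighbouring edges, up by 1, and back to the next edge.\<close>

lemma contour_shift:
  fixes f :: "complex \<Rightarrow> complex" and K :: nat and \<tau> :: "nat \<Rightarrow> real"
  defines "\<Omega> \<equiv> (\<Union>i\<in>{..2*K}. {s. \<tau> i < Re s \<and> \<bar>Im s - (real i - real K)\<bar> < 1})"
  assumes \<delta>: "0 < \<delta>" "\<delta> \<le> 1/2"
    and \<tau>: "\<And>i. i \<le> 2*K \<Longrightarrow> 1/2 \<le> \<tau> i \<and> \<tau> i \<le> 1"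
    and f: "f holomorphic_on \<Omega>"
    and U: "\<And>i s. i \<le> 2*K \<Longrightarrow> \<bar>Im s\<bar> \<le> real K \<Longrightarrow> \<bar>Im s - (real i - real K)\<bar> \<le> 1 \<Longrightarrow>
        \<tau> i + \<delta> \<le> Re s \<Longrightarrow> Re s \<le> 3/2 \<Longrightarrow> norm (f s) \<le> U (Re s)"
    and mono: "\<And>x y. x \<le> y \<Longrightarrow> U x \<le> U y" and pos: "\<And>x. U x \<ge> (0::real)"
    and E: "\<And>s. Im s = - real K \<Longrightarrow> \<tau> 0 + \<delta> \<le> Re s \<Longrightarrow> Re s \<le> 3/2 \<Longrightarrow> norm (f s) \<le> E"
      "\<And>s. Im s = real K \<Longrightarrow> \<tau> (2*K) + \<delta> \<le> Re s \<Longrightarrow> Re s \<le> 3/2 \<Longrightarrow> norm (f s) \<le> E"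
  obtains F where "\<And>s. s \<in> \<Omega> \<Longrightarrow> (F has_field_derivative f s) (at s)"
    "norm (F (Complex (3/2) K) - F (Complex (3/2) (- real K))) \<le> 4 * (\<Sum>i\<le>2*K. U (\<tau> i + \<delta>)) + 2 * E"
proof -
  define H where "H = {s. 1 < Re s \<and> \<bar>Im s\<bar> < real K + 1}"
  have op: "open {s. \<tau> i < Re s \<and> \<bar>Im s - (real i - real K)\<bar> < 1}" for i
    by (intro open_Collect_conj open_Collect_less continuous_intros)
  have win: "\<exists>i\<le>2*K. \<bar>y - (real i - real K)\<bar> < 1" if y: "\<bar>y\<bar> < real K + 1" for y
  proof (cases "y + real K < 0")
    case True
    then show ?thesis using y by (intro exI[of _ 0]) auto
  next
    case False
    define i where "i = nat \<lfloor>y + real K\<rfloor>"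
    have i: "real i \<le> y + real K" "y + real K < real i + 1" 
      unfolding i_def using False by (intro nat_floor_bounds; simp)+
    then have "i \<le> 2 * K" using y by linarith
    moreover have "\<bar>y - (real i - real K)\<bar> < 1" using i by simp
    ultimately show ?thesis by blast
  qed
  have HO: "H \<subseteq> \<Omega>"
  proof
    fix s assume s: "s \<in> H"
    then obtain i where "i \<le> 2*K" "\<bar>Im s - (real i - real K)\<bar> < 1" using win[of "Im s"] by (auto simp: H_def)
    then show "s \<in> \<Omega>" using s \<tau>[of i] by (force simp: H_def \<Omega>_def)
  qed
  have cH: "convex H"
  proof -
    have "H = {s. Re s > 1} \<inter> ({s. Im s < real K + 1} \<inter> {s. Im s > - (real K + 1)})" by (auto simp: H_def)
    then show ?thesis by (simp add: convex_Int convex_halfspace_Re_gt convex_halfspace_Im_lt convex_halfspace_Im_gt)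
  qed
  have H0: "Complex 2 0 \<in> H" by (simp add: H_def)
  \<comment> \<open>Every edge is at least 1/2, so a shift by 2 carries all strips into the convex
    set \<open>H\<close>.\<close>
  obtain F where F: "\<And>s. s \<in> \<Omega> \<Longrightarrow> (F has_field_derivative f s) (at s)"
  proof (rule right_invariant_primitive[of \<Omega> H 2 f])
    show "open \<Omega>" unfolding \<Omega>_def using op by blast
    show "s + of_real u \<in> \<Omega>" if su: "s \<in> \<Omega>" "0 \<le> u" for s u
    proof -
      obtain i where "i \<le> 2*K" "\<tau> i < Re s" "\<bar>Im s - (real i - real K)\<bar> < 1" using su(1) by (auto simp: \<Omega>_def)
      then show ?thesis using su(2) unfolding \<Omega>_def by (intro UN_I[of i]) auto
    qed
    show "s + of_real 2 \<in> H" if s: "s \<in> \<Omega>" for s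
    proof -
      obtain i where "i \<le> 2*K" "\<tau> i < Re s" "\<bar>Im s - (real i - real K)\<bar> < 1" using s by (auto simp: \<Omega>_def)
      moreover from this have "real i \<le> 2 * real K" by linarith
      ultimately show ?thesis using \<tau>[of i] by (auto simp: H_def)
    qed
  qed (use cH H0 HO f in auto)
  have hb: "norm (F (Complex x2 y) - F (Complex x1 y)) \<le> B * (x2 - x1)"
    if i: "i \<le> 2*K" "y = real i - real K" and x: "\<tau> i + \<delta> \<le> x1" "x1 \<le> x2" "x2 \<le> 3/2"
      and B: "\<And>x. x1 \<le> x \<Longrightarrow> x \<le> x2 \<Longrightarrow> norm (f (Complex x y)) \<le> B" for i y x1 x2 B
  proof -
    have seg: "s = Complex (Re s) y \<and> x1 \<le> Re s \<and> Re s \<le> x2" if "s \<in> closed_segment (Complex x1 y) (Complex x2 y)" for s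
      using that x by (auto simp: closed_segment_same_Im closed_segment_eq_real_ivl complex_eq_iff)
    have "norm (F (Complex x2 y) - F (Complex x1 y)) \<le> B * norm (Complex x2 y - Complex x1 y)"
    proof (rule field_differentiable_bound[where S = "closed_segment (Complex x1 y) (Complex x2 y)" and f' = f])
      fix s assume "s \<in> closed_segment (Complex x1 y) (Complex x2 y)"
      note s = seg[OF this]
      then have "Im s = y" by (metis complex.sel(2))
      then have "s \<in> \<Omega>" using s i x \<delta> unfolding \<Omega>_def by force
      then show "(F has_field_derivative f s) (at s within closed_segment (Complex x1 y) (Complex x2 y))"
        by (rule has_field_derivative_at_within[OF F])
      show "norm (f s) \<le> B" using B[of "Re s"] s by metis
    qed auto
    also have "Complex x2 y - Complex x1 y = of_real (x2 - x1)" by (simp add: complex_eq_iff)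
    also have "norm (complex_of_real (x2 - x1)) = x2 - x1" unfolding norm_of_real using x by simp
    finally show ?thesis .
  qed
  define p where "p = (\<lambda>i. Complex (\<tau> i + \<delta>) (real i - real K))"
  have step: "norm (F (p (Suc i)) - F (p i)) \<le> 2 * U (\<tau> i + \<delta>) + 2 * U (\<tau> (Suc i) + \<delta>)" if i: "i < 2*K" for i
  proof -
    define y where "y = real i - real K"
    have iK: "real i + 1 \<le> 2 * real K" using i by linarith
    have y: "\<bar>y\<bar> \<le> real K" "\<bar>y + 1\<bar> \<le> real K" using iK by (auto simp: y_def)
    \<comment> \<open>The path between two corners has length at most 2 and stays where |f| \<le> U
      m. As \<open>U m\<close> is one of the two edge values and every edge belongs to at most two
      steps, the total factor is 4.\<close>
    define m where "m = max (\<tau> i + \<delta>) (\<tau> (Suc i) + \<delta>)"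
    have i2: "i \<le> 2*K" "Suc i \<le> 2*K" using i by auto
    have m: "\<tau> i + \<delta> \<le> m" "\<tau> (Suc i) + \<delta> \<le> m" "m \<le> 3/2" using \<tau>[OF i2(1)] \<tau>[OF i2(2)] \<delta> by (auto simp: m_def max_def)
    have h1: "norm (F (Complex m y) - F (Complex (\<tau> i + \<delta>) y)) \<le> U m * (m - (\<tau> i + \<delta>))"
    proof (rule hb[OF i2(1) y_def order_refl m(1,3)])
      fix x assume x: "\<tau> i + \<delta> \<le> x" "x \<le> m"
      have "norm (f (Complex x y)) \<le> U x" using U[OF i2(1), of "Complex x y"] x m y by (simp add: y_def)
      then show "norm (f (Complex x y)) \<le> U m" using mono[OF x(2)] by linarith
    qed
    have h2: "norm (F (Complex m (y + 1)) - F (Complex (\<tau> (Suc i) + \<delta>) (y + 1))) \<le> U m * (m - (\<tau> (Suc i) + \<delta>))"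
    proof (rule hb[OF i2(2) _ order_refl m(2,3)])
      show "y + 1 = real (Suc i) - real K" by (simp add: y_def)
      fix x assume x: "\<tau> (Suc i) + \<delta> \<le> x" "x \<le> m"
      have "norm (f (Complex x (y + 1))) \<le> U x" using U[OF i2(2), of "Complex x (y + 1)"] x m y by (simp add: y_def)
      then show "norm (f (Complex x (y + 1))) \<le> U m" using mono[OF x(2)] by linarith
    qed
    have v: "norm (F (Complex m (y + 1)) - F (Complex m y)) \<le> U m"
    proof -
      have seg: "Re s = m \<and> y \<le> Im s \<and> Im s \<le> y + 1" if "s \<in> closed_segment (Complex m y) (Complex m (y + 1))" for s
        using that by (auto simp: closed_segment_same_Re closed_segment_eq_real_ivl)
      have "norm (F (Complex m (y + 1)) - F (Complex m y)) \<le> U m * norm (Complex m (y + 1) - Complex m y)"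
      proof (rule field_differentiable_bound[where S = "closed_segment (Complex m y) (Complex m (y + 1))" and f' = f])
        fix s assume "s \<in> closed_segment (Complex m y) (Complex m (y + 1))"
        note s = seg[OF this]
        have "s \<in> \<Omega>"
        proof (cases "Im s = y + 1")
          case True
          then have "\<bar>Im s - (real (Suc i) - real K)\<bar> < 1" by (simp add: y_def)
          then show ?thesis using s m \<delta> i2(2) unfolding \<Omega>_def by force
        next
          case False
          then have "\<bar>Im s - (real i - real K)\<bar> < 1" using s by (simp add: y_def)
          then show ?thesis using s m \<delta> i2(1) unfolding \<Omega>_def by force
        qed
        then show "(F has_field_derivative f s) (at s within closed_segment (Complex m y) (Complex m (y + 1)))"
          by (rule has_field_derivative_at_within[OF F])
        have "\<bar>Im s\<bar> \<le> real K" "\<bar>Im s - (real i - real K)\<bar> \<le> 1" using s y by (auto simp: y_def)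
        then show "norm (f s) \<le> U m" using U[OF i2(1), of s] s m by simp
      qed auto
      also have "Complex m (y + 1) - Complex m y = \<i>" by (simp add: complex_eq_iff)
      finally show ?thesis by simp
    qed
    have "F (p (Suc i)) - F (p i) = (F (Complex m (y + 1)) - F (Complex m y)) + ((F (Complex m y) - F (Complex (\<tau> i + \<delta>) y))
        + - (F (Complex m (y + 1)) - F (Complex (\<tau> (Suc i) + \<delta>) (y + 1))))"
      by (simp add: p_def y_def algebra_simps)
    also have "norm \<dots> \<le> U m + (U m * (m - (\<tau> i + \<delta>)) + U m * (m - (\<tau> (Suc i) + \<delta>)))"
      using h1 h2 v by (intro norm_triangle_mono) (simp_all only: norm_minus_cancel)
    also have "\<dots> = U m * (1 + (m - (\<tau> i + \<delta>)) + (m - (\<tau> (Suc i) + \<delta>)))" by (simp add: algebra_simps)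
    also have "\<dots> \<le> U m * 2"
      using pos[of m] \<tau>[OF i2(1)] \<tau>[OF i2(2)] by (intro mult_left_mono) (auto simp: m_def max_def)
    also have "\<dots> \<le> (U (\<tau> i + \<delta>) + U (\<tau> (Suc i) + \<delta>)) * 2"
      using pos[of "\<tau> i + \<delta>"] pos[of "\<tau> (Suc i) + \<delta>"] by (simp add: m_def max_def)
    finally show ?thesis by simp
  qed
  have "norm (F (p (2*K)) - F (p 0)) \<le> 4 * (\<Sum>i\<le>2*K. U (\<tau> i + \<delta>))"
  proof -
    have "F (p (2*K)) - F (p 0) = (\<Sum>i<2*K. F (p (Suc i)) - F (p i))"
      by (rule sum_lessThan_telescope[symmetric])
    also have "norm \<dots> \<le> (\<Sum>i<2*K. 2 * U (\<tau> i + \<delta>) + 2 * U (\<tau> (Suc i) + \<delta>))"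
      by (rule sum_norm_le) (use step in auto)
    also have "\<dots> = 2 * (\<Sum>i<2*K. U (\<tau> i + \<delta>)) + 2 * (\<Sum>i<2*K. U (\<tau> (Suc i) + \<delta>))"
      by (simp add: sum.distrib sum_distrib_left)
    also have "(\<Sum>i<2*K. U (\<tau> i + \<delta>)) \<le> (\<Sum>i\<le>2*K. U (\<tau> i + \<delta>))"
      by (rule sum_mono2) (use pos in auto)
    also have "(\<Sum>i<2*K. U (\<tau> (Suc i) + \<delta>)) \<le> (\<Sum>i\<le>2*K. U (\<tau> i + \<delta>))"
      unfolding sum.atMost_shift using pos[of "\<tau> 0 + \<delta>"] by simp
    finally show ?thesis by simp
  qed
  moreover have E0: "E \<ge> 0"
  proof -
    have "norm (f (Complex (3/2) (- real K))) \<le> E" using \<tau>[of 0] \<delta> by (intro E(1)) auto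
    then show ?thesis by (rule order_trans[OF norm_ge_zero])
  qed
  moreover have "norm (F (Complex (3/2) (- real K)) - F (p 0)) \<le> E"
  proof -
    have "norm (F (Complex (3/2) (- real K)) - F (Complex (\<tau> 0 + \<delta>) (- real K))) \<le> E * (3/2 - (\<tau> 0 + \<delta>))"
      using \<tau>[of 0] \<delta> by (intro hb[of 0]) (auto intro!: E(1))
    also have "\<dots> \<le> E * 1" using E0 \<tau>[of 0] \<delta> by (intro mult_left_mono) auto
    finally show ?thesis by (simp add: p_def)
  qed
  moreover have "norm (F (Complex (3/2) (real K)) - F (p (2*K))) \<le> E"
  proof -
    have "norm (F (Complex (3/2) (real K)) - F (Complex (\<tau> (2*K) + \<delta>) (real K))) \<le> E * (3/2 - (\<tau> (2*K) + \<delta>))"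
      using \<tau>[of "2*K"] \<delta> by (intro hb[of "2*K"]) (auto intro!: E(2))
    also have "\<dots> \<le> E * 1" using E0 \<tau>[of "2*K"] \<delta> by (intro mult_left_mono) auto
    finally show ?thesis by (simp add: p_def)
  qed
  moreover have "norm (F (Complex (3/2) K) - F (Complex (3/2) (- real K))) \<le> norm (F (p (2*K)) - F (p 0)) +
      (norm (F (Complex (3/2) (real K)) - F (p (2*K))) + norm (F (Complex (3/2) (- real K)) - F (p 0)))"
  proof -
    have "F (Complex (3/2) K) - F (Complex (3/2) (- real K)) = (F (p (2*K)) - F (p 0)) +
      ((F (Complex (3/2) (real K)) - F (p (2*K))) + - (F (Complex (3/2) (- real K)) - F (p 0)))" by simp
    also have "norm \<dots> \<le> norm (F (p (2*K)) - F (p 0)) +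
      (norm (F (Complex (3/2) (real K)) - F (p (2*K))) + norm (F (Complex (3/2) (- real K)) - F (p 0)))"
      by (intro norm_triangle_mono) (simp_all only: norm_minus_cancel)
    finally show ?thesis .
  qed
  ultimately show ?thesis using that[OF F] by simp
qed

text \<open>\<open>A\<close> and \<open>W\<close> are kept apart from \<open>norm w\<close> because
  the application is to d w with W = |w|: the saving d^(-1/2) then sits in \<open>A\<close>, and the
  main term is otherwise the one for w. The radius 5 of the zero-free range is the half-width 1 of a
  window plus the height 4 required by \<open>inverse_L_bound\<close>.\<close>

lemma mu_exp_bound:
  fixes \<delta> \<eta> :: real
  assumes \<delta>: "0 < \<delta>" "\<delta> \<le> 1/2" and \<eta>: "\<eta> > 0"
  obtains C where "C > 0"
    "\<And>q \<psi> w (K::nat) A W T \<tau>. q \<ge> 1 \<Longrightarrow> dirichlet_char q \<psi> \<Longrightarrow> Re w > 0 \<Longrightarrow> T = norm w / Re w \<Longrightarrow> A \<ge> 0 \<Longrightarrow> 0 < W \<Longrightarrow> W \<le> real K + 2 \<Longrightarrow>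
      (\<And>s. 1/2 \<le> Re s \<Longrightarrow> Re s \<le> 3/2 \<Longrightarrow> norm (Gamma s * exp (- s * Ln w)) \<le>
         A * (1 + \<bar>Im s\<bar>) powr (Re s - 1/2) * W powr (- Re s) * exp (- \<bar>Im s\<bar> / T)) \<Longrightarrow>
      (\<And>i. i \<le> 2*K \<Longrightarrow> 1/2 \<le> \<tau> i \<and> \<tau> i \<le> 1) \<Longrightarrow>
      (\<And>i z. i \<le> 2*K \<Longrightarrow> z \<in> L_dom q \<psi> \<Longrightarrow> \<tau> i < Re z \<Longrightarrow> \<bar>Im z - (real i - real K)\<bar> < 5 \<Longrightarrow> L_fun q \<psi> z \<noteq> 0) \<Longrightarrow>
      norm (mu_exp \<psi> w) \<le> C * A * (real q * (real K + 3)) powr \<eta> * ((real K + 2) powr (-1/2) * (\<Sum>i\<le>2*K. ((real K + 2) / W) powr (\<tau> i + \<delta>))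
         + (real K + 1) * (W powr (-1/2) + W powr (-3/2)) * exp (- real K / T))
         + C * norm w powr (-3/2) * ((T * (1 + real K) + T\<^sup>2) * exp (- real K / T))"
proof -
  have \<delta>1: "\<delta> \<le> 1" using \<delta> by simp
  obtain C1 where C1: "C1 > 0"
    "\<And>q \<psi> \<sigma>0 s. q \<ge> 1 \<Longrightarrow> dirichlet_char q \<psi> \<Longrightarrow> 1/2 \<le> \<sigma>0 \<Longrightarrow> \<sigma>0 \<le> 1 \<Longrightarrow>
       (\<And>z. z \<in> L_dom q \<psi> \<Longrightarrow> \<sigma>0 < Re z \<Longrightarrow> \<bar>Im z - Im s\<bar> < 4 \<Longrightarrow> L_fun q \<psi> z \<noteq> 0) \<Longrightarrow>
       \<sigma>0 + \<delta> \<le> Re s \<Longrightarrow> Re s \<le> 2 \<Longrightarrow> norm (1 / L_fun q \<psi> s) \<le> C1 * (real q * (\<bar>Im s\<bar> + 2)) powr \<eta>"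
    using inverse_L_bound[OF \<delta>(1) \<delta>1 \<eta>] by metis
  define Z where "Z = (\<Sum>n. real (Suc n) powr (-3/2))"
  have Z: "Z \<ge> 0" unfolding Z_def using summable_Suc_powr[of "1/2"] by (intro suminf_nonneg) auto
  define C where "C = 4 * C1 + 2 * (6 * exp (9/4)) * Z"
  show ?thesis
  proof (rule that)
    show "C > 0" using C1(1) Z by (simp add: C_def add_pos_nonneg)
    fix q \<psi> w A W T \<tau> and K :: nat
    assume q: "q \<ge> 1" and d: "dirichlet_char q \<psi>" and w: "Re w > 0" and T: "T = norm w / Re w" and A: "A \<ge> 0"
      and W: "0 < W" "W \<le> real K + 2"
      and kb: "\<And>s. 1/2 \<le> Re s \<Longrightarrow> Re s \<le> 3/2 \<Longrightarrow> norm (Gamma s * exp (- s * Ln w)) \<le>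
         A * (1 + \<bar>Im s\<bar>) powr (Re s - 1/2) * W powr (- Re s) * exp (- \<bar>Im s\<bar> / T)"
      and \<tau>: "\<And>i. i \<le> 2*K \<Longrightarrow> 1/2 \<le> \<tau> i \<and> \<tau> i \<le> 1"
      and zf: "\<And>i z. i \<le> 2*K \<Longrightarrow> z \<in> L_dom q \<psi> \<Longrightarrow> \<tau> i < Re z \<Longrightarrow> \<bar>Im z - (real i - real K)\<bar> < 5 \<Longrightarrow> L_fun q \<psi> z \<noteq> 0"
    have T0: "T > 0" using w T by (auto simp: zero_less_divide_iff)
    define f where "f = (\<lambda>s. (Gamma s * exp (- s * Ln w)) * (1 / L_fun q \<psi> s))"
    define \<Omega> where "\<Omega> = (\<Union>i\<in>{..2*K}. {s. \<tau> i < Re s \<and> \<bar>Im s - (real i - real K)\<bar> < 1})"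
    have O0: "\<Omega> \<subseteq> {s. Re s > 0}"
    proof
      fix s assume "s \<in> \<Omega>"
      then obtain i where "i \<le> 2*K" "\<tau> i < Re s" by (auto simp: \<Omega>_def)
      then show "s \<in> {s. Re s > 0}" using \<tau>[of i] by auto
    qed
    have hol: "f holomorphic_on \<Omega>" unfolding f_def
    proof (intro holomorphic_on_mult[OF holomorphic_on_subset[OF kernel_holomorphic O0]] inverse_L_holomorphic[OF d q O0])
      fix s assume s: "s \<in> \<Omega>" "s \<in> L_dom q \<psi>"
      then obtain i where "i \<le> 2*K" "\<tau> i < Re s" "\<bar>Im s - (real i - real K)\<bar> < 1" by (auto simp: \<Omega>_def)
      then show "L_fun q \<psi> s \<noteq> 0" using zf s(2) by force
    qed
    define Q where "Q = C1 * (real q * (real K + 3)) powr \<eta>"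
    have Q0: "Q \<ge> 0" using C1(1) by (simp add: Q_def)
    have invb: "norm (1 / L_fun q \<psi> s) \<le> Q"
      if h: "i \<le> 2*K" "\<bar>Im s\<bar> \<le> real K" "\<bar>Im s - (real i - real K)\<bar> \<le> 1" "\<tau> i + \<delta> \<le> Re s" "Re s \<le> 3/2" for i s
    proof -
      have "norm (1 / L_fun q \<psi> s) \<le> C1 * (real q * (\<bar>Im s\<bar> + 2)) powr \<eta>"
      proof (rule C1(2)[OF q d, of "\<tau> i"])
        fix z assume z: "z \<in> L_dom q \<psi>" "\<tau> i < Re z" "\<bar>Im z - Im s\<bar> < 4"
        have "\<bar>Im z - (real i - real K)\<bar> < 5" using z(3) h(3) by linarith
        then show "L_fun q \<psi> z \<noteq> 0" using zf h(1) z by blast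
      qed (use \<tau>[OF h(1)] h in auto)
      also have "\<dots> \<le> Q" unfolding Q_def using C1(1) h(2) \<eta> by (intro mult_left_mono powr_mono2) auto
      finally show ?thesis .
    qed
    define Y where "Y = (real K + 2) / W"
    have Y1: "Y \<ge> 1" using W by (simp add: Y_def)
    \<comment> \<open>The kernel has size (K + 2)^(Re s - 1/2) W^(-Re s); collecting the powers in Y
      \<ge> 1 makes the bound visibly increasing in Re s.\<close>
    define U where "U = (\<lambda>x. A * Q * (real K + 2) powr (-1/2) * Y powr x)"
    define E where "E = A * Q * ((real K + 1) * (W powr (-1/2) + W powr (-3/2)) * exp (- K / T))"
    have Ub: "norm (f s) \<le> U (Re s)"
      if h: "i \<le> 2*K" "\<bar>Im s\<bar> \<le> real K" "\<bar>Im s - (real i - real K)\<bar> \<le> 1" "\<tau> i + \<delta> \<le> Re s" "Re s \<le> 3/2" for i s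
    proof -
      have h2: "1/2 \<le> Re s" using h(4) \<tau>[OF h(1)] \<delta> by linarith
      have "exp (- \<bar>Im s\<bar> / T) \<le> 1" using T0 by simp
      moreover have "(1 + \<bar>Im s\<bar>) powr (Re s - 1/2) \<le> (real K + 2) powr (Re s - 1/2)"
        using h h2 by (intro powr_mono2) auto
      ultimately have "A * (1 + \<bar>Im s\<bar>) powr (Re s - 1/2) * W powr (- Re s) * exp (- \<bar>Im s\<bar> / T)
         \<le> A * (real K + 2) powr (Re s - 1/2) * W powr (- Re s) * 1"
        using A by (intro mult_mono) auto
      also have "\<dots> = A * (real K + 2) powr (-1/2) * Y powr (Re s)"
      proof -
        have "(real K + 2) powr (Re s - 1/2) = (real K + 2) powr (-1/2) * (real K + 2) powr Re s"
          by (simp flip: powr_add)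
        note h1 = this
        have h2: "Y powr Re s = (real K + 2) powr Re s / W powr Re s"
          unfolding Y_def using W by (simp add: powr_divide)
        have h3: "W powr (- Re s) = 1 / W powr Re s" by (rule powr_minus_divide)
        show ?thesis unfolding h1 h2 h3 by simp
      qed
      finally have k: "norm (Gamma s * exp (- s * Ln w)) \<le> A * (real K + 2) powr (-1/2) * Y powr (Re s)"
        using kb[OF h2 h(5)] by linarith
      have "norm (f s) \<le> (A * (real K + 2) powr (-1/2) * Y powr (Re s)) * Q"
        unfolding f_def norm_mult[of "Gamma s * exp (- s * Ln w)"] using A by (intro mult_mono k invb[OF h]) auto
      then show ?thesis by (simp add: U_def mult_ac)
    qed
    have Eb: "norm (f s) \<le> E"
      if h: "i \<le> 2*K" "\<bar>Im s\<bar> = real K" "\<bar>Im s - (real i - real K)\<bar> \<le> 1" "\<tau> i + \<delta> \<le> Re s" "Re s \<le> 3/2" for i s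
    proof -
      have h2: "1/2 \<le> Re s" using h(4) \<tau>[OF h(1)] \<delta> by linarith
      have "(1 + \<bar>Im s\<bar>) powr (Re s - 1/2) \<le> (real K + 1) powr 1"
        using h h2 powr_mono[of "Re s - 1/2" 1 "real K + 1"] by (simp add: add.commute)
      moreover have "W powr (- Re s) \<le> W powr (-1/2) + W powr (-3/2)"
      proof (cases "W \<ge> 1")
        case True
        then have "W powr (- Re s) \<le> W powr (-1/2)" using h2 by (intro powr_mono) auto
        then show ?thesis by (simp add: add_increasing2)
      next
        case False
        then have "W powr (- Re s) \<le> W powr (-3/2)" using h(5) W by (intro powr_mono') auto
        then show ?thesis by (simp add: add_increasing)
      qed
      ultimately have "A * (1 + \<bar>Im s\<bar>) powr (Re s - 1/2) * W powr (- Re s) * exp (- \<bar>Im s\<bar> / T)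
         \<le> A * (real K + 1) * (W powr (-1/2) + W powr (-3/2)) * exp (- real K / T)"
        using A h(2) by (intro mult_mono) auto
      then have k: "norm (Gamma s * exp (- s * Ln w)) \<le> A * (real K + 1) * (W powr (-1/2) + W powr (-3/2)) * exp (- real K / T)"
        using kb[OF h2 h(5)] by linarith
      have "norm (f s) \<le> (A * (real K + 1) * (W powr (-1/2) + W powr (-3/2)) * exp (- real K / T)) * Q"
        unfolding f_def norm_mult[of "Gamma s * exp (- s * Ln w)"]
        using A h by (intro mult_mono k invb) auto
      then show ?thesis by (simp add: E_def mult_ac)
    qed
    obtain F where F: "\<And>s. s \<in> \<Omega> \<Longrightarrow> (F has_field_derivative f s) (at s)"
      "norm (F (Complex (3/2) K) - F (Complex (3/2) (- real K))) \<le> 4 * (\<Sum>i\<le>2*K. U (\<tau> i + \<delta>)) + 2 * E"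
    proof (rule contour_shift[where f = f and K = K and \<tau> = \<tau> and U = U and E = E and \<delta> = \<delta>])
      show "f holomorphic_on (\<Union>i\<in>{..2*K}. {s. \<tau> i < Re s \<and> \<bar>Im s - (real i - real K)\<bar> < 1})"
        using hol by (simp only: \<Omega>_def)
      show "U x \<le> U y" if "x \<le> y" for x y unfolding U_def using that Y1 A Q0 by (intro mult_left_mono powr_mono) auto
      show "U x \<ge> 0" for x unfolding U_def using A Q0 by simp
      show "norm (f s) \<le> E" if "Im s = - real K" "\<tau> 0 + \<delta> \<le> Re s" "Re s \<le> 3/2" for s
        using that by (intro Eb[of 0]) auto
      show "norm (f s) \<le> E" if "Im s = real K" "\<tau> (2*K) + \<delta> \<le> Re s" "Re s \<le> 3/2" for s
        using that by (intro Eb[of "2*K"]) auto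
    qed (use \<delta> \<tau> Ub in \<open>auto simp: \<Omega>_def\<close>)
    have "norm (F (Complex (3/2) (real K)) - F (Complex (3/2) (- real K)) - 2 * pi * \<i> * mu_exp \<psi> w) \<le>
      2 * (6 * exp (9/4)) * norm w powr (-3/2) * ((T * (1 + real K) + T\<^sup>2) * exp (- real K / T)) * (\<Sum>n. real (Suc n) powr (-3/2))"
    proof (rule mu_exp_primitive[OF d q w _ T])
      fix t assume t: "\<bar>t\<bar> \<le> real K"
      have "\<exists>i\<le>2*K. \<bar>t - (real i - real K)\<bar> < 1"
      proof -
        define i where "i = nat \<lfloor>t + real K\<rfloor>"
        have i: "real i \<le> t + real K" "t + real K < real i + 1" 
          unfolding i_def using t by (intro nat_floor_bounds; simp)+
        then have "i \<le> 2 * K" using t by linarith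
        moreover have "\<bar>t - (real i - real K)\<bar> < 1" using i by simp
        ultimately show ?thesis by blast
      qed
      then obtain i where i: "i \<le> 2*K" "\<bar>t - (real i - real K)\<bar> < 1" by blast
      have "Complex (3/2) t \<in> \<Omega>" unfolding \<Omega>_def using i \<tau>[OF i(1)] by force
      then have "(F has_field_derivative f (Complex (3/2) t)) (at (Complex (3/2) t))" by (rule F(1))
      moreover have "1 / L_fun q \<psi> (Complex (3/2) t) = mu_series \<psi> (Complex (3/2) t)"
      proof -
        have "mu_series \<psi> (Complex (3/2) t) * L_fun q \<psi> (Complex (3/2) t) = 1"
          by (rule mu_series_L_fun[OF d q]) simp
        then show ?thesis by (metis div_self divide_eq_eq mult_zero_right zero_neq_one nonzero_eq_divide_eq)
      qed
      ultimately show "(F has_field_derivative Gamma (Complex (3/2) t) * exp (- Complex (3/2) t * Ln w) * mu_series \<psi> (Complex (3/2) t)) (at (Complex (3/2) t))"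
        by (simp only: f_def)
    qed auto
    then have "norm (2 * pi * \<i> * mu_exp \<psi> w) \<le> norm (F (Complex (3/2) (real K)) - F (Complex (3/2) (- real K))) +
      2 * (6 * exp (9/4)) * norm w powr (-3/2) * ((T * (1 + real K) + T\<^sup>2) * exp (- real K / T)) * Z"
      using norm_triangle_sub[of "2 * pi * \<i> * mu_exp \<psi> w" "F (Complex (3/2) (real K)) - F (Complex (3/2) (- real K))"]
      unfolding Z_def by (simp only: norm_minus_commute)
    moreover have "norm (mu_exp \<psi> w) \<le> norm (2 * pi * \<i> * mu_exp \<psi> w)"
    proof -
      have "1 * norm (mu_exp \<psi> w) \<le> (2 * pi) * norm (mu_exp \<psi> w)" using pi_ge_two by (intro mult_right_mono) auto
      then show ?thesis by (simp add: norm_mult)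
    qed
    ultimately have b1: "norm (mu_exp \<psi> w) \<le> 4 * (\<Sum>i\<le>2*K. U (\<tau> i + \<delta>)) + 2 * E +
       2 * (6 * exp (9/4)) * norm w powr (-3/2) * ((T * (1 + real K) + T\<^sup>2) * exp (- real K / T)) * Z"
      using F(2) by linarith
    define R where "R = (real q * (real K + 3)) powr \<eta>"
    define S1 where "S1 = (real K + 2) powr (-1/2) * (\<Sum>i\<le>2*K. ((real K + 2) / W) powr (\<tau> i + \<delta>))"
    define S2 where "S2 = (real K + 1) * (W powr (-1/2) + W powr (-3/2)) * exp (- real K / T)"
    define S3 where "S3 = norm w powr (-3/2) * ((T * (1 + real K) + T\<^sup>2) * exp (- real K / T))"
    have nn: "R \<ge> 0" "S1 \<ge> 0" "S2 \<ge> 0" "S3 \<ge> 0"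
      using T0 by (auto simp: R_def S1_def S2_def S3_def intro!: mult_nonneg_nonneg sum_nonneg add_nonneg_nonneg)
    have e1: "(\<Sum>i\<le>2*K. U (\<tau> i + \<delta>)) = C1 * (A * R * S1)"
      by (simp add: U_def Q_def R_def S1_def Y_def sum_distrib_left mult_ac)
    have e2: "E = C1 * (A * R * S2)" by (simp add: E_def Q_def R_def S2_def mult_ac)
    have "norm (mu_exp \<psi> w) \<le> (4 * C1) * (A * R * S1) + (2 * C1) * (A * R * S2) + (2 * (6 * exp (9/4)) * Z) * S3"
      using b1 unfolding e1 e2 by (simp add: S3_def mult_ac)
    also have "\<dots> \<le> C * (A * R * S1) + C * (A * R * S2) + C * S3"
      using nn A C1(1) Z by (intro add_mono mult_right_mono) (auto simp: C_def)
    also have "\<dots> = C * A * R * (S1 + S2) + C * S3" by (simp add: algebra_simps)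
    finally show "norm (mu_exp \<psi> w) \<le> C * A * (real q * (real K + 3)) powr \<eta> * ((real K + 2) powr (-1/2) * (\<Sum>i\<le>2*K. ((real K + 2) / W) powr (\<tau> i + \<delta>))
         + (real K + 1) * (W powr (-1/2) + W powr (-3/2)) * exp (- real K / T))
         + C * norm w powr (-3/2) * ((T * (1 + real K) + T\<^sup>2) * exp (- real K / T))"
      by (simp add: R_def S1_def S2_def S3_def mult.assoc)
  qed
qed

section \<open>The average over characters\<close>

definition zero_free :: "real \<Rightarrow> bool" where
  "zero_free a \<longleftrightarrow> (\<forall>l\<ge>1. \<forall>\<psi>\<in>dchars l. \<forall>s\<in>L_dom l \<psi>. Re s > a \<longrightarrow> L_fun l \<psi> s \<noteq> 0)"

lemma zero_freeD:
  assumes "zero_free a" "l \<ge> 1" "dirichlet_char l \<psi>" "s \<in> L_dom l \<psi>" "L_fun l \<psi> s = 0"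
  shows "Re s \<le> a"
  using assms unfolding zero_free_def dchars_def by (metis linorder_not_le mem_Collect_eq)

text \<open>Window \<open>i\<close> is centred at height \<open>i - K\<close>, so that \<open>i \<le> 2 K\<close> covers \<open>[-K, K]\<close>.\<close>
definition window_zero :: "nat \<Rightarrow> nat \<Rightarrow> (nat \<Rightarrow> complex) \<Rightarrow> nat \<Rightarrow> real \<Rightarrow> bool" where
  "window_zero q K \<psi> i \<sigma> \<longleftrightarrow> (\<exists>z\<in>L_dom q \<psi>. L_fun q \<psi> z = 0 \<and> \<sigma> < Re z \<and> \<bar>Im z - (real i - real K)\<bar> < 5)"

lemma card_window:
  shows "finite {i::nat. \<bar>y - (real i - r)\<bar> < 5}" "card {i::nat. \<bar>y - (real i - r)\<bar> < 5} \<le> 11"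
proof -
  define m where "m = nat \<lfloor>y + r - 5\<rfloor>"
  have "{i::nat. \<bar>y - (real i - r)\<bar> < 5} \<subseteq> {m..<m+11}"
  proof
    fix i :: nat assume "i \<in> {i. \<bar>y - (real i - r)\<bar> < 5}"
    then have i: "y + r - 5 < real i" "real i < y + r + 5" by auto
    have "m \<le> i" unfolding m_def using i(1) by linarith
    moreover have "i < m + 11" unfolding m_def using i(2) by linarith
    ultimately show "i \<in> {m..<m+11}" by simp
  qed
  then show "finite {i::nat. \<bar>y - (real i - r)\<bar> < 5}" "card {i::nat. \<bar>y - (real i - r)\<bar> < 5} \<le> 11"
    using card_mono[of "{m..<m+11}"] by (auto intro: finite_subset)
qed

text \<open>The constant 31 accounts for the windows near the real axis: \<open>N_zeros\<close> omits zeros of height below 10.\<close>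
lemma card_window_zeros:
  assumes zf: "zero_free a" and a: "a < 1" and q: "q \<ge> 1" and d: "dirichlet_char q \<psi>" and \<sigma>: "\<sigma> > 0"
  shows "real (card {i. i \<le> 2*K \<and> window_zero q K \<psi> i \<sigma>}) \<le> 31 + 11 * N_zeros q \<psi> \<sigma> (real K + 5)"
proof -
  define Zs where "Zs = L_zeros q \<psi> \<sigma> (real K + 5)"
  have fin: "finite Zs" and cz: "real (card Zs) \<le> N_zeros q \<psi> \<sigma> (real K + 5)"
    unfolding Zs_def using L_zeros_finite_card[OF d q \<sigma>] by auto
  \<comment> \<open>Outside \<open>A\<close> the centre of the window is at distance at least 15
    from the real axis, so its zeros have height at least 15 - 5 = 10 and are counted by
    \<open>N_zeros\<close>.\<close>
  define A where "A = {K - 15..K + 15}"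
  define B where "B = (\<Union>z\<in>Zs. {i::nat. \<bar>Im z - (real i - real K)\<bar> < 5})"
  have "{i. i \<le> 2*K \<and> window_zero q K \<psi> i \<sigma>} \<subseteq> A \<union> B"
  proof
    fix i assume i: "i \<in> {i. i \<le> 2*K \<and> window_zero q K \<psi> i \<sigma>}"
    show "i \<in> A \<union> B"
    proof (cases "i \<in> A")
      case False
      then have far: "\<bar>real i - real K\<bar> \<ge> 15" by (auto simp: A_def)
      obtain z where z: "z \<in> L_dom q \<psi>" "L_fun q \<psi> z = 0" "\<sigma> < Re z" "\<bar>Im z - (real i - real K)\<bar> < 5"
        using i by (auto simp: window_zero_def)
      have "Re z \<le> 1" using zero_freeD[OF zf q d z(1,2)] a by simp
      moreover have "10 \<le> \<bar>Im z\<bar>" using far z(4) by linarith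
      moreover have "\<bar>real i - real K\<bar> \<le> real K" using i by auto
      then have "\<bar>Im z\<bar> \<le> real K + 5" using z(4) by linarith
      ultimately have "z \<in> Zs" using z by (simp add: Zs_def L_zeros_def)
      then have "i \<in> B" unfolding B_def using z(4) by blast
      then show ?thesis by blast
    qed simp
  qed
  moreover have fB: "finite B" unfolding B_def using fin card_window(1) by blast
  ultimately have "card {i. i \<le> 2*K \<and> window_zero q K \<psi> i \<sigma>} \<le> card (A \<union> B)"
    by (intro card_mono) (auto simp: A_def)
  also have "\<dots> \<le> card A + card B" by (rule card_Un_le)
  also have "card A \<le> 31" by (auto simp: A_def)
  also have "card B \<le> (\<Sum>z\<in>Zs. card {i::nat. \<bar>Im z - (real i - real K)\<bar> < 5})"
    unfolding B_def by (rule card_UN_le[OF fin])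
  also have "\<dots> \<le> (\<Sum>z\<in>Zs. 11)" by (intro sum_mono card_window(2))
  finally have "card {i. i \<le> 2*K \<and> window_zero q K \<psi> i \<sigma>} \<le> 31 + 11 * card Zs" by simp
  then have "real (card {i. i \<le> 2*K \<and> window_zero q K \<psi> i \<sigma>}) \<le> 31 + 11 * real (card Zs)" by linarith
  then show ?thesis using cz by linarith
qed

text \<open>The edge is taken from the grid 1/2 + j \<delta>, so that the density hypothesis is
  applied at finitely many \<sigma> only.\<close>

definition window_edge :: "nat \<Rightarrow> nat \<Rightarrow> real \<Rightarrow> (nat \<Rightarrow> complex) \<Rightarrow> nat \<Rightarrow> real" where
  "window_edge q K \<delta> \<psi> i = 1/2 + real (LEAST j. \<not> window_zero q K \<psi> i (1/2 + real j * \<delta>)) * \<delta>"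

text \<open>The last bound turns edges into counts: if the edge exceeds 1/2, some zero lies to the
  right of the preceding grid point, so Y^(edge + \<delta>) is itself one of the summands. Stepping
  back by one grid point is the reason for 2\<delta> in the exponent.\<close>

lemma window_edge:
  assumes zf: "zero_free a" and q: "q \<ge> 1" and d: "dirichlet_char q \<psi>" and \<delta>: "\<delta> > 0"
    and J: "a \<le> 1/2 + real J * \<delta>" "1/2 + real J * \<delta> \<le> 1"
  shows "1/2 \<le> window_edge q K \<delta> \<psi> i" "window_edge q K \<delta> \<psi> i \<le> 1"
    "z \<in> L_dom q \<psi> \<Longrightarrow> window_edge q K \<delta> \<psi> i < Re z \<Longrightarrow> \<bar>Im z - (real i - real K)\<bar> < 5 \<Longrightarrow> L_fun q \<psi> z \<noteq> 0"
    "Y \<ge> 1 \<Longrightarrow> Y powr (window_edge q K \<delta> \<psi> i + \<delta>) \<le> Y powr (1/2 + \<delta>) +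
       (\<Sum>j<J. if window_zero q K \<psi> i (1/2 + real j * \<delta>) then Y powr (1/2 + real j * \<delta> + 2 * \<delta>) else 0)"
proof -
  define j where "j = (LEAST j. \<not> window_zero q K \<psi> i (1/2 + real j * \<delta>))"
  have nJ: "\<not> window_zero q K \<psi> i (1/2 + real J * \<delta>)"
  proof
    assume "window_zero q K \<psi> i (1/2 + real J * \<delta>)"
    then obtain z where "z \<in> L_dom q \<psi>" "L_fun q \<psi> z = 0" "1/2 + real J * \<delta> < Re z" by (auto simp: window_zero_def)
    then show False using zero_freeD[OF zf q d] J(1) by fastforce
  qed
  have nj: "\<not> window_zero q K \<psi> i (1/2 + real j * \<delta>)" unfolding j_def using nJ by (rule LeastI)
  have jJ: "j \<le> J" unfolding j_def using nJ by (rule Least_le)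
  have e: "window_edge q K \<delta> \<psi> i = 1/2 + real j * \<delta>" by (simp add: window_edge_def j_def)
  show "1/2 \<le> window_edge q K \<delta> \<psi> i" using \<delta> by (simp add: e)
  have "real j * \<delta> \<le> real J * \<delta>" using jJ \<delta> by (intro mult_right_mono) auto
  then show "window_edge q K \<delta> \<psi> i \<le> 1" using J(2) by (simp add: e)
  show "z \<in> L_dom q \<psi> \<Longrightarrow> window_edge q K \<delta> \<psi> i < Re z \<Longrightarrow> \<bar>Im z - (real i - real K)\<bar> < 5 \<Longrightarrow> L_fun q \<psi> z \<noteq> 0"
    using nj unfolding e window_zero_def by blast
  assume Y: "Y \<ge> 1"
  define g where "g = (\<lambda>j. if window_zero q K \<psi> i (1/2 + real j * \<delta>) then Y powr (1/2 + real j * \<delta> + 2 * \<delta>) else 0)"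
  have g0: "g k \<ge> 0" for k by (simp add: g_def)
  show "Y powr (window_edge q K \<delta> \<psi> i + \<delta>) \<le> Y powr (1/2 + \<delta>) +
       (\<Sum>j<J. if window_zero q K \<psi> i (1/2 + real j * \<delta>) then Y powr (1/2 + real j * \<delta> + 2 * \<delta>) else 0)"
  proof (cases j)
    case 0
    then show ?thesis using sum_nonneg[of "{..<J}" g] g0 by (simp add: e g_def)
  next
    case (Suc k)
    have "window_zero q K \<psi> i (1/2 + real k * \<delta>)"
      using not_less_Least[of k "\<lambda>j. \<not> window_zero q K \<psi> i (1/2 + real j * \<delta>)"] Suc by (simp add: j_def)
    then have "Y powr (window_edge q K \<delta> \<psi> i + \<delta>) = g k" by (simp add: e g_def Suc algebra_simps)
    also have "g k \<le> (\<Sum>j<J. g j)" using Suc jJ g0 by (intro member_le_sum) auto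
    finally have "Y powr (window_edge q K \<delta> \<psi> i + \<delta>) \<le> 0 + (\<Sum>j<J. g j)" by simp
    also have "\<dots> \<le> Y powr (1/2 + \<delta>) + (\<Sum>j<J. g j)" by (intro add_right_mono) simp
    finally show ?thesis by (simp only: g_def)
  qed
qed

text \<open>After exchanging the sums, the grid level \<sigma> contributes Y^(\<sigma> + 2\<delta>)
  times the number of windows, over all characters, with a zero beyond \<sigma>. Levels \<sigma>
  \<ge> a contribute nothing by \<open>zero_free\<close>.\<close>

lemma sum_window_edges:
  assumes zf: "zero_free a" and a: "a < 1" and q: "q \<ge> 1" and \<delta>: "\<delta> > 0"
    and J: "a \<le> 1/2 + real J * \<delta>" "1/2 + real J * \<delta> \<le> 1" and Y: "Y \<ge> 1" and B: "B \<ge> 0"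
    and dens: "\<And>\<sigma>. 1/2 \<le> \<sigma> \<Longrightarrow> \<sigma> < a \<Longrightarrow> Y powr (\<sigma> + 2 * \<delta>) * (31 * real q + 11 * (\<Sum>\<psi>\<in>dchars q. N_zeros q \<psi> \<sigma> (real K + 5))) \<le> B"
  shows "(\<Sum>\<psi>\<in>dchars q. \<Sum>i\<le>2*K. Y powr (window_edge q K \<delta> \<psi> i + \<delta>)) \<le> real q * (2 * real K + 1) * Y powr (1/2 + \<delta>) + real J * B"
proof -
  have fin: "finite (dchars q)" by (rule finite_dchars[OF q])
  have cd: "real (card (dchars q)) \<le> real q"
    using card_mono[of "{..<q}" "residue_units q"] card_dchars[OF q] by (auto simp: residue_units_def)
  have "(\<Sum>\<psi>\<in>dchars q. \<Sum>i\<le>2*K. Y powr (window_edge q K \<delta> \<psi> i + \<delta>)) \<le>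
    (\<Sum>\<psi>\<in>dchars q. \<Sum>i\<le>2*K. Y powr (1/2 + \<delta>) +
       (\<Sum>j<J. if window_zero q K \<psi> i (1/2 + real j * \<delta>) then Y powr (1/2 + real j * \<delta> + 2 * \<delta>) else 0))"
    by (intro sum_mono window_edge(4)[OF zf q _ \<delta> J Y]) (simp add: dchars_def)
  also have "\<dots> = real (card (dchars q)) * (2 * real K + 1) * Y powr (1/2 + \<delta>) +
     (\<Sum>\<psi>\<in>dchars q. \<Sum>i\<le>2*K. \<Sum>j<J. if window_zero q K \<psi> i (1/2 + real j * \<delta>) then Y powr (1/2 + real j * \<delta> + 2 * \<delta>) else 0)"
    by (simp add: sum.distrib algebra_simps)
  also have "(\<Sum>\<psi>\<in>dchars q. \<Sum>i\<le>2*K. \<Sum>j<J. if window_zero q K \<psi> i (1/2 + real j * \<delta>) then Y powr (1/2 + real j * \<delta> + 2 * \<delta>) else 0)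
     = (\<Sum>\<psi>\<in>dchars q. \<Sum>j<J. \<Sum>i\<le>2*K. if window_zero q K \<psi> i (1/2 + real j * \<delta>) then Y powr (1/2 + real j * \<delta> + 2 * \<delta>) else 0)"
    by (intro sum.cong refl sum.swap)
  also have "\<dots> = (\<Sum>j<J. \<Sum>\<psi>\<in>dchars q. \<Sum>i\<le>2*K. if window_zero q K \<psi> i (1/2 + real j * \<delta>) then Y powr (1/2 + real j * \<delta> + 2 * \<delta>) else 0)"
    by (rule sum.swap)
  also have "\<dots> \<le> (\<Sum>j<J. B)"
  proof (rule sum_mono)
    fix j assume "j \<in> {..<J}"
    define \<sigma> where "\<sigma> = 1/2 + real j * \<delta>"
    have \<sigma>: "1/2 \<le> \<sigma>" using \<delta> by (simp add: \<sigma>_def)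
    show "(\<Sum>\<psi>\<in>dchars q. \<Sum>i\<le>2*K. if window_zero q K \<psi> i (1/2 + real j * \<delta>) then Y powr (1/2 + real j * \<delta> + 2 * \<delta>) else 0) \<le> B"
      unfolding \<sigma>_def[symmetric]
    proof (cases "\<sigma> < a")
      case True
      have "(\<Sum>\<psi>\<in>dchars q. \<Sum>i\<le>2*K. if window_zero q K \<psi> i \<sigma> then Y powr (\<sigma> + 2 * \<delta>) else 0)
          = (\<Sum>\<psi>\<in>dchars q. real (card {i. i \<le> 2*K \<and> window_zero q K \<psi> i \<sigma>}) * Y powr (\<sigma> + 2 * \<delta>))"
        by (intro sum.cong refl) (simp add: sum.If_cases Int_def)
      also have "\<dots> \<le> (\<Sum>\<psi>\<in>dchars q. (31 + 11 * N_zeros q \<psi> \<sigma> (real K + 5)) * Y powr (\<sigma> + 2 * \<delta>))"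
        using \<sigma> by (intro sum_mono mult_right_mono card_window_zeros[OF zf a q]) (auto simp: dchars_def)
      also have "\<dots> = Y powr (\<sigma> + 2 * \<delta>) * (31 * real (card (dchars q)) + 11 * (\<Sum>\<psi>\<in>dchars q. N_zeros q \<psi> \<sigma> (real K + 5)))"
        by (simp add: sum.distrib sum_distrib_left sum_distrib_right algebra_simps)
      also have "\<dots> \<le> Y powr (\<sigma> + 2 * \<delta>) * (31 * real q + 11 * (\<Sum>\<psi>\<in>dchars q. N_zeros q \<psi> \<sigma> (real K + 5)))"
        using cd by (intro mult_left_mono) auto
      also have "\<dots> \<le> B" by (rule dens[OF \<sigma> True])
      finally show "(\<Sum>\<psi>\<in>dchars q. \<Sum>i\<le>2*K. if window_zero q K \<psi> i \<sigma> then Y powr (\<sigma> + 2 * \<delta>) else 0) \<le> B" .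
    next
      case False
      have "\<not> window_zero q K \<psi> i \<sigma>" if "\<psi> \<in> dchars q" for \<psi> i
      proof
        assume "window_zero q K \<psi> i \<sigma>"
        then obtain z where "z \<in> L_dom q \<psi>" "L_fun q \<psi> z = 0" "\<sigma> < Re z" by (auto simp: window_zero_def)
        then show False using zero_freeD[OF zf q, of \<psi> z] that False by (simp add: dchars_def)
      qed
      then show "(\<Sum>\<psi>\<in>dchars q. \<Sum>i\<le>2*K. if window_zero q K \<psi> i \<sigma> then Y powr (\<sigma> + 2 * \<delta>) else 0) \<le> B"
        using B by simp
    qed
  qed
  also have "\<dots> = real J * B" by simp
  also have "real (card (dchars q)) * (2 * real K + 1) * Y powr (1/2 + \<delta>) \<le> real q * (2 * real K + 1) * Y powr (1/2 + \<delta>)"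
    using cd by (intro mult_right_mono) auto
  finally show ?thesis by simp
qed

section \<open>Estimates with real powers\<close>

lemma powr_bound:
  fixes x y c p u :: real
  assumes "0 \<le> y" "y \<le> c * x powr p" "1 \<le> c" "0 \<le> u" "u \<le> 2" "1 \<le> x"
  shows "y powr u \<le> c\<^sup>2 * x powr (p * u)"
proof -
  have "y powr u \<le> (c * x powr p) powr u" using assms by (intro powr_mono2) auto
  also have "\<dots> = c powr u * x powr (p * u)" using assms by (simp add: powr_mult powr_powr)
  also have "\<dots> \<le> c powr 2 * x powr (p * u)" using assms by (intro mult_right_mono powr_mono) auto
  also have "c powr 2 = c\<^sup>2" using assms by (simp add: powr_numeral)
  finally show ?thesis .
qed

text \<open>The power 7 dominates every power of x that accompanies exp(-K/T) in
  \<open>sum_mu_exp_bound\<close>.\<close>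

lemma powr_times_exp_bounded:
  fixes \<delta> :: real
  assumes "\<delta> > 0"
  obtains M where "M > 0" "\<And>x. x \<ge> 1 \<Longrightarrow> x ^ 7 * exp (- (x powr \<delta>)) \<le> M"
proof -
  define n where "n = nat \<lceil>7 / \<delta>\<rceil>"
  have n: "7 / \<delta> \<le> real n" unfolding n_def by linarith
  show ?thesis
  proof (rule that)
    show "(fact n :: real) > 0" by simp
    fix x :: real assume x: "x \<ge> 1"
    define y where "y = x powr \<delta>"
    have y: "y \<ge> 1" using x assms by (simp add: y_def ge_one_powr_ge_zero)
    have "x ^ 7 = x powr 7" using x by (simp add: powr_numeral)
    also have "\<dots> = y powr (7 / \<delta>)" using assms by (simp add: y_def powr_powr)
    also have "\<dots> \<le> y powr real n" using y n by (intro powr_mono) auto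
    also have "\<dots> = y ^ n" using y by (simp add: powr_realpow)
    also have "\<dots> \<le> fact n * exp y"
    proof -
      have "y ^ n / fact n \<le> (\<Sum>k. y ^ k / fact k)"
        using y summable_exp[of y] by (intro sum_le_suminf[of _ "{n}", simplified]) (auto simp: divide_inverse mult.commute)
      also have "\<dots> = exp y" by (simp add: exp_def divide_inverse mult.commute)
      finally show ?thesis by (simp add: field_simps)
    qed
    finally show "x ^ 7 * exp (- (x powr \<delta>)) \<le> fact n"
      by (simp add: y_def exp_minus field_simps)
  qed
qed

lemma powr_mult_le:
  fixes x :: real
  assumes "u \<le> c * x powr p" "v \<le> c' * x powr p'" "0 \<le> u" "0 \<le> v" "0 \<le> c" "1 \<le> x" "p + p' \<le> e" "0 \<le> c'"
  shows "u * v \<le> (c * c') * x powr e"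
proof -
  have "u * v \<le> (c * x powr p) * (c' * x powr p')" using assms by (intro mult_mono) auto
  also have "\<dots> = (c * c') * x powr (p + p')" by (simp add: powr_add)
  also have "\<dots> \<le> (c * c') * x powr e" using assms by (intro mult_left_mono powr_mono) auto
  finally show ?thesis .
qed

text \<open>The exponent \<open>V\<^sup>3\<^sup>/\<^sup>2\<^sup>-\<^sup>2\<^sup>\<sigma> x\<^sup>\<sigma>\<close>
  coming from the density hypothesis is monotone in \<open>\<sigma>\<close> after inserting \<open>V \<le> x\<^sup>a\<close>, because
  \<open>(1 + a)/2 - (a(3/2 - 2\<sigma>) + \<sigma>) = (2a - 1)(\<sigma> - 1/2) \<ge> 0\<close>.\<close>
lemma density_exponent:
  fixes a \<delta> \<sigma> x V Y :: real
  assumes a: "1/2 \<le> a" "a < 1" and \<delta>: "0 < \<delta>" "\<delta> \<le> 1/2" and \<sigma>: "1/2 \<le> \<sigma>" "\<sigma> \<le> a" and x: "1 \<le> x"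
    and V: "1 \<le> V" "V \<le> c * x powr (a + \<delta>)" and Y: "1 \<le> Y" "Y \<le> c * x powr (1 + \<delta>)" and c: "c \<ge> 1"
  shows "V powr (3/2 - 2 * \<sigma>) * Y powr (\<sigma> + 2 * \<delta>) \<le> c ^ 4 * x powr ((1 + a) / 2 + 5 * \<delta>)"
proof -
  have Yb: "Y powr (\<sigma> + 2 * \<delta>) \<le> c\<^sup>2 * x powr ((1 + \<delta>) * (\<sigma> + 2 * \<delta>))"
    using Y c \<sigma> a \<delta> x by (intro powr_bound) auto
  have d1: "\<delta> * \<sigma> \<le> \<delta>" "\<delta> * \<delta> \<le> \<delta> / 2"
    using mult_left_mono[of \<sigma> 1 \<delta>] mult_left_mono[of \<delta> "1/2" \<delta>] \<delta> \<sigma> a by auto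
  have u: "(1 + \<delta>) * (\<sigma> + 2 * \<delta>) = \<sigma> + 2 * \<delta> + \<delta> * \<sigma> + 2 * (\<delta> * \<delta>)" by (simp add: algebra_simps)
  show ?thesis
  \<comment> \<open>Beyond 3/4 the exponent of \<open>V\<close> is negative, and V \<ge> 1
    suffices.\<close>
  proof (cases "\<sigma> \<le> 3/4")
    case True
    have Vb: "V powr (3/2 - 2 * \<sigma>) \<le> c\<^sup>2 * x powr ((a + \<delta>) * (3/2 - 2 * \<sigma>))"
      using V c True \<sigma> x by (intro powr_bound) auto
    have "0 \<le> (2 * a - 1) * (\<sigma> - 1/2)" using a \<sigma> by (intro mult_nonneg_nonneg) auto
    also have "(2 * a - 1) * (\<sigma> - 1/2) = 2 * (a * \<sigma>) - a - \<sigma> + 1/2" by (simp add: algebra_simps)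
    finally have p: "0 \<le> 2 * (a * \<sigma>) - a - \<sigma> + 1/2" .
    have p2: "(a + \<delta>) * (3/2 - 2 * \<sigma>) = 3/2 * a - 2 * (a * \<sigma>) + 3/2 * \<delta> - 2 * (\<delta> * \<sigma>)" by (simp add: algebra_simps)
    have p3: "\<delta> / 2 \<le> \<delta> * \<sigma>" using mult_left_mono[of "1/2" \<sigma> \<delta>] \<delta> \<sigma> by auto
    have "(a + \<delta>) * (3/2 - 2 * \<sigma>) + (1 + \<delta>) * (\<sigma> + 2 * \<delta>) \<le> (1 + a) / 2 + 5 * \<delta>"
      unfolding p2 u add_divide_distrib using p p3 d1 \<delta> by linarith
    then have "V powr (3/2 - 2 * \<sigma>) * Y powr (\<sigma> + 2 * \<delta>) \<le> (c\<^sup>2 * c\<^sup>2) * x powr ((1 + a) / 2 + 5 * \<delta>)"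
      using c x by (intro powr_mult_le[OF Vb Yb]) auto
    then show ?thesis by (simp add: power_numeral_reduce power2_eq_square mult_ac)
  next
    case False
    have Vb: "V powr (3/2 - 2 * \<sigma>) \<le> 1 * x powr 0"
      using V False x powr_mono[of "3/2 - 2 * \<sigma>" 0 V] by simp
    have "0 + (1 + \<delta>) * (\<sigma> + 2 * \<delta>) \<le> (1 + a) / 2 + 5 * \<delta>" unfolding u add_divide_distrib diff_divide_distrib using d1 \<sigma> a \<delta> by linarith
    then have "V powr (3/2 - 2 * \<sigma>) * Y powr (\<sigma> + 2 * \<delta>) \<le> (1 * c\<^sup>2) * x powr ((1 + a) / 2 + 5 * \<delta>)"
      using c x by (intro powr_mult_le[OF Vb Yb]) auto
    also have "\<dots> \<le> c ^ 4 * x powr ((1 + a) / 2 + 5 * \<delta>)"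
      using c by (intro mult_right_mono) (auto intro: power_increasing)
    finally show ?thesis .
  qed
qed

text \<open>The height K is about T x^\<delta>, just enough for exp(-K/T) to beat every power of x.
  Then V = q (K + 5) is O(x^(a + \<delta>)) and Y = (K + 2)/|w| is O(x^(1 + \<delta>)). The losses
  in the window sums are collected in \<open>Q\<close> with exponent 8\<delta>; the factor
  V^\<delta> from the bound for 1/L adds 2\<delta>, which gives the requirement 10\<delta> \<le>
  \<epsilon>.\<close>

lemma sum_mu_exp_bound:
  fixes a \<epsilon> :: real
  assumes a: "1/2 \<le> a" "a < 1" and zf: "zero_free a" and \<epsilon>: "\<epsilon> > 0"
    and density: "\<forall>\<epsilon>>0. \<exists>C. \<forall>l\<ge>1. \<forall>T\<ge>10. \<forall>\<sigma>. 1/2 \<le> \<sigma> \<and> \<sigma> \<le> 1 \<longrightarrow>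
           \<bar>\<Sum>\<psi>\<in>dchars l. N_zeros l \<psi> \<sigma> T\<bar> \<le> C * (real l * T) powr (2 - 2 * \<sigma> + \<epsilon>)"
  obtains C where "C > 0"
    "\<And>x q d w. 2 \<le> x \<Longrightarrow> q \<ge> 1 \<Longrightarrow> d \<ge> 1 \<Longrightarrow> Re w = 1 / x \<Longrightarrow> real q \<le> x powr (1 - a) \<Longrightarrow>
       real q * (norm w * x) \<le> 16 * x powr a \<Longrightarrow>
       (\<Sum>\<psi>\<in>dchars q. norm (mu_exp \<psi> (of_nat d * w))) \<le> C * real d powr (-1/2) * sqrt (real q) * x powr ((1 + a) / 2 + \<epsilon>)"
proof -
  \<comment> \<open>The bound 1 - a keeps the last grid point 1/2 + J\<delta> at most 1, where
    \<open>J\<close> is the number of grid steps needed to reach \<open>a\<close>.\<close>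
  define \<delta> where "\<delta> = min (\<epsilon> / 10) (min (1 - a) (1/2))"
  have \<delta>: "0 < \<delta>" "\<delta> \<le> 1/2" "\<delta> \<le> 1 - a" "10 * \<delta> \<le> \<epsilon>" using a \<epsilon> by (auto simp: \<delta>_def min_def)
  define J where "J = nat \<lceil>(a - 1/2) / \<delta>\<rceil>"
  have J: "a \<le> 1/2 + real J * \<delta>" "1/2 + real J * \<delta> \<le> 1"
  proof -
    have "(a - 1/2) / \<delta> \<le> real J" unfolding J_def by linarith
    then show "a \<le> 1/2 + real J * \<delta>" using \<delta>(1) by (simp add: field_simps)
    have "0 \<le> (a - 1/2) / \<delta>" using a \<delta>(1) by simp
    then have "real J \<le> (a - 1/2) / \<delta> + 1" unfolding J_def by linarith
    then have "real J * \<delta> \<le> ((a - 1/2) / \<delta> + 1) * \<delta>" using \<delta>(1) by (intro mult_right_mono) auto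
    also have "((a - 1/2) / \<delta> + 1) * \<delta> = a - 1/2 + \<delta>" using \<delta>(1) by (simp add: field_simps)
    finally show "1/2 + real J * \<delta> \<le> 1" using \<delta> by linarith
  qed
  obtain C1 where C1: "C1 > 0"
    "\<And>q \<psi> w (K::nat) A W T \<tau>. q \<ge> 1 \<Longrightarrow> dirichlet_char q \<psi> \<Longrightarrow> Re w > 0 \<Longrightarrow> T = norm w / Re w \<Longrightarrow> A \<ge> 0 \<Longrightarrow> 0 < W \<Longrightarrow> W \<le> real K + 2 \<Longrightarrow>
      (\<And>s. 1/2 \<le> Re s \<Longrightarrow> Re s \<le> 3/2 \<Longrightarrow> norm (Gamma s * exp (- s * Ln w)) \<le>
         A * (1 + \<bar>Im s\<bar>) powr (Re s - 1/2) * W powr (- Re s) * exp (- \<bar>Im s\<bar> / T)) \<Longrightarrow>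
      (\<And>i. i \<le> 2*K \<Longrightarrow> 1/2 \<le> \<tau> i \<and> \<tau> i \<le> 1) \<Longrightarrow>
      (\<And>i z. i \<le> 2*K \<Longrightarrow> z \<in> L_dom q \<psi> \<Longrightarrow> \<tau> i < Re z \<Longrightarrow> \<bar>Im z - (real i - real K)\<bar> < 5 \<Longrightarrow> L_fun q \<psi> z \<noteq> 0) \<Longrightarrow>
      norm (mu_exp \<psi> w) \<le> C1 * A * (real q * (real K + 3)) powr \<delta> * ((real K + 2) powr (-1/2) * (\<Sum>i\<le>2*K. ((real K + 2) / W) powr (\<tau> i + \<delta>))
         + (real K + 1) * (W powr (-1/2) + W powr (-3/2)) * exp (- real K / T))
         + C1 * norm w powr (-3/2) * ((T * (1 + real K) + T\<^sup>2) * exp (- real K / T))"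
    using mu_exp_bound[OF \<delta>(1,2,1)] by metis
  obtain C2' where C2': "\<forall>l\<ge>1. \<forall>T\<ge>10. \<forall>\<sigma>. 1/2 \<le> \<sigma> \<and> \<sigma> \<le> 1 \<longrightarrow>
           \<bar>\<Sum>\<psi>\<in>dchars l. N_zeros l \<psi> \<sigma> T\<bar> \<le> C2' * (real l * T) powr (2 - 2 * \<sigma> + \<delta>)"
    using density \<delta>(1) by blast
  define C2 where "C2 = max C2' 0"
  obtain M where M: "M > 0" "\<And>x. x \<ge> 1 \<Longrightarrow> x ^ 7 * exp (- (x powr \<delta>)) \<le> M"
    using powr_times_exp_bounded[OF \<delta>(1)] by blast
  \<comment> \<open>176 = 11 * 16, where K + 5 \<le> 11 T X and 16 is the constant in the hypothesis
    on q |w| x.\<close>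
  define c where "c = (176::real)"
  have c: "c \<ge> 1" "c > 0" by (simp_all add: c_def)
  define G where "G = 31 * c\<^sup>2 + 22 * C2 * c ^ 6"
  have C20: "C2 \<ge> 0" by (simp add: C2_def)
  have G0: "G \<ge> 0" using C20 c by (simp add: G_def)
  define B0 where "B0 = 6 * exp (9/4::real)"
  define CC where "CC = C1 * B0 * c\<^sup>2 * (2 * c ^ 4 + real J * G + 2 * c * M) + C1 * (2 * c\<^sup>2) * M"
  show ?thesis
  proof (rule that)
    show "CC > 0" using C1(1) M(1) c G0 by (simp add: CC_def B0_def add_nonneg_pos)
    fix x :: real and q d :: nat and w :: complex
    assume x2: "2 \<le> x" and q: "q \<ge> 1" and d: "d \<ge> 1" and w: "Re w = 1 / x" and qx: "real q \<le> x powr (1 - a)"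
      and qw: "real q * (norm w * x) \<le> 16 * x powr a"
    have x: "1 \<le> x" "0 < x" using x2 by auto
    define W where "W = norm w"
    define T where "T = W * x"
    have W: "1 / x \<le> W" "0 < W" using complex_Re_le_cmod[of w] w x by (auto simp: W_def intro: less_le_trans[of 0 "1 / x"])
    have T1: "1 \<le> T" using W(1) x by (simp add: T_def field_simps)
    define X where "X = x powr \<delta>"
    have X1: "1 \<le> X" using x \<delta> by (simp add: X_def ge_one_powr_ge_zero)
    define K where "K = nat \<lceil>T * X\<rceil> + 4"
    have TX: "1 \<le> T * X" "T \<le> T * X" using mult_mono[of 1 T 1 X] mult_left_mono[of 1 X T] T1 X1 by auto
    have K: "T * X + 4 \<le> real K" "real K \<le> T * X + 5" unfolding K_def using TX(1) by linarith+
    have KT: "T \<le> real K" using K TX by linarith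
    define V where "V = real q * (real K + 5)"
    have q1: "1 \<le> real q" using q by simp
    have V1: "real K + 5 \<le> V" using mult_right_mono[OF q1, of "real K + 5"] by (simp add: V_def)
    have V: "1 \<le> V" "V \<le> c * x powr (a + \<delta>)"
    proof -
      show "1 \<le> V" using V1 by linarith
      have "V \<le> real q * (11 * (T * X))" unfolding V_def using K TX by (intro mult_left_mono) auto
      also have "\<dots> = 11 * (real q * (norm w * x)) * X" by (simp add: T_def W_def mult_ac)
      also have "\<dots> \<le> 11 * (16 * x powr a) * X" using qw X1 by (intro mult_right_mono mult_left_mono) auto
      also have "\<dots> = c * x powr (a + \<delta>)" by (simp add: c_def X_def powr_add)
      finally show "V \<le> c * x powr (a + \<delta>)" .
    qed
    define Y where "Y = (real K + 2) / W"
    have Y: "1 \<le> Y" "Y \<le> c * x powr (1 + \<delta>)" "W \<le> real K + 2"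
    proof -
      have "T * X \<le> real K + 2" using K by linarith
      then have "W * (x * X) \<le> real K + 2" by (simp add: T_def mult_ac)
      moreover have "1 \<le> x * X" using mult_mono[of 1 x 1 X] x X1 by auto
      then have "W * 1 \<le> W * (x * X)" using W by (intro mult_left_mono) auto
      ultimately show "W \<le> real K + 2" by linarith
      then show "1 \<le> Y" using W by (simp add: Y_def)
      have "real K + 2 \<le> 8 * (T * X)" using K TX by linarith
      then have "Y \<le> 8 * (T * X) / W" unfolding Y_def using W by (intro divide_right_mono) auto
      also have "\<dots> = 8 * x powr (1 + \<delta>)" using W x by (simp add: T_def X_def powr_add)
      also have "\<dots> \<le> c * x powr (1 + \<delta>)" by (intro mult_right_mono) (auto simp: c_def)
      finally show "Y \<le> c * x powr (1 + \<delta>)" .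
    qed
    define s where "s = sqrt (real q)"
    have s: "1 \<le> s" "s * s = real q" using q1 by (auto simp: s_def)
    have sx: "s \<le> 1 * x powr ((1 - a) / 2)"
    proof -
      have "s \<le> sqrt (x powr (1 - a))" unfolding s_def using qx by (rule real_sqrt_le_mono)
      also have "\<dots> = x powr ((1 - a) / 2)" using x by (simp add: powr_half_sqrt[symmetric] powr_powr)
      finally show ?thesis by simp
    qed
    define Q where "Q = x powr ((1 + a) / 2 + 8 * \<delta>)"
    have Q1: "1 \<le> Q" unfolding Q_def using x a \<delta> by (intro ge_one_powr_ge_zero) auto
    have sQ: "1 \<le> s * Q" using mult_mono[of 1 s 1 Q] s Q1 by auto
    define K2 where "K2 = (real K + 2) powr (1/2)"
    have K2: "1 \<le> K2" unfolding K2_def by (intro ge_one_powr_ge_zero) auto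
    have V\<delta>: "V powr \<delta> \<le> c\<^sup>2 * x powr (2 * \<delta>)"
    proof -
      have "V powr \<delta> \<le> c\<^sup>2 * x powr ((a + \<delta>) * \<delta>)" using V c \<delta> x by (intro powr_bound) auto
      also have "\<dots> \<le> c\<^sup>2 * x powr (2 * \<delta>)" using x a \<delta> by (intro mult_left_mono powr_mono mult_right_mono) auto
      finally show ?thesis .
    qed
    \<comment> \<open>Two contributions. The windows near the real axis give 31 q, for which only
      \<sigma> < a and sqrt(q) \<le> x^((1 - a)/2) are available; the density term is treated by
      splitting off V^(1/2).\<close>
    have dens: "Y powr (\<sigma> + 2 * \<delta>) * (31 * real q + 11 * (\<Sum>\<psi>\<in>dchars q. N_zeros q \<psi> \<sigma> (real K + 5))) \<le> K2 * (G * s * Q)"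
      if \<sigma>: "1/2 \<le> \<sigma>" "\<sigma> < a" for \<sigma>
    proof -
      have d1: "\<delta> * \<sigma> \<le> \<delta>" "\<delta> * \<delta> \<le> \<delta> / 2"
    using mult_left_mono[of \<sigma> 1 \<delta>] mult_left_mono[of \<delta> "1/2" \<delta>] \<delta> \<sigma> a by auto
      have Yb: "Y powr (\<sigma> + 2 * \<delta>) \<le> c\<^sup>2 * x powr ((1 + \<delta>) * (\<sigma> + 2 * \<delta>))"
        using Y c \<sigma> a \<delta> x by (intro powr_bound) auto
      have u: "(1 + \<delta>) * (\<sigma> + 2 * \<delta>) = \<sigma> + 2 * \<delta> + \<delta> * \<sigma> + 2 * (\<delta> * \<delta>)" by (simp add: algebra_simps)
      have "(1 - a) / 2 + (1 + \<delta>) * (\<sigma> + 2 * \<delta>) \<le> (1 + a) / 2 + 8 * \<delta>"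
        unfolding u add_divide_distrib diff_divide_distrib using d1 \<sigma> \<delta> by linarith
      then have "s * Y powr (\<sigma> + 2 * \<delta>) \<le> (1 * c\<^sup>2) * x powr ((1 + a) / 2 + 8 * \<delta>)"
        using s c x by (intro powr_mult_le[OF sx Yb]) auto
      then have "31 * s * (s * Y powr (\<sigma> + 2 * \<delta>)) \<le> 31 * s * (c\<^sup>2 * Q)" using s by (intro mult_left_mono) (auto simp: Q_def)
      then have t1: "Y powr (\<sigma> + 2 * \<delta>) * (31 * real q) \<le> 31 * c\<^sup>2 * s * Q" by (simp add: s(2)[symmetric] mult_ac)
      have N: "(\<Sum>\<psi>\<in>dchars q. N_zeros q \<psi> \<sigma> (real K + 5)) \<le> C2 * V powr (2 - 2 * \<sigma> + \<delta>)"
      proof -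
        have "\<bar>\<Sum>\<psi>\<in>dchars q. N_zeros q \<psi> \<sigma> (real K + 5)\<bar> \<le> C2' * (real q * (real K + 5)) powr (2 - 2 * \<sigma> + \<delta>)"
          using C2' q \<sigma> a K TX by auto
        also have "\<dots> \<le> C2 * V powr (2 - 2 * \<sigma> + \<delta>)" unfolding V_def C2_def by (intro mult_right_mono) auto
        finally show ?thesis by linarith
      qed
      \<comment> \<open>This half power is covered by the prefactor (K + 2)^(-1/2) and the permitted
        loss sqrt(q). What remains has the exponent 3/2 - 2\<sigma> of
        \<open>density_exponent\<close>, up to V^\<delta>.\<close>
      have V12: "V powr (1/2) \<le> s * (2 * K2)"
      proof -
        have "V powr (1/2) = s * (real K + 5) powr (1/2)" by (simp add: V_def powr_mult s_def powr_half_sqrt)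
        also have "(real K + 5) powr (1/2) \<le> (4 * (real K + 2)) powr (1/2)" by (intro powr_mono2) auto
        also have "(4 * (real K + 2)) powr (1/2) = 2 * K2"
          by (subst powr_mult) (simp_all add: K2_def powr_half_sqrt)
        finally show ?thesis using s by (simp add: mult_left_mono)
      qed
      have ex: "V powr (3/2 - 2 * \<sigma>) * Y powr (\<sigma> + 2 * \<delta>) \<le> c ^ 4 * x powr ((1 + a) / 2 + 5 * \<delta>)"
        using \<sigma> by (intro density_exponent a \<delta>(1,2) x V Y c) auto
      have "V powr \<delta> * (V powr (3/2 - 2 * \<sigma>) * Y powr (\<sigma> + 2 * \<delta>)) \<le> (c\<^sup>2 * c ^ 4) * x powr ((1 + a) / 2 + 8 * \<delta>)"
        using c x \<delta> by (intro powr_mult_le[OF V\<delta> ex]) auto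
      also have "c\<^sup>2 * c ^ 4 = c ^ 6" by (simp flip: power_add)
      finally have ex2: "V powr \<delta> * (V powr (3/2 - 2 * \<sigma>) * Y powr (\<sigma> + 2 * \<delta>)) \<le> c ^ 6 * Q" by (simp add: Q_def)
      have e: "2 - 2 * \<sigma> + \<delta> = 1/2 + (\<delta> + (3/2 - 2 * \<sigma>))" by simp
      have "V powr (2 - 2 * \<sigma> + \<delta>) = V powr (1/2) * (V powr \<delta> * V powr (3/2 - 2 * \<sigma>))"
        unfolding e by (simp only: powr_add)
      then have "Y powr (\<sigma> + 2 * \<delta>) * V powr (2 - 2 * \<sigma> + \<delta>) = V powr (1/2) * (V powr \<delta> * (V powr (3/2 - 2 * \<sigma>) * Y powr (\<sigma> + 2 * \<delta>)))"
        by (simp add: mult_ac)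
      also have "\<dots> \<le> (s * (2 * K2)) * (c ^ 6 * Q)"
        by (rule mult_mono[OF V12 ex2]) (use s K2 in auto)
      finally have t2: "Y powr (\<sigma> + 2 * \<delta>) * V powr (2 - 2 * \<sigma> + \<delta>) \<le> (s * (2 * K2)) * (c ^ 6 * Q)" .
      have "Y powr (\<sigma> + 2 * \<delta>) * (31 * real q + 11 * (\<Sum>\<psi>\<in>dchars q. N_zeros q \<psi> \<sigma> (real K + 5)))
          \<le> Y powr (\<sigma> + 2 * \<delta>) * (31 * real q + 11 * (C2 * V powr (2 - 2 * \<sigma> + \<delta>)))"
        using N by (intro mult_left_mono) auto
      also have "\<dots> = Y powr (\<sigma> + 2 * \<delta>) * (31 * real q) + 11 * C2 * (Y powr (\<sigma> + 2 * \<delta>) * V powr (2 - 2 * \<sigma> + \<delta>))"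
        by (simp add: algebra_simps)
      also have "\<dots> \<le> K2 * (31 * c\<^sup>2 * s * Q) + 11 * C2 * ((s * (2 * K2)) * (c ^ 6 * Q))"
      proof (intro add_mono mult_left_mono t2)
        have "1 * (31 * c\<^sup>2 * s * Q) \<le> K2 * (31 * c\<^sup>2 * s * Q)"
          using K2 s Q1 by (intro mult_right_mono) auto
        then show "Y powr (\<sigma> + 2 * \<delta>) * (31 * real q) \<le> K2 * (31 * c\<^sup>2 * s * Q)" using t1 by linarith
      qed (use C20 in auto)
      also have "\<dots> = K2 * (G * s * Q)" by (simp add: G_def algebra_simps)
      finally show ?thesis .
    qed
    have cd: "real (card (dchars q)) \<le> real q"
      using card_mono[of "{..<q}" "residue_units q"] card_dchars[OF q] by (auto simp: residue_units_def)
    have sum1: "(real K + 2) powr (-1/2) * (\<Sum>\<psi>\<in>dchars q. \<Sum>i\<le>2*K. Y powr (window_edge q K \<delta> \<psi> i + \<delta>)) \<le> (2 * c ^ 4 + real J * G) * (s * Q)"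
    proof -
      have "(\<Sum>\<psi>\<in>dchars q. \<Sum>i\<le>2*K. Y powr (window_edge q K \<delta> \<psi> i + \<delta>)) \<le> real q * (2 * real K + 1) * Y powr (1/2 + \<delta>) + real J * (K2 * (G * s * Q))"
        using K2 G0 s Q1 by (intro sum_window_edges[OF zf a(2) q \<delta>(1) J Y(1) _ dens]) auto
      \<comment> \<open>All windows of all characters pay the base level 1/2. After removing sqrt(q)
        and (K + 2)^(1/2) this is essentially (V Y)^(1/2), whence the exponent (1 + a)/2.\<close>
      also have "real q * (2 * real K + 1) * Y powr (1/2 + \<delta>) \<le> K2 * (2 * c ^ 4 * (s * Q))"
      proof -
        have kk: "real K + 2 = K2 * K2" by (simp add: K2_def flip: powr_add)
        have "s * K2 \<le> V powr (1/2)"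
        proof -
          have "s * K2 = (real q * (real K + 2)) powr (1/2)" by (simp add: s_def K2_def powr_mult powr_half_sqrt)
          also have "\<dots> \<le> V powr (1/2)" unfolding V_def by (intro powr_mono2 mult_left_mono) auto
          finally show ?thesis .
        qed
        also have "\<dots> \<le> c\<^sup>2 * x powr ((a + \<delta>) * (1/2))" using V c x by (intro powr_bound) auto
        finally have k1: "s * K2 \<le> c\<^sup>2 * x powr ((a + \<delta>) * (1/2))" .
        have k2: "Y powr (1/2 + \<delta>) \<le> c\<^sup>2 * x powr ((1 + \<delta>) * (1/2 + \<delta>))"
          using Y c \<delta> x by (intro powr_bound) auto
        have "\<delta> * \<delta> \<le> \<delta> / 2" using mult_left_mono[of \<delta> "1/2" \<delta>] \<delta> by auto
        moreover have "(1 + \<delta>) * (1/2 + \<delta>) = 1/2 + 3/2 * \<delta> + \<delta> * \<delta>"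
          by (simp add: algebra_simps add_divide_distrib)
        moreover have "(a + \<delta>) * (1/2) = a / 2 + \<delta> / 2" by (simp add: algebra_simps)
        ultimately have "(a + \<delta>) * (1/2) + (1 + \<delta>) * (1/2 + \<delta>) \<le> (1 + a) / 2 + 8 * \<delta>"
          unfolding add_divide_distrib using \<delta> by linarith
        then have "(s * K2) * Y powr (1/2 + \<delta>) \<le> (c\<^sup>2 * c\<^sup>2) * x powr ((1 + a) / 2 + 8 * \<delta>)"
          using s K2 c x by (intro powr_mult_le[OF k1 k2]) auto
        also have "c\<^sup>2 * c\<^sup>2 = c ^ 4" by (simp flip: power_add)
        finally have "(s * K2) * Y powr (1/2 + \<delta>) \<le> c ^ 4 * Q" by (simp add: Q_def)
        then have m: "(2 * s * K2) * ((s * K2) * Y powr (1/2 + \<delta>)) \<le> (2 * s * K2) * (c ^ 4 * Q)"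
          using s K2 by (intro mult_left_mono) auto
        have "real q * (2 * real K + 1) * Y powr (1/2 + \<delta>) \<le> real q * (2 * (real K + 2)) * Y powr (1/2 + \<delta>)"
          by (intro mult_right_mono mult_left_mono) auto
        also have "\<dots> = (2 * s * K2) * ((s * K2) * Y powr (1/2 + \<delta>))" unfolding kk s(2)[symmetric] by (simp add: mult_ac)
        also note m
        finally show ?thesis by (simp add: mult_ac)
      qed
      finally have "(\<Sum>\<psi>\<in>dchars q. \<Sum>i\<le>2*K. Y powr (window_edge q K \<delta> \<psi> i + \<delta>)) \<le> K2 * ((2 * c ^ 4 + real J * G) * (s * Q))"
        by (simp add: algebra_simps)
      then have "(real K + 2) powr (-1/2) * (\<Sum>\<psi>\<in>dchars q. \<Sum>i\<le>2*K. Y powr (window_edge q K \<delta> \<psi> i + \<delta>)) \<le>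
         (real K + 2) powr (-1/2) * (K2 * ((2 * c ^ 4 + real J * G) * (s * Q)))"
        by (intro mult_left_mono) auto
      also have "\<dots> = ((real K + 2) powr (-1/2) * K2) * ((2 * c ^ 4 + real J * G) * (s * Q))" by (simp only: mult.assoc)
      also have "(real K + 2) powr (-1/2) * K2 = 1" unfolding K2_def by (simp flip: powr_add)
      finally show ?thesis by simp
    qed
    \<comment> \<open>The truncation errors are bounded crudely by powers of x; since K/T \<ge>
      x^\<delta>, this factor makes them negligible.\<close>
    define ex where "ex = exp (- real K / T)"
    have ex: "0 \<le> ex" "x ^ 7 * ex \<le> M"
    proof -
      have "X \<le> real K / T" using K T1 by (simp add: field_simps)
      then have "ex \<le> exp (- X)" by (simp add: ex_def)
      then have "x ^ 7 * ex \<le> x ^ 7 * exp (- X)" using x by (intro mult_left_mono) auto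
      then show "x ^ 7 * ex \<le> M" using M(2)[OF x(1)] by (simp add: X_def)
    qed (simp add: ex_def)
    have Wp: "W powr (- u) \<le> x\<^sup>2" if "0 \<le> u" "u \<le> 2" for u
    proof -
      have "W powr (- u) \<le> (1 / x) powr (- u)" using W x that by (intro powr_mono2') auto
      also have "\<dots> = x powr u" using x by (simp add: powr_minus powr_divide)
      also have "\<dots> \<le> x powr 2" using x that by (intro powr_mono) auto
      finally show ?thesis using x by (simp add: powr_numeral)
    qed
    have Vx: "V \<le> c * x\<^sup>2"
    proof -
      have "x powr (a + \<delta>) \<le> x powr 2" using x a \<delta> by (intro powr_mono) auto
      then have "c * x powr (a + \<delta>) \<le> c * x\<^sup>2" using x c by (simp add: powr_numeral)
      then show ?thesis using V(2) by linarith
    qed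
    have x47: "x ^ 4 \<le> x ^ 7" "x ^ 6 \<le> x ^ 7" using x by (intro power_increasing; simp)+
    have sum2: "real q * ((real K + 1) * (W powr (-1/2) + W powr (-3/2)) * ex) \<le> 2 * c * M * (s * Q)"
    proof -
      have "real q * (real K + 1) \<le> V" unfolding V_def by (intro mult_left_mono) auto
      then have le1: "real q * (real K + 1) \<le> c * x\<^sup>2" using Vx by linarith
      have wsum: "W powr (-1/2) + W powr (-3/2) \<le> x\<^sup>2 + x\<^sup>2" using Wp[of "1/2"] Wp[of "3/2"] by simp
      have "(real q * (real K + 1)) * (W powr (-1/2) + W powr (-3/2)) * ex \<le> (c * x\<^sup>2) * (x\<^sup>2 + x\<^sup>2) * ex"
        by (rule mult_right_mono[OF mult_mono[OF le1 wsum]]) (use ex c in auto)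
      also have "\<dots> = 2 * c * (x ^ 4 * ex)" by (simp add: power_numeral_reduce)
      also have "\<dots> \<le> 2 * c * (x ^ 7 * ex)" using x47 ex c by (intro mult_left_mono mult_right_mono) auto
      also have "\<dots> \<le> 2 * c * M" using ex c by (intro mult_left_mono) auto
      also have "\<dots> \<le> 2 * c * M * (s * Q)" using mult_left_mono[OF sQ, of "2 * c * M"] c M(1) by simp
      finally show ?thesis by (simp add: mult_ac)
    qed
    define D where "D = real d powr (-1/2)"
    have d1: "1 \<le> real d" using d by simp
    have D0: "0 \<le> D" by (simp add: D_def)
    have sum3: "real q * ((real d * W) powr (-3/2) * ((T * (1 + real K) + T\<^sup>2) * ex)) \<le> D * ((2 * c\<^sup>2) * M * (s * Q))"
    proof -
      have "(real d * W) powr (-3/2) = real d powr (-3/2) * W powr (-3/2)" by (simp add: powr_mult)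
      also have "\<dots> \<le> D * x\<^sup>2" unfolding D_def using d1 Wp[of "3/2"] by (intro mult_mono powr_mono) auto
      finally have p1: "(real d * W) powr (-3/2) \<le> D * x\<^sup>2" .
      have "T * (1 + real K) + T\<^sup>2 \<le> (real K + 1) * (1 + real K) + (real K + 1)\<^sup>2"
        using KT T1 by (intro add_mono mult_right_mono power_mono) auto
      then have p2: "T * (1 + real K) + T\<^sup>2 \<le> 2 * (real K + 1)\<^sup>2" by (simp add: power2_eq_square algebra_simps)
      have "real q * (real K + 1)\<^sup>2 \<le> (real q * real q) * (real K + 1)\<^sup>2" using q1 by (intro mult_right_mono) (auto simp: mult_le_cancel_left1)
      also have "\<dots> = (real q * (real K + 1))\<^sup>2" by (simp add: power2_eq_square mult_ac)
      also have "\<dots> \<le> V\<^sup>2" unfolding V_def by (intro power_mono mult_left_mono) auto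
      also have "\<dots> \<le> (c * x\<^sup>2)\<^sup>2" using Vx V by (intro power_mono) auto
      finally have p3: "real q * (real K + 1)\<^sup>2 \<le> c\<^sup>2 * x ^ 4" by (simp add: power_mult_distrib power_mult[symmetric])
      have "real q * ((real d * W) powr (-3/2) * ((T * (1 + real K) + T\<^sup>2) * ex)) \<le> real q * ((D * x\<^sup>2) * ((2 * (real K + 1)\<^sup>2) * ex))"
        by (rule mult_left_mono[OF mult_mono[OF p1 mult_right_mono[OF p2 ex(1)]]]) (use ex T1 D0 in auto)
      also have "\<dots> = 2 * D * x\<^sup>2 * ex * (real q * (real K + 1)\<^sup>2)" by (simp add: mult_ac)
      also have "\<dots> \<le> 2 * D * x\<^sup>2 * ex * (c\<^sup>2 * x ^ 4)" using p3 D0 ex by (intro mult_left_mono) auto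
      also have "\<dots> = D * (2 * c\<^sup>2) * (x ^ 6 * ex)" by (simp add: power_numeral_reduce)
      also have "\<dots> \<le> D * (2 * c\<^sup>2) * (x ^ 7 * ex)" using x47 ex D0 by (intro mult_left_mono mult_right_mono) auto
      also have "\<dots> \<le> D * (2 * c\<^sup>2) * M" using ex D0 by (intro mult_left_mono) auto
      also have "\<dots> = D * ((2 * c\<^sup>2) * M * 1)" by simp
      also have "\<dots> \<le> D * ((2 * c\<^sup>2) * M * (s * Q))" using sQ M(1) D0 by (intro mult_left_mono) auto
      finally show ?thesis .
    qed
    define w' where "w' = of_nat d * w"
    have w': "Re w' > 0" "norm w' = real d * W" "T = norm w' / Re w'"
      using x d1 by (simp_all add: w'_def w W_def T_def norm_mult)
    \<comment> \<open>The kernel at d w carries d^(-Re z), which is at most d^(-1/2) on the strip in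
      use.\<close>
    define A where "A = B0 * D"
    have A0: "A \<ge> 0" using D0 by (simp add: A_def B0_def)
    have kb: "norm (Gamma z * exp (- z * Ln w')) \<le> A * (1 + \<bar>Im z\<bar>) powr (Re z - 1/2) * W powr (- Re z) * exp (- \<bar>Im z\<bar> / T)"
      if z: "1/2 \<le> Re z" "Re z \<le> 3/2" for z
    proof -
      have "norm (Gamma z * exp (- z * Ln w')) \<le> B0 * (1 + \<bar>Im z\<bar>) powr (Re z - 1/2) * norm w' powr (- Re z) * exp (- \<bar>Im z\<bar> * (Re w' / norm w'))"
        unfolding B0_def by (rule norm_Mellin_kernel[OF z w'(1)])
      also have "norm w' powr (- Re z) = real d powr (- Re z) * W powr (- Re z)" unfolding w'(2) by (simp add: powr_mult)
      also have "B0 * (1 + \<bar>Im z\<bar>) powr (Re z - 1/2) * (real d powr (- Re z) * W powr (- Re z)) * exp (- \<bar>Im z\<bar> * (Re w' / norm w'))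
         \<le> B0 * (1 + \<bar>Im z\<bar>) powr (Re z - 1/2) * (D * W powr (- Re z)) * exp (- \<bar>Im z\<bar> * (Re w' / norm w'))"
        unfolding D_def using d1 z by (intro mult_right_mono mult_left_mono powr_mono) (auto simp: B0_def)
      also have "Re w' / norm w' = 1 / T" unfolding w'(3) by simp
      finally show ?thesis by (simp add: A_def mult_ac)
    qed
    have ind: "norm (mu_exp \<psi> w') \<le> C1 * A * V powr \<delta> * ((real K + 2) powr (-1/2) * (\<Sum>i\<le>2*K. Y powr (window_edge q K \<delta> \<psi> i + \<delta>))
         + (real K + 1) * (W powr (-1/2) + W powr (-3/2)) * ex) + C1 * ((real d * W) powr (-3/2) * ((T * (1 + real K) + T\<^sup>2) * ex))"
      if \<psi>: "\<psi> \<in> dchars q" for \<psi>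
    proof -
      have dc: "dirichlet_char q \<psi>" using \<psi> by (simp add: dchars_def)
      have "norm (mu_exp \<psi> w') \<le> C1 * A * (real q * (real K + 3)) powr \<delta> * ((real K + 2) powr (-1/2) * (\<Sum>i\<le>2*K. ((real K + 2) / W) powr (window_edge q K \<delta> \<psi> i + \<delta>))
         + (real K + 1) * (W powr (-1/2) + W powr (-3/2)) * exp (- real K / T))
         + C1 * norm w' powr (-3/2) * ((T * (1 + real K) + T\<^sup>2) * exp (- real K / T))"
      proof (rule C1(2)[OF q dc w'(1,3) A0 W(2) Y(3) kb])
        show "1/2 \<le> window_edge q K \<delta> \<psi> i \<and> window_edge q K \<delta> \<psi> i \<le> 1" for i
          using window_edge(1,2)[OF zf q dc \<delta>(1) J] by blast
      qed (assumption | rule window_edge(3)[OF zf q dc \<delta>(1) J])+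
      also have "\<dots> \<le> C1 * A * V powr \<delta> * ((real K + 2) powr (-1/2) * (\<Sum>i\<le>2*K. ((real K + 2) / W) powr (window_edge q K \<delta> \<psi> i + \<delta>))
         + (real K + 1) * (W powr (-1/2) + W powr (-3/2)) * exp (- real K / T))
         + C1 * norm w' powr (-3/2) * ((T * (1 + real K) + T\<^sup>2) * exp (- real K / T))"
        unfolding V_def using C1(1) A0 \<delta>
        by (intro add_right_mono mult_right_mono mult_left_mono powr_mono2) (auto intro!: add_nonneg_nonneg mult_nonneg_nonneg sum_nonneg)
      finally show ?thesis by (simp add: Y_def ex_def w'(2) mult.assoc)
    qed
    define R2 where "R2 = (real K + 1) * (W powr (-1/2) + W powr (-3/2)) * ex"
    define R3 where "R3 = (real d * W) powr (-3/2) * ((T * (1 + real K) + T\<^sup>2) * ex)"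
    have R0: "R2 \<ge> 0" "R3 \<ge> 0" using ex T1 by (auto simp: R2_def R3_def)
    have "(\<Sum>\<psi>\<in>dchars q. norm (mu_exp \<psi> w')) \<le> (\<Sum>\<psi>\<in>dchars q. C1 * A * V powr \<delta> * ((real K + 2) powr (-1/2) * (\<Sum>i\<le>2*K. Y powr (window_edge q K \<delta> \<psi> i + \<delta>)) + R2) + C1 * R3)"
      unfolding R2_def R3_def by (intro sum_mono ind)
    also have "\<dots> = C1 * A * V powr \<delta> * ((real K + 2) powr (-1/2) * (\<Sum>\<psi>\<in>dchars q. \<Sum>i\<le>2*K. Y powr (window_edge q K \<delta> \<psi> i + \<delta>)) + real (card (dchars q)) * R2) + C1 * (real (card (dchars q)) * R3)"
      by (simp add: sum.distrib sum_distrib_left algebra_simps)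
    also have "\<dots> \<le> C1 * A * (c\<^sup>2 * x powr (2 * \<delta>)) * ((2 * c ^ 4 + real J * G) * (s * Q) + 2 * c * M * (s * Q)) + C1 * (D * ((2 * c\<^sup>2) * M * (s * Q)))"
    proof (rule add_mono)
      have s2: "real (card (dchars q)) * R2 \<le> 2 * c * M * (s * Q)"
        by (rule order_trans[OF mult_right_mono[OF cd R0(1)]]) (use sum2 in \<open>simp only: R2_def\<close>)
      have s3: "real (card (dchars q)) * R3 \<le> D * ((2 * c\<^sup>2) * M * (s * Q))"
        by (rule order_trans[OF mult_right_mono[OF cd R0(2)]]) (use sum3 in \<open>simp only: R3_def\<close>)
      show "C1 * (real (card (dchars q)) * R3) \<le> C1 * (D * ((2 * c\<^sup>2) * M * (s * Q)))"
        using C1(1) by (intro mult_left_mono s3) simp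
      have nn: "0 \<le> C1 * A" using C1(1) A0 by simp
      show "C1 * A * V powr \<delta> * ((real K + 2) powr (-1/2) * (\<Sum>\<psi>\<in>dchars q. \<Sum>i\<le>2*K. Y powr (window_edge q K \<delta> \<psi> i + \<delta>)) + real (card (dchars q)) * R2)
         \<le> C1 * A * (c\<^sup>2 * x powr (2 * \<delta>)) * ((2 * c ^ 4 + real J * G) * (s * Q) + 2 * c * M * (s * Q))"
      proof (rule mult_mono[OF mult_left_mono[OF V\<delta> nn] add_mono[OF sum1 s2]])
        show "0 \<le> C1 * A * (c\<^sup>2 * x powr (2 * \<delta>))" by (intro mult_nonneg_nonneg nn) auto
        show "0 \<le> (real K + 2) powr (-1/2) * (\<Sum>\<psi>\<in>dchars q. \<Sum>i\<le>2*K. Y powr (window_edge q K \<delta> \<psi> i + \<delta>)) + real (card (dchars q)) * R2"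
          using R0(1) by (intro add_nonneg_nonneg mult_nonneg_nonneg sum_nonneg) auto
      qed
    qed
    also have "\<dots> \<le> C1 * A * (c\<^sup>2 * x powr (2 * \<delta>)) * ((2 * c ^ 4 + real J * G) * (s * Q) + 2 * c * M * (s * Q)) + C1 * (D * ((2 * c\<^sup>2) * M * (s * Q))) * x powr (2 * \<delta>)"
    proof -
      have "1 \<le> x powr (2 * \<delta>)" using x \<delta> by (simp add: ge_one_powr_ge_zero)
      moreover have "0 \<le> C1 * (D * ((2 * c\<^sup>2) * M * (s * Q)))" using C1(1) D0 M(1) s Q1 by simp
      ultimately show ?thesis by (intro add_left_mono) (simp add: mult_le_cancel_left1)
    qed
    also have "\<dots> = CC * D * s * (Q * x powr (2 * \<delta>))" by (simp add: CC_def A_def algebra_simps)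
    also have "Q * x powr (2 * \<delta>) = x powr ((1 + a) / 2 + 10 * \<delta>)" 
      by (simp add: Q_def add.commute flip: powr_add)
    also have "CC * D * s * x powr ((1 + a) / 2 + 10 * \<delta>) \<le> CC * D * s * x powr ((1 + a) / 2 + \<epsilon>)"
      using \<open>CC > 0\<close> D0 s x \<delta> by (intro mult_left_mono powr_mono) auto
    finally show "(\<Sum>\<psi>\<in>dchars q. norm (mu_exp \<psi> (of_nat d * w))) \<le> CC * real d powr (-1/2) * sqrt (real q) * x powr ((1 + a) / 2 + \<epsilon>)"
      by (simp add: D_def s_def w'_def)
  qed
qed

section \<open>Additive twists\<close>

text \<open>A prime p \<ge> 2^(1/\<epsilon>) satisfies 2 \<le> p^\<epsilon>; the at most
  \<open>N\<close> smaller ones cost a factor 2 each.\<close>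

lemma two_power_omega_bound:
  fixes \<epsilon> :: real
  assumes \<epsilon>: "\<epsilon> > 0"
  obtains C where "C > 0" "\<And>q. q \<ge> 1 \<Longrightarrow> 2 ^ card (prime_factors q) \<le> C * real q powr \<epsilon>"
proof (rule that)
  define N where "N = nat \<lceil>2 powr (1 / \<epsilon>)\<rceil>"
  show "(2::real) ^ N > 0" by simp
  fix q :: nat assume q: "q \<ge> 1"
  define P where "P = prime_factors q"
  have fin: "finite P" by (simp add: P_def)
  have p1: "1 \<le> real p" if "p \<in> P" for p
    using that prime_gt_0_nat[of p] by (auto simp: P_def in_prime_factors_iff)
  have "(2::real) ^ card P = (\<Prod>p\<in>P. 2)" by simp
  also have "\<dots> \<le> (\<Prod>p\<in>P. (if p < N then 2 else 1) * real p powr \<epsilon>)"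
  proof (rule prod_mono)
    fix p assume p: "p \<in> P"
    show "(0::real) \<le> 2 \<and> 2 \<le> (if p < N then 2 else 1) * real p powr \<epsilon>"
    proof (cases "p < N")
      case True
      then show ?thesis using p1[OF p] \<epsilon> by (simp add: ge_one_powr_ge_zero)
    next
      case False
      then have "2 powr (1 / \<epsilon>) \<le> real p" unfolding N_def by linarith
      then have "(2 powr (1 / \<epsilon>)) powr \<epsilon> \<le> real p powr \<epsilon>" using \<epsilon> by (intro powr_mono2) auto
      then show ?thesis using \<epsilon> False by (simp add: powr_powr)
    qed
  qed
  also have "\<dots> = (\<Prod>p\<in>P. if p < N then 2 else 1) * (\<Prod>p\<in>P. real p powr \<epsilon>)" by (rule prod.distrib)
  also have "\<dots> \<le> 2 ^ N * real q powr \<epsilon>"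
  proof (rule mult_mono)
    have "(\<Prod>p\<in>P. if p < N then 2 else (1::real)) = 2 ^ card {p\<in>P. p < N}"
      using fin by (simp add: prod.If_cases Int_def)
    also have "card {p\<in>P. p < N} \<le> card {..<N}" by (intro card_mono) auto
    then have "(2::real) ^ card {p\<in>P. p < N} \<le> 2 ^ N" by (intro power_increasing) auto
    finally show "(\<Prod>p\<in>P. if p < N then 2 else (1::real)) \<le> 2 ^ N" .
    have "(\<Prod>p\<in>P. p) \<le> (\<Prod>p\<in>P. p ^ multiplicity p q)"
    proof (rule prod_mono)
      fix p assume p: "p \<in> P"
      then have "multiplicity p q \<ge> 1" "p > 0"
        using prime_factors_multiplicity[of q] prime_gt_0_nat[of p] by (auto simp: P_def)
      then show "0 \<le> p \<and> p \<le> p ^ multiplicity p q" by (auto intro: self_le_power)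
    qed
    also have "\<dots> = q" using q prime_factorization_nat[of q] by (simp add: P_def)
    finally have "real (\<Prod>p\<in>P. p) \<le> real q" by (simp only: of_nat_le_iff)
    then have "real (\<Prod>p\<in>P. p) powr \<epsilon> \<le> real q powr \<epsilon>" using \<epsilon> by (intro powr_mono2 of_nat_0_le_iff) simp_all
    moreover have "real (\<Prod>p\<in>P. p) powr \<epsilon> = (\<Prod>p\<in>P. real p powr \<epsilon>)"
      using fin by (induction P rule: finite_induct) (simp_all add: powr_mult)
    ultimately show "(\<Prod>p\<in>P. real p powr \<epsilon>) \<le> real q powr \<epsilon>" by simp
  qed (auto intro: prod_nonneg)
  finally show "2 ^ card (prime_factors q) \<le> 2 ^ N * real q powr \<epsilon>" by (simp add: P_def)
qed

text \<open>Each factor 1 - 1/p of \<phi>(q)/q is at least 1/2.\<close>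

lemma residue_units_card_ge:
  assumes q: "q \<ge> 1"
  shows "real q \<le> 2 ^ card (prime_factors q) * real (card (residue_units q))"
proof -
  have "card (residue_units q) = totient q"
  \<comment> \<open>\<open>totatives 1\<close> is \<open>{1}\<close>, whereas
    \<open>residue_units 1\<close> is \<open>{0}\<close>; for larger \<open>q\<close> the two sets
    coincide.\<close>
  proof (cases "q = 1")
    case True
    then have "residue_units q = {0}" by (auto simp: residue_units_def)
    then show ?thesis using True by simp
  next
    case False
    then have "residue_units q = totatives q"
      using q by (auto simp: residue_units_def totatives_def intro: gr0I le_neq_implies_less)
    then show ?thesis by (simp add: totient_def)
  qed
  then have "real (card (residue_units q)) = real q * (\<Prod>p\<in>prime_factors q. 1 - 1 / real p)"
    by (simp add: totient_formula2)
  moreover have "(\<Prod>p\<in>prime_factors q. 1/2) \<le> (\<Prod>p\<in>prime_factors q. 1 - 1 / real p)"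
  proof (rule prod_mono)
    fix p assume "p \<in> prime_factors q"
    then have "2 \<le> p" using prime_ge_2_nat by (auto simp: in_prime_factors_iff)
    then have "1 / real p \<le> 1 / 2" by (intro divide_left_mono) auto
    then show "0 \<le> (1/2::real) \<and> 1/2 \<le> 1 - 1 / real p" by simp
  qed
  ultimately have "real q * (1/2) ^ card (prime_factors q) \<le> real (card (residue_units q))"
    by (simp add: mult_left_mono)
  then have "2 ^ card (prime_factors q) * (real q * (1/2) ^ card (prime_factors q)) \<le> 2 ^ card (prime_factors q) * real (card (residue_units q))"
    by (intro mult_left_mono) auto
  then show ?thesis by (simp add: power_divide)
qed

lemma card_squarefree_divisors:
  fixes q :: nat
  assumes q: "q \<ge> 1"
  shows "finite {d. d dvd q \<and> squarefree d}" "card {d. d dvd q \<and> squarefree d} \<le> 2 ^ card (prime_factors q)"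
proof -
  have q0: "q \<noteq> 0" using q by simp
  show "finite {d. d dvd q \<and> squarefree d}" using q0 by (intro finite_subset[OF _ finite_divisors_nat[of q]]) auto
  have prod: "d = (\<Prod>p\<in>prime_factors d. p)" if d: "d dvd q" "squarefree d" for d
  proof -
    have d0: "d \<noteq> 0" using d q0 by (metis dvd_0_left_iff)
    have "d = (\<Prod>p\<in>prime_factors d. p ^ multiplicity p d)" using d0 prime_factorization_nat[of d] by simp
    also have "\<dots> = (\<Prod>p\<in>prime_factors d. p)"
      using d(2) squarefree_factorial_semiring'[OF d0] by (intro prod.cong) auto
    finally show ?thesis .
  qed
  have "inj_on prime_factors {d. d dvd q \<and> squarefree d}"
    by (rule inj_onI) (metis (mono_tags, lifting) mem_Collect_eq prod)
  moreover have "prime_factors ` {d. d dvd q \<and> squarefree d} \<subseteq> Pow (prime_factors q)"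
    using q0 dvd_prime_factors by auto
  ultimately have "card {d. d dvd q \<and> squarefree d} \<le> card (Pow (prime_factors q))"
    by (intro card_inj_on_le) auto
  then show "card {d. d dvd q \<and> squarefree d} \<le> 2 ^ card (prime_factors q)" by (simp add: card_Pow)
qed

text \<open>Only d = gcd(m, q) can leave a quotient prime to \<open>q\<close>, and for squarefree
  \<open>m\<close> it does. The form as a sum over all divisors of \<open>q\<close> allows the sum
  over d to be moved outside the series in m.\<close>

lemma mu_gcd_decomposition:
  assumes q: "q \<ge> 1" and m: "m \<ge> 1"
  shows "(\<Sum>d | d dvd q. if d dvd m \<and> coprime (m div d) q then mu d * mu (m div d) else 0) = mu m"
proof -
  define g where "g = gcd m q"
  have g: "g dvd m" "g dvd q" "g > 0" using q by (auto simp: g_def)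
  have uniq: "d = g" if d: "d dvd q" "d dvd m" "coprime (m div d) q" for d
  proof -
    have "g = gcd (d * (m div d)) q" using d by (simp add: g_def)
    also have "\<dots> = gcd d q" using d(3) by (simp add: gcd_mult_right_right_cancel coprime_commute gcd_mult_left_right_cancel)
    also have "\<dots> = d" using d(1) by (simp add: gcd_nat.absorb1)
    finally show ?thesis by simp
  qed
  have "(\<Sum>d | d dvd q. if d dvd m \<and> coprime (m div d) q then mu d * mu (m div d) else 0)
     = (\<Sum>d\<in>{g}. if d dvd m \<and> coprime (m div d) q then mu d * mu (m div d) else 0)"
  proof (rule sum.mono_neutral_right)
    show "finite {d. d dvd q}" using q by (intro finite_divisors_nat) simp
    show "{g} \<subseteq> {d. d dvd q}" using g(2) by blast
  qed (use uniq in auto)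
  also have "\<dots> = (if coprime (m div g) q then mu g * mu (m div g) else 0)" using g by simp
  also have "\<dots> = mu m"
  proof (cases "coprime (m div g) q")
    case True
    then have "coprime g (m div g)" using g(2) coprime_divisors[of g q "m div g" "m div g"] by (simp add: coprime_commute)
    then show ?thesis using True g mu_mult_coprime[of g "m div g"] by simp
  next
    case False
    then have "gcd (m div g) q \<noteq> 1" using coprime_iff_gcd_eq_1 by metis
    then obtain p where p0: "prime p" "p dvd gcd (m div g) q" using prime_factor_nat by blast
    then have p: "prime p" "p dvd m div g" "p dvd q" by simp_all
    have "p dvd m" using p(2) g(1) by (metis dvd_div_mult_self dvd_mult2)
    then have "p dvd g" using p(3) by (simp add: g_def)
    then have "p * p dvd g * (m div g)" using p(2) by (intro mult_dvd_mono)
    then have "p ^ 2 dvd m" using g(1) by (simp add: power2_eq_square)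
    then have "\<not> squarefree m" using p(1) unfolding squarefree_def by (metis not_prime_unit)
    then show ?thesis using False by (simp add: mu_def)
  qed
  finally show ?thesis .
qed

lemma exp_neg_summable:
  fixes w :: complex
  assumes w: "Re w > 0" and c: "\<And>n. norm (c n) \<le> 1"
  shows "summable (\<lambda>n. c n * exp (- (of_nat (Suc n) * w)))"
proof (rule summable_comparison_test')
  define r where "r = exp (- Re w)"
  have r: "norm r < 1" using w by (simp add: r_def)
  show "summable (\<lambda>n. r ^ Suc n)" using r by (subst summable_Suc_iff) (rule summable_geometric)
  fix n :: nat
  have "norm (exp (- (of_nat (Suc n) * w))) = r ^ Suc n"
    unfolding r_def exp_of_nat_mult[symmetric] by (simp del: of_nat_Suc)
  then show "norm (c n * exp (- (of_nat (Suc n) * w))) \<le> r ^ Suc n"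
    using mult_right_mono[OF c[of n], of "r ^ Suc n"] by (simp add: norm_mult r_def del: of_nat_Suc power_Suc)
qed

lemma mu_exp_summable:
  assumes "dirichlet_char q \<psi>" "q \<ge> 1" "Re w > 0"
  shows "summable (\<lambda>n. of_int (mu (Suc n)) * \<psi> (Suc n) * exp (- (of_nat (Suc n) * w)))"
proof (rule exp_neg_summable[OF assms(3)])
  show "norm (of_int (mu (Suc n)) * \<psi> (Suc n)) \<le> 1" for n
    unfolding norm_mult using norm_mu_le norm_dirichlet_char_le[OF assms(1,2)] by (intro mult_le_one) auto
qed

text \<open>Characters modulo \<open>q\<close> see only integers prime to \<open>q\<close>, so n is
  first split as d k with k prime to \<open>q\<close>. The additive character is expanded in k, and
  d moves into the argument of \<open>mu_exp\<close>.\<close>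

lemma rational_twist_decomposition:
  fixes h :: int and w :: complex
  assumes q: "q \<ge> 1" and w: "Re w > 0"
  shows "(\<Sum>n. of_int (mu (Suc n)) * e1 (of_int (h * int (Suc n)) / real q) * exp (- (of_nat (Suc n) * w))) =
    (\<Sum>d | d dvd q. of_int (mu d) * (\<Sum>\<psi>\<in>dchars q. char_coeff q (\<lambda>u. e1 (of_int (h * int d * int u) / real q)) \<psi> * mu_exp \<psi> (of_nat d * w))
        / of_nat (card (residue_units q)))"
proof -
  define E where "E = (\<lambda>m. e1 (of_int (h * int m) / real q) * exp (- (of_nat m * w)))"
  define t where "t = (\<lambda>d n. (if d dvd Suc n \<and> coprime (Suc n div d) q then of_int (mu d * mu (Suc n div d)) else 0) * E (Suc n))"
  define cd where "cd = (\<lambda>d. char_coeff q (\<lambda>u. e1 (of_int (h * int d * int u) / real q)))"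
  define ph where "ph = (of_nat (card (residue_units q)) :: complex)"
  have fin: "finite {d. d dvd q}" using q by simp
  have st: "summable (t d)" for d
  proof -
    have "summable (\<lambda>n. ((if d dvd Suc n \<and> coprime (Suc n div d) q then of_int (mu d * mu (Suc n div d)) else 0) * e1 (of_int (h * int (Suc n)) / real q))
        * exp (- (of_nat (Suc n) * w)))"
      by (rule exp_neg_summable[OF w])
        (use norm_mu_le in \<open>auto simp: norm_mult simp del: norm_of_int intro!: mult_le_one\<close>)
    then show ?thesis by (simp add: t_def E_def mult.assoc)
  qed
  have "(\<Sum>n. of_int (mu (Suc n)) * e1 (of_int (h * int (Suc n)) / real q) * exp (- (of_nat (Suc n) * w))) = (\<Sum>n. \<Sum>d | d dvd q. t d n)"
  proof (rule suminf_cong)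
    fix n
    have "(\<Sum>d | d dvd q. t d n) = of_int (\<Sum>d | d dvd q. if d dvd Suc n \<and> coprime (Suc n div d) q then mu d * mu (Suc n div d) else 0) * E (Suc n)"
      unfolding t_def sum_distrib_right[symmetric] of_int_sum by (intro arg_cong2[where f = "(*)"] sum.cong refl) auto
    also have "\<dots> = of_int (mu (Suc n)) * E (Suc n)" using mu_gcd_decomposition[OF q, of "Suc n"] by simp
    finally show "of_int (mu (Suc n)) * e1 (of_int (h * int (Suc n)) / real q) * exp (- (of_nat (Suc n) * w)) = (\<Sum>d | d dvd q. t d n)"
      by (simp add: E_def mult.assoc)
  qed
  also have "\<dots> = (\<Sum>d | d dvd q. \<Sum>n. t d n)" by (rule suminf_sum) (rule st)
  also have "\<dots> = (\<Sum>d | d dvd q. of_int (mu d) * (\<Sum>\<psi>\<in>dchars q. cd d \<psi> * mu_exp \<psi> (of_nat d * w)) / ph)"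
  proof (rule sum.cong[OF refl])
    fix d assume "d \<in> {d. d dvd q}"
    then have d: "d dvd q" "d > 0" using q by (auto intro: gr0I)
    \<comment> \<open>Reindexing by the multiples of \<open>d\<close>: the index \<open>g k\<close>
      belongs to the integer d (k + 1).\<close>
    define g where "g = (\<lambda>k. d * Suc k - 1)"
    have Sg: "Suc (g k) = d * Suc k" for k using d(2) by (simp add: g_def)
    have "strict_mono g"
    proof (rule strict_monoI_Suc)
      fix k show "g k < g (Suc k)" using Sg[of k] Sg[of "Suc k"] d(2) by (metis Suc_less_eq lessI mult_less_cancel1)
    qed
    moreover have "t d n = 0" if "n \<notin> range g" for n
    proof -
      have "\<not> d dvd Suc n"
      proof
        assume "d dvd Suc n"
        then obtain k where k: "Suc n = d * k" by auto
        then obtain k' where "k = Suc k'" by (cases k) auto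
        then have "n = g k'" using k Sg[of k'] by simp
        then show False using that by blast
      qed
      then show ?thesis by (simp add: t_def)
    qed
    ultimately have "(\<Sum>n. t d n) = (\<Sum>k. t d (g k))" by (rule suminf_mono_reindex[symmetric])
    also have "\<dots> = (\<Sum>k. \<Sum>\<psi>\<in>dchars q. (of_int (mu d) * cd d \<psi> / ph) * (of_int (mu (Suc k)) * \<psi> (Suc k) * exp (- (of_nat (Suc k) * (of_nat d * w)))))"
    proof (rule suminf_cong)
      fix k
      have ex: "exp (- (of_nat (d * Suc k) * w)) = exp (- (of_nat (Suc k) * (of_nat d * w)))" by (simp add: algebra_simps)
      have "(if coprime (Suc k) q then e1 (of_int (h * int (d * Suc k)) / real q) else 0) = (\<Sum>\<psi>\<in>dchars q. cd d \<psi> * \<psi> (Suc k)) / ph"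
      proof (cases "coprime (Suc k) q")
        case True
        have "e1 (of_int (h * int d * int (Suc k)) / real q) = (\<Sum>\<psi>\<in>dchars q. cd d \<psi> * \<psi> (Suc k)) / ph"
          unfolding cd_def ph_def
        proof (rule char_expansion[OF q True])
          fix m n :: nat assume "[m = n] (mod q)"
          then have "[h * int d * int m = h * int d * int n] (mod int q)"
            by (intro cong_mult cong_refl) (simp add: cong_int_iff)
          then show "e1 (of_int (h * int d * int m) / real q) = e1 (of_int (h * int d * int n) / real q)" by (rule e1_cong)
        qed
        then show ?thesis using True by (simp add: mult.assoc del: mult_Suc_right of_nat_Suc)
      next
        case False
        have "\<psi> (Suc k) = 0" if "\<psi> \<in> dchars q" for \<psi>
          using that False dirichlet_charD(4)[of q \<psi> "Suc k"] by (simp add: dchars_def)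
        then have "(\<Sum>\<psi>\<in>dchars q. cd d \<psi> * \<psi> (Suc k)) = 0" by (intro sum.neutral) auto
        then show ?thesis using False by simp
      qed
      then have "t d (g k) = of_int (mu d) * of_int (mu (Suc k)) * ((\<Sum>\<psi>\<in>dchars q. cd d \<psi> * \<psi> (Suc k)) / ph) * exp (- (of_nat (Suc k) * (of_nat d * w)))"
        unfolding t_def E_def Sg ex using d(2) by (auto simp del: of_nat_Suc mult_Suc_right)
      also have "\<dots> = (\<Sum>\<psi>\<in>dchars q. (of_int (mu d) * cd d \<psi> / ph) * (of_int (mu (Suc k)) * \<psi> (Suc k) * exp (- (of_nat (Suc k) * (of_nat d * w)))))"
        by (simp add: sum_distrib_left sum_distrib_right sum_divide_distrib mult_ac del: of_nat_Suc)
      finally show "t d (g k) = (\<Sum>\<psi>\<in>dchars q. (of_int (mu d) * cd d \<psi> / ph) * (of_int (mu (Suc k)) * \<psi> (Suc k) * exp (- (of_nat (Suc k) * (of_nat d * w)))))" .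
    qed
    also have "\<dots> = (\<Sum>\<psi>\<in>dchars q. \<Sum>k. (of_int (mu d) * cd d \<psi> / ph) * (of_int (mu (Suc k)) * \<psi> (Suc k) * exp (- (of_nat (Suc k) * (of_nat d * w)))))"
      using d(2) w by (intro suminf_sum summable_mult mu_exp_summable[OF _ q]) (auto simp: dchars_def)
    also have "\<dots> = (\<Sum>\<psi>\<in>dchars q. (of_int (mu d) * cd d \<psi> / ph) * mu_exp \<psi> (of_nat d * w))"
      unfolding mu_exp_def using d(2) w
      by (intro sum.cong refl suminf_mult mu_exp_summable[OF _ q]) (auto simp: dchars_def)
    also have "\<dots> = of_int (mu d) * (\<Sum>\<psi>\<in>dchars q. cd d \<psi> * mu_exp \<psi> (of_nat d * w)) / ph"
      by (simp add: sum_distrib_left sum_divide_distrib mult_ac)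
    finally show "(\<Sum>n. t d n) = of_int (mu d) * (\<Sum>\<psi>\<in>dchars q. cd d \<psi> * mu_exp \<psi> (of_nat d * w)) / ph" .
  qed
  finally show ?thesis by (simp add: cd_def ph_def)
qed

text \<open>For each divisor d the Gauss sum bound sqrt(q d) meets d^(-1/2) sqrt(q) from the average
  over characters, which leaves q/\<phi>(q) times the target. Both q/\<phi>(q) and the number of
  squarefree divisors are at most 2 to the number of primes dividing \<open>q\<close>.\<close>

lemma smoothed_sum_bound:
  fixes a \<epsilon> :: real
  assumes a: "1/2 \<le> a" "a < 1" and zf: "zero_free a" and \<epsilon>: "\<epsilon> > 0"
    and density: "\<forall>\<epsilon>>0. \<exists>C. \<forall>l\<ge>1. \<forall>T\<ge>10. \<forall>\<sigma>. 1/2 \<le> \<sigma> \<and> \<sigma> \<le> 1 \<longrightarrow>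
           \<bar>\<Sum>\<psi>\<in>dchars l. N_zeros l \<psi> \<sigma> T\<bar> \<le> C * (real l * T) powr (2 - 2 * \<sigma> + \<epsilon>)"
  obtains C where "C > 0" "\<And>x \<alpha>. 2 \<le> x \<Longrightarrow>
    norm (\<Sum>n. of_int (mu (Suc n)) * e1 (\<alpha> * real (Suc n)) * exp (- (of_nat (Suc n) / of_real x))) \<le> C * x powr ((1 + a) / 2 + \<epsilon>)"
proof -
  \<comment> \<open>Three losses x^\<eta>: one from \<open>sum_mu_exp_bound\<close> and two from
    \<open>two_power_omega_bound\<close>.\<close>
  define \<eta> where "\<eta> = \<epsilon> / 3"
  have \<eta>: "\<eta> > 0" using \<epsilon> by (simp add: \<eta>_def)
  obtain C1 where C1: "C1 > 0" "\<And>x q d w. 2 \<le> x \<Longrightarrow> q \<ge> 1 \<Longrightarrow> d \<ge> 1 \<Longrightarrow> Re w = 1 / x \<Longrightarrow> real q \<le> x powr (1 - a) \<Longrightarrow>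
       real q * (norm w * x) \<le> 16 * x powr a \<Longrightarrow>
       (\<Sum>\<psi>\<in>dchars q. norm (mu_exp \<psi> (of_nat d * w))) \<le> C1 * real d powr (-1/2) * sqrt (real q) * x powr ((1 + a) / 2 + \<eta>)"
    using sum_mu_exp_bound[OF a zf \<eta> density] by metis
  obtain C2 where C2: "C2 > 0" "\<And>q. q \<ge> 1 \<Longrightarrow> 2 ^ card (prime_factors q) \<le> C2 * real q powr \<eta>"
    using two_power_omega_bound[OF \<eta>] by metis
  show ?thesis
  proof (rule that)
    show "C2\<^sup>2 * C1 > 0" using C1(1) C2(1) by simp
    fix x \<alpha> :: real assume x2: "2 \<le> x"
    then have x: "1 \<le> x" "0 < x" by auto
    define N where "N = nat \<lfloor>x powr (1 - a)\<rfloor>"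
    have xa: "1 \<le> x powr (1 - a)" using x a by (intro ge_one_powr_ge_zero) auto
    have N: "real N \<le> x powr (1 - a)" "x powr (1 - a) < real N + 1" unfolding N_def using xa by linarith+
    have N0: "N > 0" using N xa by linarith
    obtain h k where hk: "coprime h k" "0 < k" "k \<le> int N" "\<bar>of_int k * \<alpha> - of_int h\<bar> < 1 / N"
      using Dirichlet_approx_coprime[OF N0] by metis
    define q where "q = nat k"
    have q: "q \<ge> 1" "k = int q" using hk(2) by (auto simp: q_def)
    have qx: "real q \<le> x powr (1 - a)" using hk(3) N q(2) by linarith
    define \<beta> where "\<beta> = \<alpha> - of_int h / real q"
    have q0: "real q > 0" using q by simp
    have "real q * \<beta> = of_int k * \<alpha> - of_int h" using q0 by (simp add: \<beta>_def q(2) algebra_simps)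
    then have qb: "real q * \<bar>\<beta>\<bar> < 1 / real N" using hk(4) q0 by (metis abs_mult abs_of_pos)
    define w where "w = Complex (1 / x) (- (2 * pi * \<beta>))"
    have Rew: "Re w = 1 / x" "Re w > 0" using x by (simp_all add: w_def)
    have qw: "real q * (norm w * x) \<le> 16 * x powr a"
    proof -
      have "norm w \<le> 1 / x + 2 * pi * \<bar>\<beta>\<bar>" using cmod_le[of w] x by (simp add: w_def abs_mult)
      then have "real q * (norm w * x) \<le> real q * ((1 / x + 2 * pi * \<bar>\<beta>\<bar>) * x)"
        using x q0 by (intro mult_left_mono mult_right_mono) auto
      also have "\<dots> = real q + 2 * pi * (real q * \<bar>\<beta>\<bar>) * x" using x by (simp add: field_simps)
      \<comment> \<open>Here q \<le> x^(1-a) \<le> x^a because a \<ge> 1/2, and 1/N \<le> 2/x^(1-a)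
        because x^(1-a) < N + 1 \<le> 2N. With 3.5 for \<pi> the total is 15 x^a.\<close>
      also have "\<dots> \<le> x powr a + 2 * 3.5 * (2 / x powr (1 - a)) * x"
      proof (intro add_mono mult_right_mono mult_mono)
        have "x powr (1 - a) \<le> x powr a" using x a by (intro powr_mono) auto
        then show "real q \<le> x powr a" using qx by linarith
        have "x powr (1 - a) \<le> 2 * real N" using N N0 by linarith
        moreover have "0 < x powr (1 - a)" using xa by linarith
          ultimately have "1 / real N \<le> 2 / x powr (1 - a)" using N0 by (simp add: field_simps)
        then show "real q * \<bar>\<beta>\<bar> \<le> 2 / x powr (1 - a)" using qb by linarith
        show "pi \<le> 3.5" using pi_less_4 pi_approx by simp
      qed (use x q0 in auto)
      also have "2 * 3.5 * (2 / x powr (1 - a)) * x = 14 * x powr a"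
        using x by (simp add: powr_diff field_simps)
      also have "x powr a + 14 * x powr a \<le> 16 * x powr a" by simp
      finally show ?thesis .
    qed
    have "of_int (mu (Suc n)) * e1 (\<alpha> * real (Suc n)) * exp (- (of_nat (Suc n) / of_real x))
       = of_int (mu (Suc n)) * e1 (of_int (h * int (Suc n)) / real q) * exp (- (of_nat (Suc n) * w))" for n
    proof -
      define m where "m = Suc n"
      have "\<alpha> * real m = of_int (h * int m) / real q + \<beta> * real m"
        using q0 by (simp add: \<beta>_def field_simps)
      then have "e1 (\<alpha> * real m) = e1 (of_int (h * int m) / real q) * e1 (\<beta> * real m)" by (simp add: e1_add)
      moreover have "e1 (\<beta> * real m) * exp (- (of_nat m / of_real x)) = exp (- (of_nat m * w))"
      proof -
        have "\<i> * of_real (2 * pi * (\<beta> * real m)) + - (of_nat m / of_real x) = - (of_nat m * w)"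
          using x by (simp add: w_def complex_eq_iff)
        then show ?thesis unfolding e1_def cis_conv_exp exp_add[symmetric] by simp
      qed
      ultimately show ?thesis by (simp add: m_def mult.assoc del: of_nat_Suc)
    qed
    then have eq: "(\<Sum>n. of_int (mu (Suc n)) * e1 (\<alpha> * real (Suc n)) * exp (- (of_nat (Suc n) / of_real x)))
       = (\<Sum>n. of_int (mu (Suc n)) * e1 (of_int (h * int (Suc n)) / real q) * exp (- (of_nat (Suc n) * w)))" by (rule suminf_cong)
    define b where "b = (1 + a) / 2"
    define ph where "ph = real (card (residue_units q))"
    have ph: "ph > 0" using card_residue_units_pos[OF q(1)] by (simp add: ph_def)
    define f where "f = (\<lambda>d. of_int (mu d) * (\<Sum>\<psi>\<in>dchars q. char_coeff q (\<lambda>u. e1 (of_int (h * int d * int u) / real q)) \<psi> * mu_exp \<psi> (of_nat d * w))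
        / of_nat (card (residue_units q)))"
    have fd: "norm (f d) \<le> real q * C1 * x powr (b + \<eta>) / ph" if d: "d dvd q" for d
    proof -
      have d1: "d \<ge> 1" using d q(1) by (metis One_nat_def Suc_leI dvd_pos_nat gr0I less_le_trans not_one_le_zero zero_less_one)
      have "norm (\<Sum>\<psi>\<in>dchars q. char_coeff q (\<lambda>u. e1 (of_int (h * int d * int u) / real q)) \<psi> * mu_exp \<psi> (of_nat d * w))
         \<le> (\<Sum>\<psi>\<in>dchars q. sqrt (real q * real d) * norm (mu_exp \<psi> (of_nat d * w)))"
        unfolding norm_mult[symmetric]
        by (rule sum_norm_le) (use hk(1) q d norm_char_coeff_e1[OF q(1) _ _ d, of _ h] in \<open>auto simp: norm_mult dchars_def intro!: mult_right_mono\<close>)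
      also have "\<dots> = sqrt (real q * real d) * (\<Sum>\<psi>\<in>dchars q. norm (mu_exp \<psi> (of_nat d * w)))" by (simp add: sum_distrib_left)
      also have "\<dots> \<le> sqrt (real q * real d) * (C1 * real d powr (-1/2) * sqrt (real q) * x powr (b + \<eta>))"
        unfolding b_def by (intro mult_left_mono C1(2)[OF x2 q(1) d1 Rew(1) qx qw]) auto
      also have "\<dots> = (sqrt (real q) * sqrt (real q)) * (sqrt (real d) * real d powr (-1/2)) * C1 * x powr (b + \<eta>)"
        by (simp add: real_sqrt_mult mult_ac)
      also have "sqrt (real d) * real d powr (-1/2) = 1"
      proof -
        have "sqrt (real d) = real d powr (1/2)" by (simp add: powr_half_sqrt)
        then show ?thesis using d1 by (simp flip: powr_add)
      qed
      also have "sqrt (real q) * sqrt (real q) = real q" by simp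
      finally have s: "norm (\<Sum>\<psi>\<in>dchars q. char_coeff q (\<lambda>u. e1 (of_int (h * int d * int u) / real q)) \<psi> * mu_exp \<psi> (of_nat d * w)) \<le> real q * C1 * x powr (b + \<eta>)" by simp
      have "norm (f d) \<le> 1 * norm (\<Sum>\<psi>\<in>dchars q. char_coeff q (\<lambda>u. e1 (of_int (h * int d * int u) / real q)) \<psi> * mu_exp \<psi> (of_nat d * w)) / ph"
        unfolding f_def norm_divide norm_mult using norm_mu_le[of d] ph by (intro divide_mono mult_right_mono) (auto simp: ph_def)
      also have "\<dots> \<le> real q * C1 * x powr (b + \<eta>) / ph" using s ph by (intro divide_right_mono) auto
      finally show ?thesis .
    qed
    have "(\<Sum>n. of_int (mu (Suc n)) * e1 (\<alpha> * real (Suc n)) * exp (- (of_nat (Suc n) / of_real x))) = (\<Sum>d | d dvd q. f d)"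
      unfolding eq f_def by (rule rational_twist_decomposition[OF q(1) Rew(2)])
    also have "(\<Sum>d | d dvd q. f d) = (\<Sum>d | d dvd q \<and> squarefree d. f d)"
      using q(1) by (intro sum.mono_neutral_right) (auto simp: f_def mu_def)
    finally have decomp: "(\<Sum>n. of_int (mu (Suc n)) * e1 (\<alpha> * real (Suc n)) * exp (- (of_nat (Suc n) / of_real x))) = (\<Sum>d | d dvd q \<and> squarefree d. f d)" .
    have "norm (\<Sum>n. of_int (mu (Suc n)) * e1 (\<alpha> * real (Suc n)) * exp (- (of_nat (Suc n) / of_real x)))
        \<le> (\<Sum>d | d dvd q \<and> squarefree d. real q * C1 * x powr (b + \<eta>) / ph)"
      unfolding decomp by (rule sum_norm_le) (use fd in blast)
    also have "\<dots> = real (card {d. d dvd q \<and> squarefree d}) * (real q / ph) * (C1 * x powr (b + \<eta>))" by simp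
    also have "\<dots> \<le> (2 ^ card (prime_factors q)) * (2 ^ card (prime_factors q)) * (C1 * x powr (b + \<eta>))"
    proof (intro mult_right_mono mult_mono)
      have "real (card {d. d dvd q \<and> squarefree d}) \<le> real (2 ^ card (prime_factors q))"
        using card_squarefree_divisors(2)[OF q(1)] by (simp only: of_nat_le_iff)
      then show "real (card {d. d dvd q \<and> squarefree d}) \<le> 2 ^ card (prime_factors q)" by simp
      show "real q / ph \<le> 2 ^ card (prime_factors q)"
        using residue_units_card_ge[OF q(1)] ph by (simp add: ph_def divide_le_eq)
    qed (use C1(1) ph in auto)
    also have "\<dots> \<le> (C2 * x powr \<eta>) * (C2 * x powr \<eta>) * (C1 * x powr (b + \<eta>))"
    proof -
      have "real q \<le> x"
      proof -
        have "x powr (1 - a) \<le> x powr 1" using x a by (intro powr_mono) auto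
        then show ?thesis using qx x by simp
      qed
      then have "C2 * real q powr \<eta> \<le> C2 * x powr \<eta>" using C2(1) \<eta> by (intro mult_left_mono powr_mono2) auto
      then have "2 ^ card (prime_factors q) \<le> C2 * x powr \<eta>" using C2(2)[OF q(1)] by linarith
      then show ?thesis using C1(1) C2(1) by (intro mult_right_mono mult_mono) auto
    qed
    also have "\<dots> = C2\<^sup>2 * C1 * (x powr \<eta> * x powr \<eta> * x powr (b + \<eta>))" by (simp add: power2_eq_square mult_ac)
    also have "x powr \<eta> * x powr \<eta> * x powr (b + \<eta>) = x powr (b + \<epsilon>)" by (simp add: \<eta>_def add.commute flip: powr_add)
    finally show "norm (\<Sum>n. of_int (mu (Suc n)) * e1 (\<alpha> * real (Suc n)) * exp (- (of_nat (Suc n) / of_real x))) \<le> C2\<^sup>2 * C1 * x powr ((1 + a) / 2 + \<epsilon>)"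
      by (simp add: b_def)
  qed
qed

section \<open>Removing the smoothing\<close>

text \<open>Half of Jordan's bound 2y/\<pi>, which suffices as constants do not matter.\<close>

lemma sin_ge_div_pi:
  fixes y :: real
  assumes "0 \<le> y" "y \<le> pi / 2"
  shows "y / pi \<le> sin y"
proof (cases "y \<le> pi / 3")
  case True
  show ?thesis
  proof (cases "y = 0")
    case False
    then have y: "0 < y" using assms by simp
    obtain z where z: "0 < z" "z < y" "sin y - sin 0 = (y - 0) * cos z"
      using MVT2[OF y, of sin cos] by (auto intro: DERIV_sin)
    have "cos (pi / 3) \<le> cos z" using z True by (intro cos_monotone_0_pi_le) auto
    then have "y * (1 / 2) \<le> sin y" using z y by (simp add: cos_60)
    moreover have "y / pi \<le> y / 2" using y pi_ge_two by (intro divide_left_mono) auto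
    ultimately show ?thesis by linarith
  qed simp
next
  case False
  have "sin (pi / 6) \<le> sin y" using False assms by (intro sin_monotone_2pi_le) (use pi_gt_zero in linarith)+
  moreover have "y / pi \<le> 1 / 2" using assms by (simp add: field_simps)
  ultimately show ?thesis unfolding sin_30 by linarith
qed

text \<open>|1 - r e(t)| is at least of the order of 1 - r plus the distance from t to the nearest
  integer. The two fractions serve t near 0 and t near 1; their sum is a single majorant with an
  elementary primitive.\<close>

lemma inverse_distance_bound:
  fixes r t :: real
  assumes r: "1 / 2 \<le> r" "r < 1" and t: "0 \<le> t" "t \<le> 1"
  shows "1 / norm (1 - of_real r * e1 t) \<le> 2 / (1 - r + t) + 2 / (2 - r - t)"
proof -
  define u where "u = 1 - r"
  have u: "u > 0" using r by (simp add: u_def)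
  have "(norm (1 - of_real r * e1 t))\<^sup>2 = (1 - r * cos (2 * pi * t))\<^sup>2 + (r * sin (2 * pi * t))\<^sup>2"
    by (simp add: cmod_power2 e1_def)
  also have "\<dots> = u\<^sup>2 + 4 * r * (sin (pi * t))\<^sup>2"
  proof -
    have "(1 - r * c)\<^sup>2 + (r * s)\<^sup>2 = u\<^sup>2 + 4 * r * v" if cs: "s\<^sup>2 + c\<^sup>2 = 1" "c = 1 - 2 * v" for c s v :: real
    proof -
      have "(1 - r * c)\<^sup>2 + (r * s)\<^sup>2 = 1 - 2 * r * c + r\<^sup>2 * (s\<^sup>2 + c\<^sup>2)"
        by (simp add: power2_eq_square algebra_simps)
      also have "\<dots> = u\<^sup>2 + 4 * r * v" unfolding cs(1) unfolding cs(2) u_def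
        by (simp add: power2_eq_square algebra_simps)
      finally show ?thesis .
    qed
    moreover have "cos (2 * pi * t) = 1 - 2 * (sin (pi * t))\<^sup>2"
      using cos_double_sin[of "pi * t"] by (simp add: mult.assoc)
    ultimately show ?thesis using sin_cos_squared_add[of "2 * pi * t"] by blast
  qed
  finally have sq: "(norm (1 - of_real r * e1 t))\<^sup>2 = u\<^sup>2 + 4 * r * (sin (pi * t))\<^sup>2" .
  have low: "(u + m) / 2 \<le> norm (1 - of_real r * e1 t)" if m: "0 \<le> m" "m \<le> sin (pi * t)" for m
  proof (rule power2_le_imp_le)
    have "m\<^sup>2 \<le> (sin (pi * t))\<^sup>2" using m by (intro power_mono) auto
    then have "1 * m\<^sup>2 \<le> (4 * r) * (sin (pi * t))\<^sup>2" using r by (intro mult_mono) auto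
    moreover have "((u + m) / 2)\<^sup>2 \<le> u\<^sup>2 + m\<^sup>2"
    proof -
      have "((u + m) / 2)\<^sup>2 = (u\<^sup>2 + 2 * u * m + m\<^sup>2) / 4" by (simp add: power2_sum power_divide)
      also have "\<dots> \<le> u\<^sup>2 + m\<^sup>2"
      proof -
        have "(A + B + D) / 4 \<le> A + D" if "B \<le> A + D" "0 \<le> A" "0 \<le> D" for A B D :: real
          using that by (simp add: field_simps)
        from this[OF sum_squares_bound zero_le_power2 zero_le_power2] show ?thesis .
      qed
      finally show ?thesis .
    qed
    ultimately show "((u + m) / 2)\<^sup>2 \<le> (norm (1 - of_real r * e1 t))\<^sup>2" unfolding sq by linarith
  qed simp
  have inv: "1 / norm (1 - of_real r * e1 t) \<le> 2 / (u + m)" if m: "0 \<le> m" "m \<le> sin (pi * t)" for m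
  proof -
    have "1 / norm (1 - of_real r * e1 t) \<le> 1 / ((u + m) / 2)"
      by (rule divide_left_mono) (use low[OF m] u m(1) in \<open>auto intro!: mult_pos_pos\<close>)
    then show ?thesis by simp
  qed
  have pos: "0 \<le> 2 / (u + t)" "0 \<le> 2 / (u + (1 - t))" using u t by auto
  have "1 / norm (1 - of_real r * e1 t) \<le> 2 / (u + t) + 2 / (u + (1 - t))"
  proof (cases "t \<le> 1 / 2")
    case True
    have "pi * t / pi \<le> sin (pi * t)" using t True by (intro sin_ge_div_pi) auto
    then have "t \<le> sin (pi * t)" by simp
    from inv[OF t(1) this] show ?thesis using pos by linarith
  next
    case False
    have "pi * (1 - t) / pi \<le> sin (pi * (1 - t))" using t False by (intro sin_ge_div_pi) auto
    also have "sin (pi * (1 - t)) = sin (pi * t)" by (simp add: right_diff_distrib)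
    finally have "1 - t \<le> sin (pi * t)" by simp
    from inv[OF _ this] show ?thesis using pos t by linarith
  qed
  moreover have "u + (1 - t) = 2 - r - t" by (simp add: u_def)
  ultimately have "1 / norm (1 - of_real r * e1 t) \<le> 2 / (u + t) + 2 / (2 - r - t)" by metis
  then show ?thesis unfolding u_def .
qed

lemma inverse_distance_majorant_integral:
  fixes r :: real
  assumes r: "r < 1"
  shows "((\<lambda>t. 2 / (1 - r + t) + 2 / (2 - r - t)) has_integral 4 * (ln (2 - r) - ln (1 - r))) {0..1}"
proof -
  define F where "F = (\<lambda>t. 2 * ln (1 - r + t) - 2 * ln (2 - r - t))"
  have "((\<lambda>t. 2 / (1 - r + t) + 2 / (2 - r - t)) has_integral F 1 - F 0) {0..1}"
  proof (rule fundamental_theorem_of_calculus)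
    fix t :: real assume "t \<in> {0..1}"
    then have "1 - r + t > 0" "2 - r - t > 0" using r by auto
    then have "(F has_real_derivative 2 / (1 - r + t) + 2 / (2 - r - t)) (at t within {0..1})"
      unfolding F_def by (auto intro!: derivative_eq_intros)
    then show "(F has_vector_derivative 2 / (1 - r + t) + 2 / (2 - r - t)) (at t within {0..1})"
      by (simp add: has_real_derivative_iff_has_vector_derivative)
  qed simp
  moreover have "F 1 - F 0 = 4 * (ln (2 - r) - ln (1 - r))" by (simp add: F_def)
  ultimately show ?thesis by simp
qed

lemma bounded_coeffs_summable:
  fixes c :: "nat \<Rightarrow> complex"
  assumes c: "\<And>n. norm (c n) \<le> 1" and z: "norm z < 1"
  shows "summable (\<lambda>n. c n * z ^ n)"
proof (rule summable_comparison_test')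
  show "summable (\<lambda>n. norm z ^ n)" using z by (intro summable_geometric) simp
  show "norm (c n * z ^ n) \<le> norm z ^ n" for n
    using mult_right_mono[OF c[of n], of "norm z ^ n"] by (simp add: norm_mult norm_power)
qed

lemma bounded_coeffs_conv_radius:
  fixes c :: "nat \<Rightarrow> complex"
  assumes c: "\<And>n. norm (c n) \<le> 1"
  shows "fps_conv_radius (Abs_fps c) \<ge> 1"
  unfolding fps_conv_radius_def
proof (rule conv_radius_geI_ex')
  fix r :: real assume "0 < r" "ereal r < 1"
  then show "summable (\<lambda>n. fps_nth (Abs_fps c) n * of_real r ^ n)"
    using bounded_coeffs_summable[of c "of_real r"] c by simp
qed

text \<open>Division by 1 - z turns coefficients into partial sums. Taking the supremum of the
  series out of the integral leaves the mean of 1/|1 - z| over the circle, which is only logarithmic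
  in 1/(1 - r).\<close>

lemma partial_sum_bound_of_power_series_bound:
  fixes c :: "nat \<Rightarrow> complex" and r H :: real
  assumes c: "\<And>n. norm (c n) \<le> 1" and r: "1 / 2 \<le> r" "r < 1"
    and H: "\<And>t. norm (\<Sum>n. c n * (of_real r * e1 t) ^ n) \<le> H"
  shows "norm (\<Sum>n\<le>N. c n) \<le> 4 * H / r ^ N * (ln (2 - r) - ln (1 - r))"
proof -
  define A where "A = Abs_fps c"
  define G :: "complex fps" where "G = Abs_fps (\<lambda>_. 1)"
  define F where "F = A * G"
  define S where "S = (\<Sum>n\<le>N. c n)"
  have rA: "fps_conv_radius A \<ge> 1" unfolding A_def by (rule bounded_coeffs_conv_radius[OF c])
  have rG: "fps_conv_radius G \<ge> 1" unfolding G_def by (rule bounded_coeffs_conv_radius) simp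
  have rF: "fps_conv_radius F \<ge> 1" unfolding F_def
    using rA rG by (intro order_trans[OF _ fps_conv_radius_mult]) simp
  have eval: "eval_fps F z = (\<Sum>n. c n * z ^ n) / (1 - z)" if z: "norm z < 1" for z
  proof -
    have "ereal (norm z) < 1" using z by simp
    then have "eval_fps F z = eval_fps A z * eval_fps G z"
      unfolding F_def using rA rG by (intro eval_fps_mult) (blast intro: less_le_trans)+
    also have "eval_fps G z = 1 / (1 - z)" using z by (simp add: eval_fps_def G_def suminf_geometric)
    finally show ?thesis by (simp add: eval_fps_def A_def)
  qed
  have hol: "eval_fps F holomorphic_on ball 0 1"
  proof (rule holomorphic_on_eval_fps, rule subsetI)
    fix z :: complex assume "z \<in> ball 0 1"
    then have "ereal (norm z) < 1" by simp
    then show "z \<in> eball 0 (fps_conv_radius F)" using less_le_trans[OF _ rF] by (simp add: eball_def)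
  qed
  have "fps_nth F N = S" by (simp add: F_def A_def G_def fps_mult_nth S_def atLeast0AtMost)
  moreover have "fps_nth F N = (deriv ^^ N) (eval_fps F) 0 / fact N"
    by (rule fps_nth_conv_deriv) (use rF in \<open>auto intro: less_le_trans[of 0 1]\<close>)
  ultimately have dS: "(deriv ^^ N) (eval_fps F) 0 = S * fact N" by (simp add: field_simps)
  have "((\<lambda>u. eval_fps F u / (u - 0) ^ Suc N) has_contour_integral 2 * pi * \<i> / fact N * (deriv ^^ N) (eval_fps F) 0) (circlepath 0 r)"
    using r hol by (intro Cauchy_has_contour_integral_higher_derivative_circlepath)
      (auto intro!: holomorphic_on_imp_continuous_on holomorphic_on_subset[OF hol])
  then have ci: "((\<lambda>u. eval_fps F u / u ^ Suc N) has_contour_integral 2 * pi * \<i> * S) (circlepath 0 r)"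
    unfolding dS by (simp add: mult.assoc)
  define g where "g = (\<lambda>t. eval_fps F (of_real r * e1 t) / (of_real r * e1 t) ^ N * (2 * pi * \<i>))"
  have e1e: "exp (2 * of_real pi * \<i> * of_real t) = e1 t" for t
    by (simp add: e1_def cis_conv_exp mult_ac)
  have nz: "of_real r * e1 t \<noteq> 0" for t using r by (simp add: e1_def)
  have gi: "(g has_integral 2 * pi * \<i> * S) {0..1}"
  proof (rule has_integral_eq[OF _ ci[unfolded has_contour_integral_def]])
    fix t :: real assume t: "t \<in> {0..1}"
    have "circlepath 0 r t = of_real r * e1 t" by (simp add: circlepath e1e)
    moreover have "vector_derivative (circlepath 0 r) (at t within {0..1}) = 2 * pi * \<i> * of_real r * exp (2 * of_real pi * \<i> * of_real t)"
      using t by (intro vector_derivative_circlepath01) auto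
    then have "vector_derivative (circlepath 0 r) (at t within {0..1}) = 2 * pi * \<i> * (of_real r * e1 t)"
      unfolding e1e by (simp only: mult.assoc)
    ultimately show "eval_fps F (circlepath 0 r t) / circlepath 0 r t ^ Suc N * vector_derivative (circlepath 0 r) (at t within {0..1}) = g t"
      using nz[of t] by (simp add: g_def)
  qed
  define h where "h = (\<lambda>t. (2 * pi * H / r ^ N) * (2 / (1 - r + t) + 2 / (2 - r - t)))"
  have hi: "(h has_integral (2 * pi * H / r ^ N) * (4 * (ln (2 - r) - ln (1 - r)))) {0..1}"
    unfolding h_def by (intro has_integral_mult_right inverse_distance_majorant_integral r)
  have H0: "H \<ge> 0" using H[of 0] norm_ge_zero order_trans by blast
  have "norm (integral {0..1} g) \<le> integral {0..1} h"
  proof (rule integral_norm_bound_integral)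
    fix t :: real assume t: "t \<in> {0..1}"
    have nr: "norm (of_real r * e1 t) = r" using r by (simp add: norm_mult)
    have "norm (g t) = norm (\<Sum>n. c n * (of_real r * e1 t) ^ n) * (1 / norm (1 - of_real r * e1 t)) * (2 * pi / r ^ N)"
      using r by (simp add: g_def eval nr norm_mult norm_divide norm_power)
    also have "\<dots> \<le> H * (2 / (1 - r + t) + 2 / (2 - r - t)) * (2 * pi / r ^ N)"
      using H0 r t by (intro mult_right_mono mult_mono[OF H inverse_distance_bound]) auto
    finally show "norm (g t) \<le> h t" by (simp add: h_def mult_ac)
  qed (use gi hi in blast)+
  then have "norm (2 * pi * \<i> * S) \<le> (2 * pi * H / r ^ N) * (4 * (ln (2 - r) - ln (1 - r)))"
    using integral_unique[OF gi] integral_unique[OF hi] by simp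
  then have "2 * pi * norm S \<le> 2 * pi * (4 * H / r ^ N * (ln (2 - r) - ln (1 - r)))"
    by (simp add: norm_mult mult_ac)
  then show ?thesis unfolding S_def using pi_gt_zero by (simp only: mult_le_cancel_left_pos[of "2 * pi"] zero_less_mult_iff zero_less_numeral simp_thms)
qed

text \<open>Rotating z = exp(-1/x) e(t) replaces \<alpha> by \<alpha> + t, which is why
  \<open>H\<close> has to be uniform in \<beta>. The constant is 36 = 4 * 3 * 3, from r^(-N) \<le> e
  \<le> 3 and ln(2 - r) - ln(1 - r) \<le> 3 ln x.\<close>

lemma S_mu_bound_of_smoothed:
  fixes x H :: real
  assumes x: "2 \<le> x"
    and H: "\<And>\<beta>. norm (\<Sum>n. of_int (mu (Suc n)) * e1 (\<beta> * real (Suc n)) * exp (- (of_nat (Suc n) / of_real x))) \<le> H"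
  shows "norm (S_mu x \<alpha>) \<le> 36 * H * ln x"
proof -
  define N where "N = nat \<lfloor>x\<rfloor>"
  define r where "r = exp (- (1 / x))"
  define c where "c = (\<lambda>n. of_int (mu n) * e1 (\<alpha> * real n))"
  have H0: "H \<ge> 0" using H[of 0] norm_ge_zero order_trans by blast
  have c: "norm (c n) \<le> 1" for n using norm_mu_le[of n] by (simp add: c_def norm_mult)
  have r1: "1 / 2 \<le> r"
  proof -
    have "1 / x \<le> 1 / 2" using x by (intro divide_left_mono) auto
    then show ?thesis unfolding r_def using exp_ge_add_one_self[of "- (1 / x)"] by linarith
  qed
  have r2: "r < 1" using x by (simp add: r_def)
  have u: "1 / (2 * x) \<le> 1 - r"
  proof -
    have "1 + 1 / x \<le> exp (1 / x)" by simp
    moreover have "r * exp (1 / x) = 1" by (simp add: r_def flip: exp_add)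
    ultimately have "r * (1 + 1 / x) \<le> 1" using mult_left_mono[of "1 + 1 / x" "exp (1 / x)" r] by (simp add: r_def)
    moreover have "r * (1 + 1 / x) = r + r / x" by (simp add: distrib_left)
    moreover have "1 / 2 / x \<le> r / x" using r1 x by (intro divide_right_mono) auto
    ultimately show ?thesis by simp
  qed
  have smooth: "norm (\<Sum>n. c n * (of_real r * e1 t) ^ n) \<le> H" for t
  proof -
    have sm: "summable (\<lambda>n. c n * (of_real r * e1 t) ^ n)"
      using r1 r2 by (intro bounded_coeffs_summable c) (simp add: norm_mult)
    have "c 0 = 0" by (simp add: c_def mu_def)
    then have "(\<Sum>n. c n * (of_real r * e1 t) ^ n) = (\<Sum>n. c (Suc n) * (of_real r * e1 t) ^ Suc n)"
      using suminf_split_head[OF sm] by (simp del: power_Suc)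
    also have "\<dots> = (\<Sum>n. of_int (mu (Suc n)) * e1 ((\<alpha> + t) * real (Suc n)) * exp (- (of_nat (Suc n) / of_real x)))"
    proof (rule suminf_cong)
      fix n
      define m where "m = Suc n"
      have "(of_real r * e1 t) ^ m = of_real (r ^ m) * e1 t ^ m" by (simp add: power_mult_distrib)
      also have "r ^ m = exp (- (real m / x))" unfolding r_def by (simp flip: exp_of_nat_mult)
      also have "of_real (exp (- (real m / x))) = exp (- (of_nat m / of_real x) :: complex)" by (simp flip: exp_of_real)
      also have "e1 t ^ m = e1 (t * real m)" unfolding e1_def Complex.DeMoivre by (simp add: mult_ac)
      finally have "c m * (of_real r * e1 t) ^ m = of_int (mu m) * e1 ((\<alpha> + t) * real m) * exp (- (of_nat m / of_real x))"
        unfolding c_def distrib_right[of \<alpha> t "real m"] e1_add by (simp add: mult_ac)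
      then show "c (Suc n) * (of_real r * e1 t) ^ Suc n = of_int (mu (Suc n)) * e1 ((\<alpha> + t) * real (Suc n)) * exp (- (of_nat (Suc n) / of_real x))"
        unfolding m_def .
    qed
    finally show ?thesis using H by simp
  qed
  have "S_mu x \<alpha> = (\<Sum>n\<in>{1..N}. c n)"
    unfolding S_mu_def N_def c_def e1_def cis_conv_exp by (intro sum.cong refl) (simp add: mult_ac)
  also have "\<dots> = (\<Sum>n\<le>N. c n)" by (rule sum.mono_neutral_left) (auto simp: c_def mu_def)
  finally have "norm (S_mu x \<alpha>) \<le> 4 * H / r ^ N * (ln (2 - r) - ln (1 - r))"
    using partial_sum_bound_of_power_series_bound[of c r H N, OF c r1 r2 smooth] by simp
  also have "\<dots> = 4 * H * (1 / r ^ N) * (ln (2 - r) - ln (1 - r))" by simp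
  also have "\<dots> \<le> 4 * H * 3 * (3 * ln x)"
  proof (intro mult_mono)
    have "real N \<le> x" using x by (simp add: N_def)
    then have "real N / x \<le> 1" using x by simp
    moreover have "1 / r ^ N = exp (real N / x)" by (simp add: r_def exp_minus divide_inverse power_inverse flip: exp_of_nat_mult)
    ultimately show "1 / r ^ N \<le> 3" using exp_le order_trans[of "exp (real N / x)" "exp 1" 3] by simp
    have "ln (2 - r) \<le> ln 2" using r1 r2 by simp
    moreover have "ln (1 / (2 * x)) \<le> ln (1 - r)" using u x r2 by (subst ln_le_cancel_iff) auto
    moreover have "ln (1 / (2 * x)) = - ln 2 - ln x" using x by (simp add: ln_div ln_mult)
    moreover have "ln 2 \<le> ln x" using x by simp
    ultimately show "ln (2 - r) - ln (1 - r) \<le> 3 * ln x" by linarith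
    show "0 \<le> ln (2 - r) - ln (1 - r)" using r2 by simp
  qed (use H0 r1 in auto)
  finally show ?thesis by simp
qed

theorem theorem2:
  fixes a :: real
  assumes "1/2 \<le> a" and "a < 1"
    and "\<forall>l\<ge>1. \<forall>\<psi>\<in>dchars l. \<forall>s\<in>L_dom l \<psi>. Re s > a \<longrightarrow> L_fun l \<psi> s \<noteq> 0"
    and "\<forall>\<epsilon>>0. \<exists>C. \<forall>l\<ge>1. \<forall>T\<ge>10. \<forall>\<sigma>. 1/2 \<le> \<sigma> \<and> \<sigma> \<le> 1 \<longrightarrow>
           \<bar>\<Sum>\<psi>\<in>dchars l. N_zeros l \<psi> \<sigma> T\<bar> \<le> C * (real l * T) powr (2 - 2 * \<sigma> + \<epsilon>)"
  shows "\<forall>\<epsilon>>0. \<exists>C. \<forall>x\<ge>2. \<forall>\<alpha>\<in>{0..1}. norm (S_mu x \<alpha>) \<le> C * x powr ((1 + a) / 2 + \<epsilon>)"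
proof (intro allI impI)
  fix \<epsilon> :: real assume "\<epsilon> > 0"
  then have \<epsilon>: "\<epsilon> / 2 > 0" by simp
  have zf: "zero_free a" unfolding zero_free_def by (rule assms(3))
  obtain C where C: "C > 0" "\<And>x \<alpha>. 2 \<le> x \<Longrightarrow>
      norm (\<Sum>n. of_int (mu (Suc n)) * e1 (\<alpha> * real (Suc n)) * exp (- (of_nat (Suc n) / of_real x))) \<le> C * x powr ((1 + a) / 2 + \<epsilon> / 2)"
    by (rule smoothed_sum_bound[OF assms(1,2) zf \<epsilon> assms(4)]) (rule that)
  show "\<exists>C. \<forall>x\<ge>2. \<forall>\<alpha>\<in>{0..1}. norm (S_mu x \<alpha>) \<le> C * x powr ((1 + a) / 2 + \<epsilon>)"
  proof (intro exI allI ballI impI)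
    fix x \<alpha> :: real assume x: "2 \<le> x"
    have "norm (S_mu x \<alpha>) \<le> 36 * (C * x powr ((1 + a) / 2 + \<epsilon> / 2)) * ln x"
      by (rule S_mu_bound_of_smoothed[OF x C(2)[OF x]])
    \<comment> \<open>The reserved half of \<epsilon> pays for the logarithm.\<close>
    also have "\<dots> \<le> 36 * (C * x powr ((1 + a) / 2 + \<epsilon> / 2)) * (x powr (\<epsilon> / 2) / (\<epsilon> / 2))"
      using x \<epsilon> C(1) by (intro mult_left_mono ln_powr_bound) auto
    also have "\<dots> = 36 * C / (\<epsilon> / 2) * (x powr ((1 + a) / 2 + \<epsilon> / 2) * x powr (\<epsilon> / 2))" by simp
    also have "x powr ((1 + a) / 2 + \<epsilon> / 2) * x powr (\<epsilon> / 2) = x powr ((1 + a) / 2 + \<epsilon>)"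
      by (simp add: add.commute flip: powr_add)
    finally show "norm (S_mu x \<alpha>) \<le> 36 * C / (\<epsilon> / 2) * x powr ((1 + a) / 2 + \<epsilon>)" .
  qed
qed

end
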